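(* For all $\nu=(\nu_1,\nu_2,\nu_3)\in\mathbb{R}^3$ and all $\zeta\in\mathbb{R}^3$, $$\varphi_{\mathrm{FCC}}(\nu)=|\nu_1+\nu_2|+|\nu_1+\nu_3|+|\nu_2+\nu_3|+|\nu_1-\nu_2|+|\nu_1-\nu_3|+|\nu_2-\nu_3|$$ and $$\varphi_{\mathrm{FCC}}^\circ(\zeta)=\max\left\{\tfrac14\|\zeta\|_\infty,\tfrac16\|\zeta\|_1\right\}.$$ In particular, $W_{\mathrm{FCC}}$ is a truncated octahedron and its surface energy per unit volume is $$|W_{\mathrm{FCC}}|^{-2/3}\int_{\partial^*W_{\mathrm{FCC}}}\varphi_{\mathrm{FCC}}(\nu)\,d\mathcal{H}^2=3\cdot2^2\cdot2^{2/3}.$$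
   Context: $b_1=\frac1{\sqrt2}(1,1,0)$, $b_2=\frac1{\sqrt2}(1,0,1)$, $b_3=\frac1{\sqrt2}(0,1,1)$, and $\mathcal{L}=\mathcal{L}_{\mathrm{FCC}}=\mathrm{span}_{\mathbb{Z}}\{b_1,b_2,b_3\}$. For $x\in\mathcal{L}$, $\mathcal{N}(x)=\{y\in\mathcal{L}\colon|x-y|=1\}=x+\{\pm b_1,\pm b_2,\pm b_3,\pm(b_1-b_2),\pm(b_1-b_3),\pm(b_2-b_3)\}$. For $X\subset\mathcal{L}$, $A\subset\mathbb{R}^3$, let $E_{\mathcal{L}}(X,A)=\sum_{x\in X\cap A}(12-\#(\mathcal{N}(x)\cap X))$. For $\nu\in\mathbb{S}^2$ let $Q^\nu_T$ be an open cube of side $T$ centered at the origin with faces parallel and orthogonal to $\nu$, and $u_\nu(x)=1$ if $\langle x,\nu\rangle\ge0$, $u_\nu(x)=0$ otherwise. $\varphi_{\mathrm{FCC}}\colon\mathbb{R}^3\to[0,+\infty)$ is the convex, positively 1-homogeneous function such that for $\nu\in\mathbb{S}^2$ $$\varphi_{\mathrm{FCC}}(\nu)=\lim_{T\to+\infty}\frac1{T^2}\inf\{E_{\mathcal{L}}(X,Q^\nu_T)\colon X\subset\mathcal{L},\ \chi_X(i)=u_\nu(i)\text{ for }i\in\mathcal{L}\setminus Q^\nu_{T-3}\}.$$ The polar function is $\varphi^\circ(\xi)=\sup_{\nu\in\mathbb{S}^2}\langle\nu,\xi\rangle/\varphi(\nu)$ and the Wulff set is $W_{\mathrm{FCC}}=\{\zeta\in\mathbb{R}^3\colon\langle\zeta,\nu\rangle\le\varphi_{\mathrm{FCC}}(\nu)\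 \forall\nu\in\mathbb{S}^2\}=\{\varphi_{\mathrm{FCC}}^\circ\le1\}$. $\partial^*W$ is the reduced boundary and $\nu$ its outer unit normal. $\|\cdot\|_\infty$ and $\|\cdot\|_1$ are the max and $\ell^1$ norms on $\mathbb{R}^3$. *)

theory Defs
  imports "HOL-Analysis.Analysis"
begin

section \<open>The face-centred cubic lattice and its surface energy\<close>

definition fcc_basis1 :: "real ^ 3" where
  "fcc_basis1 = (1 / sqrt 2) *\<^sub>R vector [1, 1, 0]"

definition fcc_basis2 :: "real ^ 3" where
  "fcc_basis2 = (1 / sqrt 2) *\<^sub>R vector [1, 0, 1]"

definition fcc_basis3 :: "real ^ 3" where
  "fcc_basis3 = (1 / sqrt 2) *\<^sub>R vector [0, 1, 1]"

definition fcc_lattice :: "(real ^ 3) set" where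
  "fcc_lattice =
     {x. \<exists>k l m :: int. x = of_int k *\<^sub>R fcc_basis1 + of_int l *\<^sub>R fcc_basis2 + of_int m *\<^sub>R fcc_basis3}"

definition fcc_neighbours :: "real ^ 3 \<Rightarrow> (real ^ 3) set" where
  "fcc_neighbours x = {y \<in> fcc_lattice. norm (x - y) = 1}"

text \<open>Only meaningful when \<open>X \<inter> A\<close> is finite; below, \<open>X\<close> is a subset of the lattice and \<open>A\<close>
  is a cube.\<close>

definition fcc_energy :: "(real ^ 3) set \<Rightarrow> (real ^ 3) set \<Rightarrow> real" where
  "fcc_energy X A = (\<Sum>x\<in>X \<inter> A. 12 - real (card (fcc_neighbours x \<inter> X)))"

text \<open>A cube centred at the origin with faces parallel and orthogonal to \<open>\<nu>\<close> is given by its side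
  and by an orthonormal basis containing \<open>\<nu>\<close>. For \<open>T \<le> 0\<close> the cube is empty.\<close>

definition orthonormal_basis_through :: "real ^ 3 \<Rightarrow> (real ^ 3) set \<Rightarrow> bool" where
  "orthonormal_basis_through \<nu> B \<longleftrightarrow>
     \<nu> \<in> B \<and> card B = 3 \<and> pairwise orthogonal B \<and> (\<forall>b\<in>B. norm b = 1)"

definition open_cube :: "(real ^ 3) set \<Rightarrow> real \<Rightarrow> (real ^ 3) set" where
  "open_cube B T = {x. \<forall>b\<in>B. \<bar>x \<bullet> b\<bar> < T / 2}"

definition half_space_indicator :: "real ^ 3 \<Rightarrow> real ^ 3 \<Rightarrow> real" where
  "half_space_indicator \<nu> x = (if x \<bullet> \<nu> \<ge> 0 then 1 else 0)"

definition admissible_configurations ::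
    "real ^ 3 \<Rightarrow> (real ^ 3) set \<Rightarrow> real \<Rightarrow> (real ^ 3) set set" where
  "admissible_configurations \<nu> B T =
     {X. X \<subseteq> fcc_lattice \<and>
         (\<forall>i \<in> fcc_lattice - open_cube B (T - 3). indicator X i = half_space_indicator \<nu> i)}"

text \<open>The cubes are determined by \<open>\<nu>\<close> only up to a rotation about the axis \<open>\<nu>\<close>; the defining
  limit is required for every choice.\<close>

definition is_fcc_surface_density :: "(real ^ 3 \<Rightarrow> real) \<Rightarrow> bool" where
  "is_fcc_surface_density \<phi> \<longleftrightarrow>
     convex_on UNIV \<phi> \<and>
     (\<forall>\<nu>. 0 \<le> \<phi> \<nu>) \<and>
     (\<forall>\<nu> t. 0 \<le> t \<longrightarrow> \<phi> (t *\<^sub>R \<nu>) = t * \<phi> \<nu>) \<and>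
     (\<forall>\<nu> B. norm \<nu> = 1 \<and> orthonormal_basis_through \<nu> B \<longrightarrow>
        ((\<lambda>T. 1 / T\<^sup>2 * (INF X\<in>admissible_configurations \<nu> B T. fcc_energy X (open_cube B T)))
          \<longlongrightarrow> \<phi> \<nu>) at_top)"

definition phi_FCC :: "real ^ 3 \<Rightarrow> real" where
  "phi_FCC = (THE \<phi>. is_fcc_surface_density \<phi>)"

section \<open>Polar function and Wulff set\<close>

definition polar_function :: "(real ^ 3 \<Rightarrow> real) \<Rightarrow> real ^ 3 \<Rightarrow> real" where
  "polar_function \<phi> \<xi> = (SUP \<nu>\<in>sphere 0 1. (\<nu> \<bullet> \<xi>) / \<phi> \<nu>)"

definition wulff_set :: "(real ^ 3 \<Rightarrow> real) \<Rightarrow> (real ^ 3) set" where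
  "wulff_set \<phi> = {\<zeta>. \<forall>\<nu>\<in>sphere 0 1. \<zeta> \<bullet> \<nu> \<le> \<phi> \<nu>}"

definition W_FCC :: "(real ^ 3) set" where
  "W_FCC = wulff_set phi_FCC"

text \<open>The Archimedean solid, up to similarity: its standard model is the convex hull of the 24
  permutations of \<open>(0, \<plusminus>1, \<plusminus>2)\<close>, the trisection points of the edges of the regular octahedron with
  vertices \<open>(\<plusminus>3, 0, 0)\<close>, \<open>(0, \<plusminus>3, 0)\<close>, \<open>(0, 0, \<plusminus>3)\<close>.\<close>

definition is_truncated_octahedron :: "(real ^ 3) set \<Rightarrow> bool" where
  "is_truncated_octahedron P \<longleftrightarrow>
     (\<exists>c r f. 0 < r \<and> orthogonal_transformation f \<and>
        P = (\<lambda>x. c + r *\<^sub>R f x) ` (convex hull {v :: real ^ 3. range (\<lambda>i. \<bar>v $ i\<bar>) = {0, 1, 2}}))"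

section \<open>Hausdorff measure\<close>

text \<open>For \<open>s > 0\<close>, with the usual normalization by the volume of the unit ball.\<close>

definition hausdorff_premeasure :: "real \<Rightarrow> real \<Rightarrow> 'a::metric_space set \<Rightarrow> ennreal" where
  "hausdorff_premeasure s \<delta> A =
     (INF C \<in> {C :: nat \<Rightarrow> 'a set. A \<subseteq> (\<Union>i. C i) \<and> (\<forall>i. bounded (C i) \<and> diameter (C i) \<le> \<delta>)}.
        \<Sum>i. ennreal (unit_ball_vol s * (diameter (C i) / 2) powr s))"

definition hausdorff_outer_measure :: "real \<Rightarrow> 'a::metric_space set \<Rightarrow> ennreal" where
  "hausdorff_outer_measure s A = (SUP \<delta>\<in>{0<..}. hausdorff_premeasure s \<delta> A)"

definition hausdorff_measure :: "real \<Rightarrow> 'a::metric_space measure" where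
  "hausdorff_measure s = measure_of UNIV (sets borel) (hausdorff_outer_measure s)"

section \<open>Reduced boundary and outer unit normal\<close>

definition C1_vector_field :: "(real ^ 'n \<Rightarrow> real ^ 'n) \<Rightarrow> bool" where
  "C1_vector_field F \<longleftrightarrow>
     (\<forall>x. F differentiable at x) \<and> continuous_on UNIV (\<lambda>x. jacobian F (at x))"

definition divergence :: "(real ^ 'n \<Rightarrow> real ^ 'n) \<Rightarrow> real ^ 'n \<Rightarrow> real" where
  "divergence F x = trace (jacobian F (at x))"

text \<open>\<open>E\<close> has locally finite perimeter, and the distributional gradient of its characteristic
  function is \<open>-\<sigma> M\<close>, where \<open>M\<close> is the total variation and \<open>\<bar>\<sigma>\<bar> = 1\<close> (polar decomposition).
  Given \<open>E\<close>, \<open>M\<close> is unique and \<open>\<sigma>\<close> is unique \<open>M\<close>-almost everywhere.\<close>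

definition is_gauss_green_measure ::
    "(real ^ 'n) set \<Rightarrow> (real ^ 'n) measure \<Rightarrow> (real ^ 'n \<Rightarrow> real ^ 'n) \<Rightarrow> bool" where
  "is_gauss_green_measure E M \<sigma> \<longleftrightarrow>
     E \<in> sets lebesgue \<and>
     sets M = sets borel \<and> (\<forall>K. compact K \<longrightarrow> emeasure M K < \<infinity>) \<and>
     \<sigma> \<in> borel_measurable M \<and> (AE x in M. norm (\<sigma> x) = 1) \<and>
     (\<forall>F. C1_vector_field F \<and> compact (closure {x. F x \<noteq> 0}) \<longrightarrow>
        (LINT x:E|lebesgue. divergence F x) = (LINT x|M. F x \<bullet> \<sigma> x))"

text \<open>De Giorgi's definition; the sign of \<open>\<sigma>\<close> makes \<open>n\<close> the outer normal.\<close>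

definition is_outer_normal_at :: "(real ^ 'n) set \<Rightarrow> real ^ 'n \<Rightarrow> real ^ 'n \<Rightarrow> bool" where
  "is_outer_normal_at E x n \<longleftrightarrow>
     (\<exists>M \<sigma>. is_gauss_green_measure E M \<sigma> \<and>
        (\<forall>r>0. 0 < emeasure M (ball x r)) \<and>
        norm n = 1 \<and>
        ((\<lambda>r. (LINT y:ball x r|M. \<sigma> y) /\<^sub>R measure M (ball x r)) \<longlongrightarrow> n) (at_right 0))"

definition reduced_boundary :: "(real ^ 'n) set \<Rightarrow> (real ^ 'n) set" where
  "reduced_boundary E = {x. \<exists>n. is_outer_normal_at E x n}"

definition outer_normal :: "(real ^ 'n) set \<Rightarrow> real ^ 'n \<Rightarrow> real ^ 'n" where
  "outer_normal E x = (THE n. is_outer_normal_at E x n)"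

definition surface_energy :: "(real ^ 3 \<Rightarrow> real) \<Rightarrow> (real ^ 3) set \<Rightarrow> real" where
  "surface_energy \<phi> E = (LINT x:reduced_boundary E|hausdorff_measure 2. \<phi> (outer_normal E x))"

end

theory Submission
  imports Defs
begin

text \<open>
  The energy of a configuration is the sum, over the twelve bond directions \<open>v\<close>, of the number of bonds
  that leave the configuration in direction \<open>v\<close>. Every lattice line of direction \<open>v\<close> that crosses the
  interface of the half space contributes at least one such bond to every admissible configuration, so
  the half space is a minimiser. Its energy is found by counting lattice points in the layers
  \<open>0 \<le> x \<bullet> \<nu> < - (v \<bullet> \<nu>)\<close>: direction \<open>v\<close> contributes \<open>sqrt 2 * max 0 (- (v \<bullet> \<nu>))\<close> per unit area.
  The resulting density equals \<open>4\<close> times the largest plus \<open>2\<close> times the second largest of the numbers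
  \<open>\<bar>\<nu> $ i\<bar>\<close>, from which the polar function follows by summation by parts.

  The Wulff set is a polytope with unit facet normals \<open>n\<close> at distances \<open>\<phi> n\<close> from the origin, so the
  divergence theorem for the identity field turns its surface energy into three times its volume
  \<open>256\<close>. That theorem has to be read with the measure-theoretic data: the two-dimensional Hausdorff
  measure agrees with the area on planes by the isodiametric inequality and a Vitali covering, and the
  reduced boundary is the union of the relative interiors of the facets, because an approximate normal
  at a point of a closed facet must be the normal of that facet.
\<close>

text \<open>An outer normal may be witnessed by any pair \<open>M\<close>, \<open>\<sigma>\<close>
  that represents the gradient of the body, while uniqueness is established only for the vector
  integrals of \<open>\<sigma>\<close> over balls. The mass of \<open>M\<close> on a ball therefore
  has no direct upper bound; it is bounded only after multiplication by the length of the averaged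
  normal, a factor that tends to 1.

  Planes carry two measures. The statement demands Hausdorff measure; the projected volume of a slab
  suits Tonelli along lines of any direction and gives the divergence theorem without charts. The
  first is reached from the second through isometric copies of the coordinate plane.

  The factor \<open>sqrt 2\<close> is the reciprocal of the covolume \<open>1 / sqrt 2\<close> of
  the lattice, and opposite bonds pair up to the absolute values in the density. The volume 256 is
  half of the cube of side 8 around the body, so the final ratio is three times the cube root of
  256.\<close>

section \<open>Hausdorff measure is a Borel measure\<close>

text \<open>Giving inadmissible covering sets the weight infinity turns the restricted infimum into
  the outer measure induced by a monotone set function, whose subadditivity is known. Monotonicity
  reconciles the arbitrary covers here with the disjoint covers in
  \<open>outer_measure\<close>.\<close>

lemma hausdorff_premeasure_eq_outer_measure:
  fixes A :: "'a::metric_space set"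
  assumes "0 < s"
  defines "f \<equiv> (\<lambda>\<delta> C :: 'a set. if bounded C \<and> diameter C \<le> \<delta>
     then ennreal (unit_ball_vol s * (diameter C / 2) powr s) else \<infinity>)"
  assumes "0 \<le> \<delta>"
  shows "positive (Pow UNIV) (f \<delta>)" "increasing (Pow UNIV) (f \<delta>)"
    "hausdorff_premeasure s \<delta> A = outer_measure (Pow UNIV) (f \<delta>) A"
proof -
  interpret ring_of_sets UNIV "Pow UNIV :: 'a set set" by (rule ring_of_sets_Pow)
  show pos: "positive (Pow UNIV) (f \<delta>)"
    using assms by (simp add: positive_def f_def diameter_def)
  show inc: "increasing (Pow UNIV) (f \<delta>)"
    unfolding increasing_def
  proof (intro ballI impI)
    fix x y :: "'a set" assume "x \<subseteq> y"
    show "f \<delta> x \<le> f \<delta> y"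
    proof (cases "bounded y \<and> diameter y \<le> \<delta>")
      case True
      then have b: "bounded x" and d: "diameter x \<le> diameter y"
        using bounded_subset \<open>x \<subseteq> y\<close> diameter_subset by blast+
      have "unit_ball_vol s * (diameter x / 2) powr s \<le> unit_ball_vol s * (diameter y / 2) powr s"
        using d diameter_ge_0[OF b] assms(1)
        by (intro mult_left_mono powr_mono2) auto
      then show ?thesis using True b d by (simp add: f_def ennreal_leI)
    next
      case False then show ?thesis by (simp only: f_def if_False) simp
    qed
  qed
  show "hausdorff_premeasure s \<delta> A = outer_measure (Pow UNIV) (f \<delta>) A"
  proof (rule antisym)
    show "outer_measure (Pow UNIV) (f \<delta>) A \<le> hausdorff_premeasure s \<delta> A"
      unfolding hausdorff_premeasure_def
    proof (rule INF_greatest)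
      fix C :: "nat \<Rightarrow> 'a set" 
      assume C: "C \<in> {C. A \<subseteq> (\<Union>i. C i) \<and> (\<forall>i. bounded (C i) \<and> diameter (C i) \<le> \<delta>)}"
      have "outer_measure (Pow UNIV) (f \<delta>) A \<le> (\<Sum>i. f \<delta> (C i))"
        by (rule outer_measure_le[OF pos inc]) (use C in auto)
      also have "\<dots> = (\<Sum>i. ennreal (unit_ball_vol s * (diameter (C i) / 2) powr s))"
        using C by (intro arg_cong[where f = suminf]) (auto simp: f_def)
      finally show "outer_measure (Pow UNIV) (f \<delta>) A
        \<le> (\<Sum>i. ennreal (unit_ball_vol s * (diameter (C i) / 2) powr s))" .
    qed
    show "hausdorff_premeasure s \<delta> A \<le> outer_measure (Pow UNIV) (f \<delta>) A"
      unfolding outer_measure_def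
    proof (rule INF_greatest)
      fix C :: "nat \<Rightarrow> 'a set" 
      assume C: "C \<in> {B. range B \<subseteq> Pow UNIV \<and> disjoint_family B \<and> A \<subseteq> \<Union> (range B)}"
      show "hausdorff_premeasure s \<delta> A \<le> (\<Sum>i. f \<delta> (C i))"
      proof (cases "\<forall>i. bounded (C i) \<and> diameter (C i) \<le> \<delta>")
        case True
        then have "(\<Sum>i. f \<delta> (C i)) = (\<Sum>i. ennreal (unit_ball_vol s * (diameter (C i) / 2) powr s))"
          by (intro arg_cong[where f = suminf]) (auto simp: f_def)
        with True C show ?thesis
          unfolding hausdorff_premeasure_def by (intro INF_lower2[of C]) auto
      next
        case False
        then obtain i where "\<not> (bounded (C i) \<and> diameter (C i) \<le> \<delta>)" by blast
        then have "f \<delta> (C i) = \<infinity>" by (simp only: f_def if_False)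
        moreover have "f \<delta> (C i) \<le> (\<Sum>i. f \<delta> (C i))"
          using sum_le_suminf[of "\<lambda>i. f \<delta> (C i)" "{i}"] by (simp add: summableI)
        ultimately show ?thesis by (simp add: top_unique)
      qed
    qed
  qed
qed

lemma hausdorff_premeasure_mono:
  "A \<subseteq> B \<Longrightarrow> hausdorff_premeasure s \<delta> A \<le> hausdorff_premeasure s \<delta> B"
  unfolding hausdorff_premeasure_def by (intro INF_superset_mono) auto

lemma hausdorff_premeasure_antimono:
  "\<delta> \<le> \<delta>' \<Longrightarrow> hausdorff_premeasure s \<delta>' A \<le> hausdorff_premeasure s \<delta> A"
  unfolding hausdorff_premeasure_def by (intro INF_superset_mono) (auto intro: order_trans)

lemma hausdorff_outer_measure_mono:
  "A \<subseteq> B \<Longrightarrow> hausdorff_outer_measure s A \<le> hausdorff_outer_measure s B"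
  unfolding hausdorff_outer_measure_def by (intro SUP_mono' hausdorff_premeasure_mono)

lemma hausdorff_premeasure_le:
  "0 < \<delta> \<Longrightarrow> hausdorff_premeasure s \<delta> A \<le> hausdorff_outer_measure s A"
  unfolding hausdorff_outer_measure_def by (intro SUP_upper) auto

lemma outer_measure_space_hausdorff_premeasure:
  assumes "0 < s" "0 < \<delta>"
  shows "outer_measure_space (Pow UNIV) (hausdorff_premeasure s \<delta> :: 'a::metric_space set \<Rightarrow> ennreal)"
proof -
  interpret ring_of_sets UNIV "Pow UNIV :: 'a set set" by (rule ring_of_sets_Pow)
  note E = hausdorff_premeasure_eq_outer_measure[OF assms(1), where 'a='a]
  have "(hausdorff_premeasure s \<delta> :: 'a set \<Rightarrow> ennreal) = outer_measure (Pow UNIV)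
    (\<lambda>C. if bounded C \<and> diameter C \<le> \<delta> then ennreal (unit_ball_vol s * (diameter C / 2) powr s) else \<infinity>)"
    using E(3)[of \<delta>] assms by (intro ext) simp
  then show ?thesis
    using outer_measure_space_outer_measure[OF E(1,2)[of \<delta>]] assms by (simp only: less_imp_le)
qed

lemma outer_measure_space_hausdorff:
  assumes "0 < s"
  shows "outer_measure_space (Pow UNIV) (hausdorff_outer_measure s :: 'a::metric_space set \<Rightarrow> ennreal)"
proof -
  note oms = outer_measure_space_hausdorff_premeasure[OF assms, where 'a='a]
  show ?thesis
    unfolding outer_measure_space_def
  proof (intro conjI)
    have "hausdorff_premeasure s \<delta> ({} :: 'a set) = 0" if "0 < \<delta>" for \<delta>
      using oms[OF that] by (simp add: outer_measure_space_def positive_def)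
    then show "positive (Pow UNIV) (hausdorff_outer_measure s :: 'a set \<Rightarrow> ennreal)"
      by (simp add: positive_def hausdorff_outer_measure_def)
    show "increasing (Pow UNIV) (hausdorff_outer_measure s :: 'a set \<Rightarrow> ennreal)"
      by (simp add: increasing_def hausdorff_outer_measure_mono)
    show "countably_subadditive (Pow UNIV) (hausdorff_outer_measure s :: 'a set \<Rightarrow> ennreal)"
      unfolding countably_subadditive_def
    proof (intro allI impI)
      fix A :: "nat \<Rightarrow> 'a set" assume A: "range A \<subseteq> Pow UNIV" "disjoint_family A" "\<Union> (range A) \<in> Pow UNIV"
      show "hausdorff_outer_measure s (\<Union> (range A)) \<le> (\<Sum>i. hausdorff_outer_measure s (A i))"
        unfolding hausdorff_outer_measure_def[of s "\<Union> (range A)"]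
      proof (rule SUP_least)
        fix \<delta> :: real assume "\<delta> \<in> {0<..}"
        then have "hausdorff_premeasure s \<delta> (\<Union> (range A)) \<le> (\<Sum>i. hausdorff_premeasure s \<delta> (A i))"
          using oms[of \<delta>] A by (auto simp: outer_measure_space_def countably_subadditive_def)
        also have "\<dots> \<le> (\<Sum>i. hausdorff_outer_measure s (A i))"
          using \<open>\<delta> \<in> _\<close> by (intro suminf_le hausdorff_premeasure_le summableI) auto
        finally show "hausdorff_premeasure s \<delta> (\<Union> (range A)) \<le> (\<Sum>i. hausdorff_outer_measure s (A i))" .
      qed
    qed
  qed
qed

text \<open>\<open>countably_subadditive\<close> speaks of disjoint families; disjointing the
  sequence and monotonicity extend it to all sequences.\<close>

lemma outer_measure_space_UN_le:
  assumes "outer_measure_space (Pow UNIV) \<mu>"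
  shows "\<mu> (\<Union>i::nat. A i) \<le> (\<Sum>i. \<mu> (A i))"
proof -
  have "\<mu> (\<Union>i. A i) = \<mu> (\<Union>i. disjointed A i)" by (simp add: UN_disjointed_eq)
  also have "\<dots> \<le> (\<Sum>i. \<mu> (disjointed A i))"
    using assms disjoint_family_disjointed[of A]
    by (simp add: outer_measure_space_def countably_subadditive_def)
  also have "\<dots> \<le> (\<Sum>i. \<mu> (A i))"
    using assms by (intro suminf_le summableI)
      (simp add: outer_measure_space_def increasing_def disjointed_subset)
  finally show ?thesis .
qed

lemma outer_measure_space_Un_le:
  assumes "outer_measure_space (Pow UNIV) \<mu>"
  shows "\<mu> (A \<union> B) \<le> \<mu> A + \<mu> B"
proof -
  interpret ring_of_sets UNIV "Pow UNIV :: 'a set set" by (rule ring_of_sets_Pow)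
  have "subadditive (Pow UNIV) \<mu>" "increasing (Pow UNIV) \<mu>"
    using assms countably_subadditive_subadditive by (auto simp: outer_measure_space_def)
  then have "\<mu> (A \<union> (B - A)) \<le> \<mu> A + \<mu> (B - A)" "\<mu> (B - A) \<le> \<mu> B"
    unfolding subadditive_def increasing_def by blast+
  then show ?thesis by (metis Un_Diff_cancel add_left_mono order_trans)
qed

text \<open>A set of diameter less than \<open>d\<close> cannot meet both \<open>A\<close> and
  \<open>B\<close>, so a fine cover of the union splits into a cover of \<open>A\<close> and a cover
  of \<open>B\<close> at no extra cost. This is the metric property from which measurability of
  closed sets follows.\<close>

lemma hausdorff_outer_measure_separated:
  fixes A B :: "'a::metric_space set"
  assumes "0 < s" "0 < d" and sep: "\<And>x y. x \<in> A \<Longrightarrow> y \<in> B \<Longrightarrow> d \<le> dist x y"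
  shows "hausdorff_outer_measure s A + hausdorff_outer_measure s B \<le> hausdorff_outer_measure s (A \<union> B)"
proof -
  have 1: "hausdorff_premeasure s \<delta> A + hausdorff_premeasure s \<delta> B \<le> hausdorff_premeasure s \<delta> (A \<union> B)"
    if "0 < \<delta>" "\<delta> < d" for \<delta>
    unfolding hausdorff_premeasure_def[of s \<delta> "A \<union> B"]
  proof (rule INF_greatest)
    fix C :: "nat \<Rightarrow> 'a set"
    assume "C \<in> {C. A \<union> B \<subseteq> (\<Union>i. C i) \<and> (\<forall>i. bounded (C i) \<and> diameter (C i) \<le> \<delta>)}"
    then have C: "A \<union> B \<subseteq> (\<Union>i. C i)" "\<And>i. bounded (C i)" "\<And>i. diameter (C i) \<le> \<delta>" by auto
    define g where "g = (\<lambda>C :: 'a set. ennreal (unit_ball_vol s * (diameter C / 2) powr s))"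
    have gm: "g X \<le> g Y" if "X \<subseteq> Y" "bounded Y" for X Y
      unfolding g_def using that \<open>0 < s\<close> diameter_ge_0[OF bounded_subset[OF that(2,1)]]
      by (intro ennreal_leI mult_left_mono powr_mono2) (auto simp: diameter_subset)
    have g0: "g {} = 0" by (simp add: g_def diameter_def \<open>0 < s\<close>)
    have le: "hausdorff_premeasure s \<delta> D \<le> (\<Sum>i. g (C i \<inter> D))" if "D \<subseteq> A \<union> B" for D
      unfolding hausdorff_premeasure_def g_def
    proof (rule INF_lower2[of "\<lambda>i. C i \<inter> D"])
      show "(\<lambda>i. C i \<inter> D) \<in> {C. D \<subseteq> (\<Union>i. C i) \<and> (\<forall>i. bounded (C i) \<and> diameter (C i) \<le> \<delta>)}"
        using C that by (auto intro: order_trans[OF diameter_subset] bounded_subset)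
    qed simp
    have "g (C i \<inter> A) + g (C i \<inter> B) \<le> g (C i)" for i
    proof -
      have "C i \<inter> A = {} \<or> C i \<inter> B = {}"
      proof (rule ccontr)
        assume "\<not> ?thesis"
        then obtain x y where "x \<in> C i" "x \<in> A" "y \<in> C i" "y \<in> B" by auto
        with sep[of x y] diameter_bounded_bound[OF C(2)[of i], of x y] C(3)[of i] that
        show False by auto
      qed
      then show ?thesis using gm[of "C i \<inter> A" "C i"] gm[of "C i \<inter> B" "C i"] C(2) g0 by auto
    qed
    then have "(\<Sum>i. g (C i \<inter> A) + g (C i \<inter> B)) \<le> (\<Sum>i. g (C i))"
      by (intro suminf_le summableI)
    also have "(\<Sum>i. g (C i \<inter> A) + g (C i \<inter> B)) = (\<Sum>i. g (C i \<inter> A)) + (\<Sum>i. g (C i \<inter> B))"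
      by (simp add: suminf_add)
    finally show "hausdorff_premeasure s \<delta> A + hausdorff_premeasure s \<delta> B \<le>
      (\<Sum>i. ennreal (unit_ball_vol s * (diameter (C i) / 2) powr s))"
      using add_mono[OF le[of A] le[of B]] by (simp add: g_def)
  qed
  have 2: "hausdorff_premeasure s \<delta> A + hausdorff_premeasure s \<delta>' B \<le> hausdorff_outer_measure s (A \<union> B)"
    if "0 < \<delta>" "0 < \<delta>'" for \<delta> \<delta>'
  proof -
    \<comment> \<open>Premeasures grow as the scale shrinks, so the two scales are replaced by a
      common one that also lies below \<open>d\<close>.\<close>
    define e where "e = min (d/2) (min \<delta> \<delta>')"
    have e: "0 < e" "e < d" "e \<le> \<delta>" "e \<le> \<delta>'" using that \<open>0 < d\<close> by (auto simp: e_def)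
    have "hausdorff_premeasure s \<delta> A + hausdorff_premeasure s \<delta>' B
      \<le> hausdorff_premeasure s e A + hausdorff_premeasure s e B"
      by (intro add_mono hausdorff_premeasure_antimono e)
    also have "\<dots> \<le> hausdorff_outer_measure s (A \<union> B)"
      using 1[OF e(1,2)] hausdorff_premeasure_le[OF e(1)] order_trans by blast
    finally show ?thesis .
  qed
  have ne: "{0<..} \<noteq> ({} :: real set)" using greaterThan_non_empty by blast
  have 3: "hausdorff_outer_measure s A + hausdorff_premeasure s \<delta>' B \<le> hausdorff_outer_measure s (A \<union> B)"
    if "0 < \<delta>'" for \<delta>'
    unfolding hausdorff_outer_measure_def[of s A] ennreal_SUP_add_left[OF ne]
    using 2[OF _ that]
    by (subst ennreal_SUP_add_left[symmetric, OF ne]) (auto intro!: SUP_least)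
  show ?thesis
    unfolding hausdorff_outer_measure_def[of s B]
    using 3 by (subst ennreal_SUP_add_right[OF ne]) (auto intro!: SUP_least)
qed

text \<open>A closed set is Caratheodory measurable for a metric outer measure: the shells around it at
  every second level are pairwise separated, so their measures have a finite sum.\<close>

lemma closed_caratheodory_metric_outer_measure:
  fixes \<mu> :: "'a::metric_space set \<Rightarrow> ennreal"
  assumes oms: "outer_measure_space (Pow UNIV) \<mu>"
    and sep: "\<And>A B d. 0 < d \<Longrightarrow> (\<And>x y. x \<in> A \<Longrightarrow> y \<in> B \<Longrightarrow> d \<le> dist x y) \<Longrightarrow> \<mu> A + \<mu> B \<le> \<mu> (A \<union> B)"
    and "closed C"
  shows "\<mu> (S \<inter> C) + \<mu> (S - C) \<le> \<mu> S"
proof (cases "C = {} \<or> \<mu> S = \<infinity>")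
  case True
  then show ?thesis using oms by (auto simp: outer_measure_space_def positive_def)
next
  case False
  have mono: "\<mu> A \<le> \<mu> B" if "A \<subseteq> B" for A B
    using oms that by (simp add: outer_measure_space_def increasing_def)
  define T where "T n = {x \<in> S. 1 / (real n + 1) \<le> infdist x C}" for n
  define R where "R n = {x \<in> S. 1 / (real n + 2) \<le> infdist x C \<and> infdist x C < 1 / (real n + 1)}" for n
  have far: "d \<le> dist x y" if "infdist x C \<ge> infdist y C + d" for x y d
    using infdist_triangle[of x C y] that by (simp add: dist_commute)
  have T: "\<mu> (S \<inter> C) + \<mu> (T n) \<le> \<mu> S" for n
  proof -
    have "\<mu> (S \<inter> C) + \<mu> (T n) \<le> \<mu> (S \<inter> C \<union> T n)"
    proof (rule sep)
      show "0 < 1 / (real n + 1)" by simp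
      fix x y assume "x \<in> S \<inter> C" "y \<in> T n"
      then show "1 / (real n + 1) \<le> dist x y"
        using far[of x "1 / (real n + 1)" y] infdist_le[of x C y]
        by (auto simp: T_def dist_commute intro: order_trans)
    qed
    also have "\<dots> \<le> \<mu> S" by (rule mono) (auto simp: T_def)
    finally show ?thesis .
  qed
  have shells: "(\<Sum>k<m. \<mu> (R (2 * k + p))) \<le> \<mu> (\<Union>k<m. R (2 * k + p))" for m p
  proof (induction m)
    case 0 then show ?case by simp
  next
    case (Suc m)
    have "\<mu> (\<Union>k<m. R (2 * k + p)) + \<mu> (R (2 * m + p)) \<le> \<mu> ((\<Union>k<m. R (2 * k + p)) \<union> R (2 * m + p))"
    proof (rule sep)
      let ?t = "real (2 * m + p)"
      \<comment> \<open>For \<open>m = 0\<close> the union of earlier shells is empty and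
        \<open>?t\<close> may be 0, so any positive number serves. Otherwise this is the gap between
        shell \<open>2 * m + p\<close> and all earlier shells of the same parity.\<close>
      show "0 < (if m = 0 then 1 else 1 / ?t - 1 / (?t + 1))" by (auto intro!: divide_strict_left_mono)
      fix x y assume "x \<in> (\<Union>k<m. R (2 * k + p))" and y: "y \<in> R (2 * m + p)"
      then obtain k where k: "k < m" "x \<in> R (2 * k + p)" by auto
      have "1 / ?t \<le> 1 / (real (2 * k + p) + 2)"
        using k(1) by (intro divide_left_mono) auto
      then have "1 / ?t \<le> infdist x C" using k(2) by (auto simp: R_def)
      moreover have "infdist y C < 1 / (?t + 1)" using y by (auto simp: R_def)
      ultimately show "(if m = 0 then 1 else 1 / ?t - 1 / (?t + 1)) \<le> dist x y"
        using far[of y "1 / ?t - 1 / (?t + 1)" x] k(1) by auto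
    qed
    moreover have "(\<Union>k<Suc m. R (2 * k + p)) = (\<Union>k<m. R (2 * k + p)) \<union> R (2 * m + p)"
      by (auto simp: lessThan_Suc)
    ultimately show ?case using add_right_mono[OF Suc.IH, of "\<mu> (R (2 * m + p))"]
      by (simp only: sum.lessThan_Suc)
  qed
  have shells_le: "(\<Sum>k. \<mu> (R (2 * k + p))) \<le> \<mu> S" for p
  proof (rule suminf_le_const)
    fix m
    show "(\<Sum>k<m. \<mu> (R (2 * k + p))) \<le> \<mu> S"
      by (rule order_trans[OF shells mono]) (auto simp: R_def)
  qed (rule summableI)
  have part: "(\<Sum>k<n. \<mu> (R k)) \<le> \<mu> S + \<mu> S" for n
  proof -
    have "(\<Sum>k<2*m. \<mu> (R k)) = (\<Sum>k<m. \<mu> (R (2 * k + 0))) + (\<Sum>k<m. \<mu> (R (2 * k + 1)))" for m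
      by (induction m) (auto simp: algebra_simps)
    then have "(\<Sum>k<2*n. \<mu> (R k)) \<le> (\<Sum>k. \<mu> (R (2 * k + 0))) + (\<Sum>k. \<mu> (R (2 * k + 1)))"
      by (auto intro!: add_mono sum_le_suminf summableI)
    moreover have "(\<Sum>k<n. \<mu> (R k)) \<le> (\<Sum>k<2*n. \<mu> (R k))" by (rule sum_mono2) auto
    ultimately show ?thesis using add_mono[OF shells_le[of 0] shells_le[of 1]] by (meson order_trans)
  qed
  have fin: "(\<Sum>k. \<mu> (R k)) < \<infinity>"
    using suminf_le_const[OF summableI part] False by (auto simp: less_top[symmetric] top_unique)
  define r where "r k = enn2real (\<mu> (R k))" for k
  have "\<mu> (R k) < \<infinity>" for k
    using sum_le_suminf[of "\<lambda>k. \<mu> (R k)" "{k}"] fin by (auto intro: le_less_trans summableI)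
  then have r: "\<mu> (R k) = ennreal (r k)" for k by (auto simp: r_def)
  have r0: "0 \<le> r k" for k by (simp add: r_def)
  have "summable r"
    using fin r0 by (intro summable_suminf_not_top) (auto simp: r)
  have cover: "S - C \<subseteq> T n \<union> (\<Union>k. R (k + n))" for n
  proof
    fix x assume x: "x \<in> S - C"
    have pos: "0 < infdist x C"
      using x False \<open>closed C\<close> in_closed_iff_infdist_zero[of C x] infdist_nonneg[of x C] by force
    show "x \<in> T n \<union> (\<Union>k. R (k + n))"
    proof (cases "x \<in> T n")
      case F: False
      obtain m where m: "1 / (real m + 1) < infdist x C" 
        using pos reals_Archimedean by (metis inverse_eq_divide of_nat_Suc add.commute)
      \<comment> \<open>The first level that the distance of \<open>x\<close> from \<open>C\<close>
        reaches. It exceeds \<open>n\<close> because \<open>x\<close> is not in \<open>T n\<close>,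
        and it places \<open>x\<close> in the shell with index \<open>k - 1\<close>.\<close>
      define k where "k = (LEAST k. 1 / (real k + 1) \<le> infdist x C)"
      have k: "1 / (real k + 1) \<le> infdist x C" unfolding k_def by (rule LeastI[of _ m]) (use m in auto)
      have "n < k"
      proof (rule ccontr)
        assume "\<not> n < k"
        then have "1 / (real n + 1) \<le> 1 / (real k + 1)" by (intro divide_left_mono) auto
        with k F x show False by (auto simp: T_def)
      qed
      moreover have "infdist x C < 1 / (real (k - 1) + 1)"
        using not_less_Least[of "k - 1" "\<lambda>k. 1 / (real k + 1) \<le> infdist x C"] \<open>n < k\<close> by (auto simp: k_def)
      moreover have "real (k - 1) + 2 = real k + 1" using \<open>n < k\<close> by linarith
      then have "1 / (real (k - 1) + 2) \<le> infdist x C" using k by (simp only:)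
      ultimately have "x \<in> R (k - 1)" using x unfolding R_def by simp
      then have "x \<in> R ((k - 1 - n) + n)" using \<open>n < k\<close> by auto
      then show ?thesis by blast
    qed auto
  qed
  have "\<mu> (S \<inter> C) + \<mu> (S - C) \<le> \<mu> S + ennreal e" if "0 < e" for e
  proof -
    obtain n where n: "norm (\<Sum>i. r (i + n)) < e"
      using suminf_exist_split[OF \<open>0 < e\<close> \<open>summable r\<close>] by auto
    have "\<mu> (S - C) \<le> \<mu> (T n) + \<mu> (\<Union>k. R (k + n))"
      using mono[OF cover[of n]] outer_measure_space_Un_le[OF oms] order_trans by blast
    also have "\<mu> (\<Union>k. R (k + n)) \<le> (\<Sum>k. \<mu> (R (k + n)))"
      by (rule outer_measure_space_UN_le[OF oms])
    also have "(\<Sum>k. \<mu> (R (k + n))) = ennreal (\<Sum>k. r (k + n))"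
      unfolding r by (rule suminf_ennreal2) (use r0 \<open>summable r\<close> in \<open>auto simp: summable_iff_shift\<close>)
    also have "\<dots> \<le> ennreal e" using n by (intro ennreal_leI) auto
    finally have "\<mu> (S \<inter> C) + \<mu> (S - C) \<le> (\<mu> (S \<inter> C) + \<mu> (T n)) + ennreal e"
      by (metis add.assoc add_left_mono)
    also have "\<dots> \<le> \<mu> S + ennreal e" by (intro add_right_mono T)
    finally show ?thesis .
  qed
  then show ?thesis by (rule ennreal_le_epsilon)
qed

text \<open>\<open>measure_of\<close> falls back to the zero measure unless its set function is a
  measure on the generated sigma-algebra. Caratheodory's theorem gives a measure on the lambda
  system, which contains the closed sets and hence all Borel sets.\<close>

lemma
  assumes "0 < s"
  shows sets_hausdorff_measure: "sets (hausdorff_measure s :: 'a::metric_space measure) = sets borel"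
    and space_hausdorff_measure: "space (hausdorff_measure s :: 'a measure) = UNIV"
    and emeasure_hausdorff_measure:
      "A \<in> sets borel \<Longrightarrow> emeasure (hausdorff_measure s :: 'a measure) A = hausdorff_outer_measure s A"
proof -
  let ?\<mu> = "hausdorff_outer_measure s :: 'a set \<Rightarrow> ennreal"
  let ?L = "lambda_system UNIV (Pow UNIV) ?\<mu>"
  interpret sigma_algebra UNIV "Pow UNIV :: 'a set set" by (rule sigma_algebra_Pow)
  note oms = outer_measure_space_hausdorff[OF assms, where 'a='a]
  have ms: "measure_space UNIV ?L ?\<mu>" by (rule caratheodory_lemma[OF oms])
  then have sa: "sigma_algebra UNIV ?L" by (simp add: measure_space_def)
  have "C \<in> ?L" if "closed C" for C
  proof -
    have "?\<mu> (x \<inter> C) + ?\<mu> (x - C) = ?\<mu> x" for x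
    proof (rule antisym)
      show "?\<mu> (x \<inter> C) + ?\<mu> (x - C) \<le> ?\<mu> x"
        by (rule closed_caratheodory_metric_outer_measure[OF oms _ that])
          (rule hausdorff_outer_measure_separated[OF assms])
      show "?\<mu> x \<le> ?\<mu> (x \<inter> C) + ?\<mu> (x - C)"
        using outer_measure_space_Un_le[OF oms, of "x \<inter> C" "x - C"] by (simp add: Int_Diff_Un)
    qed
    then show ?thesis unfolding lambda_system_eq by simp
  qed
  then have "sigma_sets UNIV (Collect closed) \<subseteq> ?L"
    by (intro sigma_algebra.sigma_sets_subset[OF sa]) auto
  then have sub: "sets (borel :: 'a measure) \<subseteq> ?L"
    by (simp add: borel_eq_closed)
  have sb: "sigma_algebra UNIV (sets (borel :: 'a measure))"
    using sets.sigma_algebra_axioms[of "borel :: 'a measure"] by simp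
  have "measure_space UNIV (sets borel) ?\<mu>"
    using ms sub sb unfolding measure_space_def
    by (auto simp: positive_def countably_additive_def)
  then show "A \<in> sets borel \<Longrightarrow> emeasure (hausdorff_measure s :: 'a measure) A = hausdorff_outer_measure s A"
    unfolding hausdorff_measure_def measure_space_def
    by (intro emeasure_measure_of_sigma) auto
  show "sets (hausdorff_measure s :: 'a measure) = sets borel"
    unfolding hausdorff_measure_def using sigma_algebra.sets_measure_of_eq[OF sb] by simp
  show "space (hausdorff_measure s :: 'a measure) = UNIV"
    unfolding hausdorff_measure_def by (simp add: space_measure_of_conv)
qed

section \<open>Hausdorff measure on planes\<close>

definition steiner_symmetrization :: "(real \<times> real) set \<Rightarrow> (real \<times> real) set" where
  "steiner_symmetrization K = {(x, y). ennreal (2 * \<bar>y\<bar>) < emeasure lborel (Pair x -` K)}"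

lemma steiner_symmetrization_borel:
  assumes "K \<in> sets borel"
  shows "steiner_symmetrization K \<in> sets borel"
proof -
  have [measurable]: "K \<in> sets (lborel \<Otimes>\<^sub>M lborel)"
    using assms by (metis lborel_prod sets_lborel)
  have [measurable]: "(\<lambda>x. emeasure lborel (Pair x -` K)) \<in> borel_measurable borel"
    using lborel.measurable_emeasure_Pair[of K lborel] by simp
  have "{p \<in> space (borel \<Otimes>\<^sub>M borel). ennreal (2 * \<bar>snd p\<bar>) < emeasure lborel (Pair (fst p) -` K)} \<in> sets (borel \<Otimes>\<^sub>M borel)"
    by measurable
  moreover have "{p \<in> space (borel \<Otimes>\<^sub>M borel). ennreal (2 * \<bar>snd p\<bar>) < emeasure lborel (Pair (fst p) -` K)} = steiner_symmetrization K"
    by (auto simp: steiner_symmetrization_def space_pair_measure)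
  ultimately show ?thesis by (metis borel_prod)
qed

text \<open>Every section of the new set is the centred open interval of the same length as the old
  section, so Tonelli gives equal areas. The strict inequality in the definition leaves null
  sections empty, so each occupied column contains points of \<open>K\<close>.\<close>

lemma emeasure_steiner_symmetrization:
  assumes K: "K \<in> sets borel" and b: "bounded K"
  shows "emeasure lborel (steiner_symmetrization K) = emeasure lborel K"
proof -
  have K': "K \<in> sets (lborel \<Otimes>\<^sub>M lborel)" using K by (metis lborel_prod sets_lborel)
  have S': "steiner_symmetrization K \<in> sets (lborel \<Otimes>\<^sub>M lborel)"
    using steiner_symmetrization_borel[OF K] by (metis lborel_prod sets_lborel)
  have fin: "emeasure lborel (Pair x -` K) < \<infinity>" for x
  proof -
    have "Pair x -` K \<subseteq> snd ` K" by force
    then have "bounded (Pair x -` K)" using bounded_snd[OF b] bounded_subset by blast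
    then show ?thesis by (rule emeasure_bounded_finite)
  qed
  have "emeasure lborel (Pair x -` steiner_symmetrization K) = emeasure lborel (Pair x -` K)" for x
  proof -
    obtain m where m: "0 \<le> m" "emeasure lborel (Pair x -` K) = ennreal m"
      using fin[of x] by (metis ennreal_cases infinity_ennreal_def less_irrefl)
    have "Pair x -` steiner_symmetrization K = {-m/2<..<m/2}"
      by (auto simp: steiner_symmetrization_def m ennreal_less_iff)
    then show ?thesis using m by simp
  qed
  then have "emeasure (lborel \<Otimes>\<^sub>M lborel) (steiner_symmetrization K) = emeasure (lborel \<Otimes>\<^sub>M lborel) K"
    by (simp add: lborel.emeasure_pair_measure_alt[OF S'] lborel.emeasure_pair_measure_alt[OF K'])
  then show ?thesis by (simp add: lborel_prod)
qed

lemma interval_of_large_measure: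
  fixes A :: "real set"
  assumes "ennreal m < emeasure lborel A" "0 \<le> m" "bounded A" "A \<in> sets borel"
  shows "m < Sup A - Inf A" "A \<noteq> {}"
proof -
  show ne: "A \<noteq> {}" using assms(1) by auto
  have "emeasure lborel A \<le> emeasure lborel {Inf A .. Sup A}"
    using assms(3) by (intro emeasure_mono)
      (auto intro!: cInf_lower cSup_upper bounded_imp_bdd_above bounded_imp_bdd_below)
  moreover have "Inf A \<le> Sup A"
    using ne assms(3) by (intro cInf_le_cSup bounded_imp_bdd_above bounded_imp_bdd_below)
  ultimately have "ennreal m < ennreal (Sup A - Inf A)"
    using assms(1) by simp
  then show "m < Sup A - Inf A" using assms(2) by (simp add: ennreal_less_iff)
qed

text \<open>The heights satisfy \<open>2 * \<bar>y\<bar> < Sup ?A - Inf ?A\<close> and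
  \<open>2 * \<bar>y'\<bar> < Sup ?B - Inf ?B\<close>. The two right sides add up to the crossed
  differences \<open>Sup ?A - Inf ?B\<close> and \<open>Sup ?B - Inf ?A\<close>, and each of these
  is a limit of vertical distances between points of \<open>K\<close> in the two columns.\<close>

lemma steiner_symmetrization_dist:
  assumes K: "K \<in> sets borel" "bounded K"
    and p: "p \<in> steiner_symmetrization K" and q: "q \<in> steiner_symmetrization K"
  shows "dist p q \<le> diameter K"
proof -
  obtain x y x' y' where pq: "p = (x, y)" "q = (x', y')" by (cases p, cases q)
  let ?A = "Pair x -` K" and ?B = "Pair x' -` K"
  have bd: "bounded (Pair z -` K)" for z
    by (rule bounded_subset[OF bounded_snd[OF K(2)]]) force
  have ms: "Pair z -` K \<in> sets borel" for z
    using sets_Pair1[of K lborel lborel z] K(1) by (metis lborel_prod sets_lborel)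
  note A = interval_of_large_measure[OF _ _ bd ms, of "2 * \<bar>y\<bar>" x]
  note B = interval_of_large_measure[OF _ _ bd ms, of "2 * \<bar>y'\<bar>" x']
  have A': "2 * \<bar>y\<bar> < Sup ?A - Inf ?A" "?A \<noteq> {}" and B': "2 * \<bar>y'\<bar> < Sup ?B - Inf ?B" "?B \<noteq> {}"
    using A B p q by (auto simp: pq steiner_symmetrization_def)
  have bound: "Sup U - Inf V \<le> sqrt ((diameter K)\<^sup>2 - (x - x')\<^sup>2)"
    if UV: "U \<noteq> {}" "V \<noteq> {}" "bounded U" "bounded V" "\<And>u v. u \<in> U \<Longrightarrow> v \<in> V \<Longrightarrow> (x - x')\<^sup>2 + (u - v)\<^sup>2 \<le> (diameter K)\<^sup>2"
    for U V
  proof -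
    have 1: "u - v \<le> sqrt ((diameter K)\<^sup>2 - (x - x')\<^sup>2)" if "u \<in> U" "v \<in> V" for u v
      using UV(5)[OF that] by (intro real_le_rsqrt) auto
    have "u - sqrt ((diameter K)\<^sup>2 - (x - x')\<^sup>2) \<le> Inf V" if "u \<in> U" for u
      using 1[OF that] UV by (intro cInf_greatest) (auto simp: algebra_simps)
    then have "Sup U \<le> Inf V + sqrt ((diameter K)\<^sup>2 - (x - x')\<^sup>2)"
      using UV by (intro cSup_least) (auto simp: algebra_simps)
    then show ?thesis by simp
  qed
  have d: "(x - x')\<^sup>2 + (u - v)\<^sup>2 \<le> (diameter K)\<^sup>2" if "(x, u) \<in> K" "(x', v) \<in> K" for u v
  proof -
    have "sqrt ((x - x')\<^sup>2 + (u - v)\<^sup>2) \<le> diameter K"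
      using diameter_bounded_bound[OF K(2) that] by (simp add: dist_Pair_Pair dist_real_def)
    then show ?thesis by (metis real_sqrt_le_iff real_sqrt_ge_zero abs_of_nonneg add_nonneg_nonneg power_mono real_sqrt_pow2 zero_le_power2)
  qed
  have "Sup ?A - Inf ?B \<le> sqrt ((diameter K)\<^sup>2 - (x - x')\<^sup>2)"
    by (rule bound[OF A'(2) B'(2) bd bd]) (use d in auto)
  moreover have "Sup ?B - Inf ?A \<le> sqrt ((diameter K)\<^sup>2 - (x - x')\<^sup>2)"
    by (rule bound[OF B'(2) A'(2) bd bd]) (metis d power2_commute vimage_eq)
  ultimately have 2: "\<bar>y - y'\<bar> \<le> sqrt ((diameter K)\<^sup>2 - (x - x')\<^sup>2)"
    using A'(1) B'(1) by linarith
  have "(x - x')\<^sup>2 \<le> (diameter K)\<^sup>2"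
    using A'(2) B'(2) d by (metis add_increasing2 ex_in_conv le_add_same_cancel1 order_trans vimage_eq zero_le_power2)
  then have "(y - y')\<^sup>2 \<le> (diameter K)\<^sup>2 - (x - x')\<^sup>2"
    using power_mono[OF 2, of 2] by simp
  then have "sqrt ((x - x')\<^sup>2 + (y - y')\<^sup>2) \<le> sqrt ((diameter K)\<^sup>2)" by (intro real_sqrt_le_mono) auto
  then show ?thesis
    using diameter_ge_0[OF K(2)] by (simp add: pq dist_Pair_Pair dist_real_def)
qed

lemma emeasure_lborel_swap:
  fixes K :: "(real \<times> real) set"
  assumes "K \<in> sets borel"
  shows "prod.swap -` K \<in> sets borel" "emeasure lborel (prod.swap -` K) = emeasure lborel K"
proof -
  have m: "(\<lambda>(x, y). (y, x)) \<in> measurable (lborel \<Otimes>\<^sub>M lborel) (lborel \<Otimes>\<^sub>M lborel :: (real \<times> real) measure)"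
    by measurable
  have K: "K \<in> sets (lborel \<Otimes>\<^sub>M lborel)" using assms by (metis lborel_prod sets_lborel)
  have eq: "(\<lambda>(x, y). (y, x)) -` K \<inter> space (lborel \<Otimes>\<^sub>M lborel) = prod.swap -` K"
    by (auto simp: space_pair_measure prod.swap_def)
  show "prod.swap -` K \<in> sets borel"
    using measurable_sets[OF m K] unfolding eq by (metis lborel_prod sets_lborel)
  show "emeasure lborel (prod.swap -` K) = emeasure lborel K"
    using emeasure_distr[OF m K] lborel_pair.distr_pair_swap[where 'a=real and 'b=real] unfolding eq
    by (simp add: lborel_prod)
qed

text \<open>Symmetrizing with respect to both coordinate axes leaves a set symmetric about the origin, in
  which every point is at distance at most half the diameter from the origin.\<close>

theorem isodiametric_inequality_plane:
  fixes K :: "(real \<times> real) set"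
  assumes "bounded K" and "K \<in> sets borel"
  shows "emeasure lborel K \<le> ennreal (pi * (diameter K / 2)\<^sup>2)"
proof -
  define K1 where "K1 = steiner_symmetrization K"
  define K2 where "K2 = steiner_symmetrization (prod.swap -` K1)"
  have K1: "K1 \<in> sets borel" "emeasure lborel K1 = emeasure lborel K"
    "\<And>p q. p \<in> K1 \<Longrightarrow> q \<in> K1 \<Longrightarrow> dist p q \<le> diameter K"
    using steiner_symmetrization_borel emeasure_steiner_symmetrization steiner_symmetrization_dist assms
    by (auto simp: K1_def)
  have sw: "dist (prod.swap p) (prod.swap q) = dist p q" for p q :: "real \<times> real"
    by (cases p, cases q) (simp add: dist_Pair_Pair)
  have d: "dist p q \<le> diameter K" if "p \<in> prod.swap -` K1" "q \<in> prod.swap -` K1" for p q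
    using K1(3)[of "prod.swap p" "prod.swap q"] that sw by auto
  then have b: "bounded (prod.swap -` K1)" unfolding bounded_two_points by blast
  have "diameter (prod.swap -` K1) \<le> diameter K"
    using d diameter_ge_0[OF assms(1)] by (intro diameter_le) (auto simp: dist_norm)
  then have K2: "K2 \<in> sets borel" "emeasure lborel K2 = emeasure lborel K"
    "\<And>p q. p \<in> K2 \<Longrightarrow> q \<in> K2 \<Longrightarrow> dist p q \<le> diameter K"
    using steiner_symmetrization_borel[of "prod.swap -` K1"] emeasure_steiner_symmetrization[OF _ b] 
      steiner_symmetrization_dist[OF _ b] emeasure_lborel_swap[OF K1(1)] K1(2)
    unfolding K2_def by (simp, simp, meson order_trans)
  \<comment> \<open>The columns of the swapped set at \<open>y\<close> and \<open>-y\<close>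
    coincide, so the second symmetrization preserves the symmetry gained by the first, and together
    they give the point reflection.\<close>
  have sym1: "Pair y -` prod.swap -` K1 = Pair (-y) -` prod.swap -` K1" for y
    by (auto simp: K1_def steiner_symmetrization_def)
  have sym2: "- p \<in> K2" if "p \<in> K2" for p
    using that sym1[of "fst p"] by (cases p) (simp add: K2_def steiner_symmetrization_def)
  have "K2 \<subseteq> cball 0 (diameter K / 2)"
  proof
    fix p assume "p \<in> K2"
    have "dist p (- p) = 2 * norm p" by (simp add: dist_norm flip: scaleR_2)
    then show "p \<in> cball 0 (diameter K / 2)" using K2(3)[OF \<open>p \<in> K2\<close> sym2[OF \<open>p \<in> K2\<close>]] by simp
  qed
  then have "emeasure lborel K2 \<le> emeasure lborel (cball (0 :: real \<times> real) (diameter K / 2))"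
    by (intro emeasure_mono) auto
  also have "\<dots> = ennreal (pi * (diameter K / 2)\<^sup>2)"
    using diameter_ge_0[OF assms(1)] by (subst emeasure_cball) (auto simp: unit_ball_vol_2 power2_eq_square)
  finally show ?thesis using K2(2) by simp
qed

section \<open>Vitali covers and the Hausdorff measure of isometric copies of plane sets\<close>

lemma countable_disjoint_balls_sequence:
  fixes a :: "'i \<Rightarrow> 'a::euclidean_space"
  assumes "countable C" "pairwise (\<lambda>i j. disjnt (ball (a i) (r i)) (ball (a j) (r j))) C"
    and "\<And>i. i \<in> C \<Longrightarrow> 0 < r i"
  obtains I :: "nat set" and b :: "nat \<Rightarrow> 'i"
  where "b ` I = C" "disjoint_family (\<lambda>n. if n \<in> I then ball (a (b n)) (r (b n)) else {})"
proof
  let ?I = "to_nat_on C ` C" and ?b = "from_nat_into C"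
  show "?b ` ?I = C" using assms(1) by (force simp: image_image from_nat_into_to_nat_on)
  show "disjoint_family (\<lambda>n. if n \<in> ?I then ball (a (?b n)) (r (?b n)) else {})"
    unfolding disjoint_family_on_def
  proof (intro ballI impI)
    fix m n :: nat assume "m \<noteq> n"
    show "(if m \<in> ?I then ball (a (?b m)) (r (?b m)) else {}) \<inter>
      (if n \<in> ?I then ball (a (?b n)) (r (?b n)) else {}) = {}"
    proof (cases "m \<in> ?I \<and> n \<in> ?I")
      case True
      then have "?b m \<noteq> ?b n" "?b m \<in> C" "?b n \<in> C"
        using \<open>m \<noteq> n\<close> assms(1) by (auto simp: from_nat_into_to_nat_on)
      then show ?thesis using pairwiseD[OF assms(2)] True by (auto simp: disjnt_def)
    qed auto
  qed
qed

text \<open>The image of a ball enlarged by \<open>t\<close> has weight at most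
  \<open>t\<^sup>2\<close> times the area of the original ball, and the original balls are disjoint
  in \<open>U\<close>. The value \<open>t = 5\<close> handles null sets and \<open>t = 1\<close> the
  almost exact cover. Indices outside \<open>I\<close> receive the empty set, since a cover is a
  sequence while the Vitali family may be finite.\<close>

lemma hausdorff_premeasure_isometric_balls:
  fixes \<iota> :: "real \<times> real \<Rightarrow> 'a::metric_space" and a :: "'i \<Rightarrow> real \<times> real"
  assumes iso: "\<And>p q. dist (\<iota> p) (\<iota> q) = dist p q"
    and C: "countable C" "pairwise (\<lambda>i j. disjnt (ball (a i) (r i)) (ball (a j) (r j))) C"
    and r: "\<And>i. i \<in> C \<Longrightarrow> 0 < r i" "\<And>i. i \<in> C \<Longrightarrow> 2 * (t * r i) \<le> \<delta>" and "0 < t" "0 \<le> \<delta>"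
    and U: "U \<in> sets borel" "\<And>i. i \<in> C \<Longrightarrow> ball (a i) (r i) \<subseteq> U"
    and S: "S \<subseteq> (\<Union>i\<in>C. cball (a i) (t * r i))"
  shows "hausdorff_premeasure 2 \<delta> (\<iota> ` S) \<le> ennreal (t\<^sup>2) * emeasure lborel U"
proof -
  obtain I and b :: "nat \<Rightarrow> 'i" where b: "b ` I = C"
    and disj: "disjoint_family (\<lambda>n. if n \<in> I then ball (a (b n)) (r (b n)) else {})"
    by (rule countable_disjoint_balls_sequence[OF C r(1)])
  define D where "D n = (if n \<in> I then \<iota> ` cball (a (b n)) (t * r (b n)) else {})" for n
  define B where "B n = (if n \<in> I then ball (a (b n)) (r (b n)) else {})" for n
  have diam: "bounded (D n)" "diameter (D n) \<le> (if n \<in> I then 2 * (t * r (b n)) else 0)" for n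
  proof -
    have d: "dist x y \<le> 2 * (t * r (b n))" if xy: "n \<in> I" "x \<in> D n" "y \<in> D n" for x y
    proof -
      obtain p q where "x = \<iota> p" "y = \<iota> q" "p \<in> cball (a (b n)) (t * r (b n))" "q \<in> cball (a (b n)) (t * r (b n))"
        using xy by (simp only: D_def if_True image_iff) blast
      then show ?thesis using iso dist_triangle2[of p q "a (b n)"] by (simp add: dist_commute)
    qed
    show "bounded (D n)"
      unfolding bounded_two_points using d by (cases "n \<in> I") (auto simp: D_def)
    show "diameter (D n) \<le> (if n \<in> I then 2 * (t * r (b n)) else 0)"
    proof (cases "D n = {}")
      case True
      then show ?thesis using \<open>0 < t\<close> r(1)[of "b n"] b by (auto simp: D_def diameter_def)
    next
      case False
      then have "n \<in> I" by (auto simp: D_def)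
      with False d show ?thesis unfolding diameter_def by (auto intro!: cSUP_least)
    qed
  qed
  have term_le: "ennreal (unit_ball_vol 2 * (diameter (D n) / 2) powr 2) \<le> ennreal (t\<^sup>2) * emeasure lborel (B n)" for n
  proof (cases "n \<in> I")
    case True
    then have rp: "0 < r (b n)" using r(1) b by auto
    have "(diameter (D n) / 2)\<^sup>2 \<le> (t * r (b n))\<^sup>2"
      using diam[of n] diameter_ge_0[OF diam(1)[of n]] True by (intro power_mono) auto
    then have "unit_ball_vol 2 * (diameter (D n) / 2) powr 2 \<le> t\<^sup>2 * (pi * (r (b n))\<^sup>2)"
      using diameter_ge_0[OF diam(1)[of n]] mult_left_mono[of _ _ pi]
      by (simp add: unit_ball_vol_2 power_mult_distrib mult_ac)
    then have "ennreal (unit_ball_vol 2 * (diameter (D n) / 2) powr 2) \<le> ennreal (t\<^sup>2) * ennreal (pi * (r (b n))\<^sup>2)"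
      by (subst ennreal_mult[symmetric]) (auto intro: ennreal_leI)
    then show ?thesis using True rp
      by (simp add: B_def emeasure_ball unit_ball_vol_2 power2_eq_square)
  next
    case False
    then show ?thesis by (simp add: D_def diameter_def)
  qed
  have "hausdorff_premeasure 2 \<delta> (\<iota> ` S) \<le> (\<Sum>n. ennreal (unit_ball_vol 2 * (diameter (D n) / 2) powr 2))"
    unfolding hausdorff_premeasure_def
  proof (rule INF_lower, intro CollectI conjI allI)
    show "\<iota> ` S \<subseteq> (\<Union>n. D n)" using S unfolding b[symmetric] D_def by fastforce
    show "bounded (D n)" for n by (rule diam)
    show "diameter (D n) \<le> \<delta>" for n
      using diam(2)[of n] r(2)[of "b n"] b \<open>0 \<le> \<delta>\<close> by (auto split: if_splits)
  qed
  also have "\<dots> \<le> (\<Sum>n. ennreal (t\<^sup>2) * emeasure lborel (B n))"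
    by (intro suminf_le summableI term_le)
  also have "\<dots> = ennreal (t\<^sup>2) * (\<Sum>n. emeasure lborel (B n))"
    by (rule ennreal_suminf_cmult)
  also have "(\<Sum>n. emeasure lborel (B n)) = emeasure lborel (\<Union>n. B n)"
    by (rule suminf_emeasure) (use disj in \<open>auto simp: B_def\<close>)
  also have "\<dots> \<le> emeasure lborel U"
    using U b by (intro emeasure_mono) (auto simp: B_def split: if_splits)
  finally show ?thesis by (simp add: mult_left_mono)
qed

text \<open>Enlarging the disjoint balls of a Vitali cover five times costs only a constant factor.\<close>

lemma hausdorff_premeasure_isometric_null:
  fixes \<iota> :: "real \<times> real \<Rightarrow> 'a::metric_space"
  assumes iso: "\<And>p q. dist (\<iota> p) (\<iota> q) = dist p q" and "0 < \<delta>"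
    and N: "N \<in> null_sets lborel"
  shows "hausdorff_premeasure 2 \<delta> (\<iota> ` N) = 0"
proof -
  have "hausdorff_premeasure 2 \<delta> (\<iota> ` N) \<le> 0 + ennreal e" if "0 < e" for e
  proof -
    \<comment> \<open>The divisor 25 pays for the square of the enlargement factor 5.\<close>
    obtain V where V: "open V" "N \<subseteq> V" "emeasure lborel (V - N) < ennreal (e / 25)"
    proof (rule outer_regular_lborel[of N "e / 25"])
      show "N \<in> sets borel" using null_setsD2[OF N] by simp
    qed (use \<open>0 < e\<close> in auto)
    have "emeasure lborel V = emeasure lborel (V - N)"
      using emeasure_Diff_null_set[OF N, of V] V(1) by (simp add: borel_open)
    then have Ve: "emeasure lborel V < ennreal (e / 25)" using V by simp
    \<comment> \<open>Radii up to \<open>\<delta> / 10\<close> keep the diameters of the five times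
      enlarged balls within \<open>\<delta>\<close>.\<close>
    define K where "K = {(x, r). 0 < r \<and> r \<le> \<delta> / 10 \<and> ball x r \<subseteq> V}"
    have cov: "V \<subseteq> (\<Union>i\<in>K. cball (fst i) (snd i))"
    proof
      fix x assume "x \<in> V"
      then obtain s where s: "0 < s" "ball x s \<subseteq> V" using V(1) openE by blast
      then have "(x, min s (\<delta> / 10)) \<in> K" using \<open>0 < \<delta>\<close> by (auto simp: K_def)
      moreover have "x \<in> cball x (min s (\<delta> / 10))" using s \<open>0 < \<delta>\<close> by simp
      ultimately show "x \<in> (\<Union>i\<in>K. cball (fst i) (snd i))" by force
    qed
    have "0 < snd i \<and> snd i \<le> \<delta> / 10" if "i \<in> K" for i using that by (auto simp: K_def)
    then obtain C where C: "countable C" "C \<subseteq> K"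
      "pairwise (\<lambda>i j. disjnt (cball (fst i) (snd i)) (cball (fst j) (snd j))) C"
      "V \<subseteq> (\<Union>i\<in>C. cball (fst i) (5 * snd i))"
      by (rule Vitali_covering_lemma_cballs[OF cov])
    have pw: "pairwise (\<lambda>i j. disjnt (ball (fst i) (snd i)) (ball (fst j) (snd j))) C"
      by (rule pairwise_mono[OF C(3) _ subset_refl], rule disjnt_subset1[OF disjnt_subset2], assumption)
        (rule ball_subset_cball)+
    have "hausdorff_premeasure 2 \<delta> (\<iota> ` N) \<le> ennreal (5\<^sup>2) * emeasure lborel V"
    proof (rule hausdorff_premeasure_isometric_balls[OF iso C(1) pw])
      show "V \<in> sets borel" using V(1) by (rule borel_open)
      show "N \<subseteq> (\<Union>i\<in>C. cball (fst i) (5 * snd i))" using V(2) C(4) by blast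
      show "0 < snd i" "2 * (5 * snd i) \<le> \<delta>" "ball (fst i) (snd i) \<subseteq> V" if "i \<in> C" for i
        using subsetD[OF C(2) that] by (simp_all add: K_def case_prod_beta)
    qed (use \<open>0 < \<delta>\<close> in auto)
    also have "\<dots> \<le> ennreal 25 * ennreal (e / 25)"
      using Ve by (intro mult_mono) auto
    also have "\<dots> = ennreal e" using \<open>0 < e\<close> by (subst ennreal_mult[symmetric]) auto
    finally show ?thesis by simp
  qed
  then have "hausdorff_premeasure 2 \<delta> (\<iota> ` N) \<le> 0" by (rule ennreal_le_epsilon)
  then show ?thesis by simp
qed

text \<open>Disjoint small balls fill an open superset of nearly the same area up to a null set, and
  null sets have premeasure 0. The weight of a ball's image is at most the area of the ball, so the
  cover costs at most the area of the open set.\<close>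

lemma hausdorff_outer_measure_isometric_le:
  fixes \<iota> :: "real \<times> real \<Rightarrow> 'a::metric_space"
  assumes iso: "\<And>p q. dist (\<iota> p) (\<iota> q) = dist p q" and A: "A \<in> sets borel"
  shows "hausdorff_outer_measure 2 (\<iota> ` A) \<le> emeasure lborel A"
  unfolding hausdorff_outer_measure_def
proof (rule SUP_least)
  fix \<delta> :: real assume "\<delta> \<in> {0<..}"
  then have "0 < \<delta>" by simp
  show "hausdorff_premeasure 2 \<delta> (\<iota> ` A) \<le> emeasure lborel A"
  proof (rule ennreal_le_epsilon)
    fix e :: real assume "0 < e"
    obtain U where U: "open U" "A \<subseteq> U" "emeasure lborel (U - A) < ennreal e"
      using outer_regular_lborel[OF A \<open>0 < e\<close>] by auto
    define K where "K = {(x, r). 0 < r \<and> r \<le> \<delta> / 2 \<and> ball x r \<subseteq> U}"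
    have "\<exists>i. i \<in> K \<and> x \<in> ball (fst i) (snd i) \<and> snd i < d" if "x \<in> U" "0 < d" for x d
    proof -
      obtain s where s: "0 < s" "ball x s \<subseteq> U" using U(1) \<open>x \<in> U\<close> openE by blast
      define r where "r = min s (min (\<delta> / 2) (d / 2))"
      have "0 < r" "r \<le> s" "r \<le> \<delta> / 2" "r < d" using s \<open>0 < \<delta>\<close> \<open>0 < d\<close> by (auto simp: r_def)
      then have "(x, r) \<in> K" "x \<in> ball x r" "r < d" using s by (auto simp: K_def)
      then show ?thesis by (intro exI[of _ "(x, r)"]) auto
    qed
    then obtain C where C: "countable C" "C \<subseteq> K"
      "pairwise (\<lambda>i j. disjnt (ball (fst i) (snd i)) (ball (fst j) (snd j))) C"
      "negligible (U - (\<Union>i\<in>C. ball (fst i) (snd i)))"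
      by (rule Vitali_covering_theorem_balls[of U K fst snd])
    define B where "B = (\<Union>i\<in>C. ball (fst i) (snd i))"
    have bB: "open B" by (auto simp: B_def)
    have null: "U - B \<in> null_sets lborel"
      using C(4) U(1) bB by (simp add: B_def negligible_iff_null_sets null_sets_completion_iff)
    have "\<iota> ` A \<subseteq> \<iota> ` B \<union> \<iota> ` (U - B)" using U(2) by auto
    then have "hausdorff_premeasure 2 \<delta> (\<iota> ` A) \<le> hausdorff_premeasure 2 \<delta> (\<iota> ` B \<union> \<iota> ` (U - B))"
      by (rule hausdorff_premeasure_mono)
    also have "\<dots> \<le> hausdorff_premeasure 2 \<delta> (\<iota> ` B) + hausdorff_premeasure 2 \<delta> (\<iota> ` (U - B))"
      by (rule outer_measure_space_Un_le[OF outer_measure_space_hausdorff_premeasure]) (use \<open>0 < \<delta>\<close> in auto)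
    also have "\<dots> = hausdorff_premeasure 2 \<delta> (\<iota> ` B)"
      by (simp add: hausdorff_premeasure_isometric_null[OF iso \<open>0 < \<delta>\<close> null])
    also have "\<dots> \<le> ennreal (1\<^sup>2) * emeasure lborel U"
    proof (rule hausdorff_premeasure_isometric_balls[OF iso C(1,3)])
      show "U \<in> sets borel" using U(1) by (rule borel_open)
      show "B \<subseteq> (\<Union>i\<in>C. cball (fst i) (1 * snd i))" by (auto simp: B_def)
      show "0 < snd i" "2 * (1 * snd i) \<le> \<delta>" "ball (fst i) (snd i) \<subseteq> U" if "i \<in> C" for i
        using subsetD[OF C(2) that] by (simp_all add: K_def case_prod_beta)
    qed (use \<open>0 < \<delta>\<close> in auto)
    also have "\<dots> = emeasure lborel A + emeasure lborel (U - A)"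
      using A U by (subst plus_emeasure) (auto simp: borel_open Un_absorb1)
    also have "\<dots> \<le> emeasure lborel A + ennreal e"
      using U(3) by (intro add_left_mono) auto
    finally show "hausdorff_premeasure 2 \<delta> (\<iota> ` A) \<le> emeasure lborel A + ennreal e" .
  qed
qed

text \<open>A cover pulls back to sets in the plane of no larger diameter, whose areas the
  isodiametric inequality bounds by the weights. As the outer measure is a supremum over scales, the
  single scale 1 is enough.\<close>

lemma hausdorff_outer_measure_isometric_ge:
  fixes \<iota> :: "real \<times> real \<Rightarrow> 'a::metric_space"
  assumes iso: "\<And>p q. dist (\<iota> p) (\<iota> q) = dist p q" and A: "A \<in> sets borel"
  shows "emeasure lborel A \<le> hausdorff_outer_measure 2 (\<iota> ` A)"
proof -
  have "emeasure lborel A \<le> hausdorff_premeasure 2 1 (\<iota> ` A)"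
    unfolding hausdorff_premeasure_def
  proof (rule INF_greatest)
    fix C :: "nat \<Rightarrow> 'a set"
    assume C: "C \<in> {C. \<iota> ` A \<subseteq> (\<Union>i. C i) \<and> (\<forall>i. bounded (C i) \<and> diameter (C i) \<le> 1)}"
    \<comment> \<open>Closures make the preimages Borel without changing their diameters.\<close>
    define D where "D i = closure (\<iota> -` C i)" for i
    have bd: "bounded (D i)" "diameter (D i) \<le> diameter (C i)" for i
    proof -
      have b: "bounded (C i)" using C by auto
      have d: "dist p q \<le> diameter (C i)" if "p \<in> \<iota> -` C i" "q \<in> \<iota> -` C i" for p q
        using diameter_bounded_bound[OF b, of "\<iota> p" "\<iota> q"] that iso by auto
      then have b': "bounded (\<iota> -` C i)" unfolding bounded_two_points by blast
      then show "bounded (D i)" unfolding D_def by (rule bounded_closure)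
      have "diameter (\<iota> -` C i) \<le> diameter (C i)"
        using d diameter_ge_0[OF b] by (intro diameter_le) (auto simp: dist_norm)
      then show "diameter (D i) \<le> diameter (C i)" using b' by (simp add: D_def diameter_closure)
    qed
    have "A \<subseteq> (\<Union>i. D i)"
      using C closure_subset[of "\<iota> -` C _"] by (force simp: D_def)
    then have "emeasure lborel A \<le> emeasure lborel (\<Union>i. D i)"
      by (intro emeasure_mono) (auto simp: D_def)
    also have "\<dots> \<le> (\<Sum>i. emeasure lborel (D i))"
      by (intro emeasure_subadditive_countably) (auto simp: D_def)
    also have "\<dots> \<le> (\<Sum>i. ennreal (unit_ball_vol 2 * (diameter (C i) / 2) powr 2))"
    proof (intro suminf_le summableI)
      fix i
      have "emeasure lborel (D i) \<le> ennreal (pi * (diameter (D i) / 2)\<^sup>2)"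
        by (rule isodiametric_inequality_plane[OF bd(1)]) (simp add: D_def)
      also have "\<dots> \<le> ennreal (pi * (diameter (C i) / 2)\<^sup>2)"
        using bd diameter_ge_0[OF bd(1)[of i]] by (intro ennreal_leI mult_left_mono power_mono) auto
      also have "\<dots> = ennreal (unit_ball_vol 2 * (diameter (C i) / 2) powr 2)"
        using bd(2)[of i] diameter_ge_0[OF bd(1)[of i]] by (simp add: unit_ball_vol_2)
      finally show "emeasure lborel (D i) \<le> ennreal (unit_ball_vol 2 * (diameter (C i) / 2) powr 2)" .
    qed
    finally show "emeasure lborel A \<le> (\<Sum>i. ennreal (unit_ball_vol 2 * (diameter (C i) / 2) powr 2))" .
  qed
  then show ?thesis using hausdorff_premeasure_le[of 1 2 "\<iota> ` A"] by (meson order_trans zero_less_one)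
qed

theorem hausdorff_outer_measure_isometric_plane:
  fixes \<iota> :: "real \<times> real \<Rightarrow> 'a::metric_space"
  assumes "\<And>p q. dist (\<iota> p) (\<iota> q) = dist p q" and "A \<in> sets borel"
  shows "hausdorff_outer_measure 2 (\<iota> ` A) = emeasure lborel A"
  using hausdorff_outer_measure_isometric_le[OF assms] hausdorff_outer_measure_isometric_ge[OF assms]
  by (rule antisym)

section \<open>Surface measure on planes and the divergence theorem for polytopes\<close>

definition slab :: "'a::euclidean_space \<Rightarrow> 'a set" where
  "slab n = {x. 0 \<le> x \<bullet> n \<and> x \<bullet> n \<le> 1}"

text \<open>The surface measure on the plane \<open>{x. x \<bullet> n = c}\<close>, for a unit vector \<open>n\<close>: the volume of the
  slab of thickness one that projects orthogonally onto a piece of the plane.\<close>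

definition plane_measure :: "'a::euclidean_space \<Rightarrow> real \<Rightarrow> 'a measure" where
  "plane_measure n c = distr (density lborel (indicator (slab n))) borel (\<lambda>x. x + (c - x \<bullet> n) *\<^sub>R n)"

lemma slab_borel[measurable]: "slab n \<in> sets borel"
proof -
  have "slab n = {x. 0 \<le> x \<bullet> n} \<inter> {x. x \<bullet> n \<le> 1}" by (auto simp: slab_def)
  moreover have "closed ({x. 0 \<le> x \<bullet> n} \<inter> {x. x \<bullet> n \<le> 1})"
    by (intro closed_Int closed_Collect_le continuous_intros)
  ultimately show ?thesis by (simp add: borel_closed)
qed

lemma sets_plane_measure[simp, measurable_cong]: "sets (plane_measure n c) = sets borel"
  by (simp add: plane_measure_def)

lemma space_plane_measure[simp]: "space (plane_measure n c) = UNIV"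
  by (simp add: plane_measure_def)

lemma nn_integral_plane_measure:
  assumes [measurable]: "f \<in> borel_measurable borel"
  shows "(\<integral>\<^sup>+x. f x \<partial>plane_measure n c) = (\<integral>\<^sup>+x. indicator (slab n) x * f (x + (c - x \<bullet> n) *\<^sub>R n) \<partial>lborel)"
  unfolding plane_measure_def
  by (subst nn_integral_distr; (subst nn_integral_density)?; measurable)

lemma nn_integral_lborel_translate:
  fixes f :: "'a::euclidean_space \<Rightarrow> ennreal"
  assumes [measurable]: "f \<in> borel_measurable borel"
  shows "(\<integral>\<^sup>+x. f (x + a) \<partial>lborel) = (\<integral>\<^sup>+x. f x \<partial>lborel)"
proof -
  have "(\<integral>\<^sup>+x. f x \<partial>lborel) = (\<integral>\<^sup>+x. f x \<partial>distr lborel borel ((+) a))"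
    by (simp add: lborel_distr_plus)
  also have "\<dots> = (\<integral>\<^sup>+x. f (a + x) \<partial>lborel)"
    by (subst nn_integral_distr) auto
  finally show ?thesis by (simp add: add.commute)
qed

text \<open>Each line of direction \<open>e\<close> meets \<open>S\<close> in the same length
  \<open>k\<close>, so integrating over the line through \<open>y\<close>, and then over
  \<open>y\<close> in \<open>S\<close>, counts every point with weight \<open>k\<close>. Tonelli and
  translation invariance replace a choice of coordinates.\<close>

lemma nn_integral_lborel_lines:
  fixes g :: "'a::euclidean_space \<Rightarrow> ennreal"
  assumes [measurable]: "g \<in> borel_measurable borel" "S \<in> sets borel"
    and k: "\<And>z. (\<integral>\<^sup>+\<tau>. indicator S (z - \<tau> *\<^sub>R e) \<partial>lborel) = k"
  shows "(\<integral>\<^sup>+y. indicator S y * (\<integral>\<^sup>+\<tau>. g (y + \<tau> *\<^sub>R e) \<partial>lborel) \<partial>lborel) = k * (\<integral>\<^sup>+z. g z \<partial>lborel)"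
proof -
  have "(\<integral>\<^sup>+y. indicator S y * (\<integral>\<^sup>+\<tau>. g (y + \<tau> *\<^sub>R e) \<partial>lborel) \<partial>lborel)
    = (\<integral>\<^sup>+y. \<integral>\<^sup>+\<tau>. indicator S y * g (y + \<tau> *\<^sub>R e) \<partial>lborel \<partial>lborel)"
    by (intro nn_integral_cong nn_integral_cmult[symmetric]) measurable
  also have "\<dots> = (\<integral>\<^sup>+\<tau>. \<integral>\<^sup>+y. indicator S y * g (y + \<tau> *\<^sub>R e) \<partial>lborel \<partial>lborel)"
    by (rule lborel_pair.Fubini') measurable
  also have "\<dots> = (\<integral>\<^sup>+\<tau>. \<integral>\<^sup>+z. indicator S (z - \<tau> *\<^sub>R e) * g z \<partial>lborel \<partial>lborel)"
  proof (rule nn_integral_cong)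
    fix \<tau> :: real
    show "(\<integral>\<^sup>+y. indicator S y * g (y + \<tau> *\<^sub>R e) \<partial>lborel) = (\<integral>\<^sup>+z. indicator S (z - \<tau> *\<^sub>R e) * g z \<partial>lborel)"
      using nn_integral_lborel_translate[of "\<lambda>z. indicator S (z - \<tau> *\<^sub>R e) * g z" "\<tau> *\<^sub>R e"] by simp
  qed
  also have "\<dots> = (\<integral>\<^sup>+z. \<integral>\<^sup>+\<tau>. indicator S (z - \<tau> *\<^sub>R e) * g z \<partial>lborel \<partial>lborel)"
    by (rule lborel_pair.Fubini') measurable
  also have "\<dots> = (\<integral>\<^sup>+z. k * g z \<partial>lborel)"
    by (subst nn_integral_multc) (auto simp: k)
  also have "\<dots> = k * (\<integral>\<^sup>+z. g z \<partial>lborel)"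
    by (rule nn_integral_cmult) measurable
  finally show ?thesis .
qed

lemma nn_integral_slab_line:
  assumes "n \<bullet> e \<noteq> 0"
  shows "(\<integral>\<^sup>+\<tau>. indicator (slab n) (z - \<tau> *\<^sub>R e) \<partial>lborel) = ennreal (1 / \<bar>n \<bullet> e\<bar>)"
proof -
  define a where "a = n \<bullet> e"
  define l where "l = min (z \<bullet> n / a) ((z \<bullet> n - 1) / a)"
  define u where "u = max (z \<bullet> n / a) ((z \<bullet> n - 1) / a)"
  have a: "a \<noteq> 0" using assms by (simp add: a_def)
  have "z - \<tau> *\<^sub>R e \<in> slab n \<longleftrightarrow> \<tau> \<in> {l..u}" for \<tau>
  proof -
    have "z - \<tau> *\<^sub>R e \<in> slab n \<longleftrightarrow> \<tau> * a \<le> z \<bullet> n \<and> z \<bullet> n - 1 \<le> \<tau> * a"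
      by (auto simp: slab_def a_def inner_diff_left inner_commute[of e n])
    also have "\<dots> \<longleftrightarrow> \<tau> \<in> {l..u}"
      using a by (cases "a > 0") (auto simp: l_def u_def min_def max_def field_simps)
    finally show ?thesis .
  qed
  then have "(\<integral>\<^sup>+\<tau>. indicator (slab n) (z - \<tau> *\<^sub>R e) \<partial>lborel) = (\<integral>\<^sup>+\<tau>. indicator {l..u} \<tau> \<partial>lborel)"
    by (intro nn_integral_cong) (auto simp: indicator_def)
  also have "\<dots> = ennreal (u - l)"
    by (simp add: l_def u_def)
  also have "u - l = 1 / \<bar>a\<bar>"
    using a by (cases "a > 0") (auto simp: l_def u_def min_def max_def field_simps)
  finally show ?thesis by (simp add: a_def)
qed

text \<open>\<open>F\<close> is constant along \<open>e\<close>, and \<open>slab e\<close> meets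
  every line of direction \<open>e\<close> in length 1, so integrating its indicator along such
  lines returns \<open>F\<close>. The lines meet \<open>slab n\<close> in length
  \<open>1 / \<bar>n \<bullet> e\<bar>\<close>, which is the factor.\<close>

lemma nn_integral_slab_change:
  fixes F :: "'a::euclidean_space \<Rightarrow> ennreal"
  assumes [measurable]: "F \<in> borel_measurable borel"
    and inv: "\<And>x \<tau>. F (x + \<tau> *\<^sub>R e) = F x" and e: "norm e = 1" and ne: "n \<bullet> e \<noteq> 0"
  shows "ennreal \<bar>n \<bullet> e\<bar> * (\<integral>\<^sup>+x. indicator (slab n) x * F x \<partial>lborel) = (\<integral>\<^sup>+x. indicator (slab e) x * F x \<partial>lborel)"
proof -
  have ee: "e \<bullet> e = 1" using e by (simp add: dot_square_norm)
  have "(\<integral>\<^sup>+y. indicator (slab n) y * (\<integral>\<^sup>+\<tau>. indicator (slab e) (y + \<tau> *\<^sub>R e) * F (y + \<tau> *\<^sub>R e) \<partial>lborel) \<partial>lborel)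
    = ennreal (1 / \<bar>n \<bullet> e\<bar>) * (\<integral>\<^sup>+z. indicator (slab e) z * F z \<partial>lborel)"
    by (rule nn_integral_lborel_lines[OF _ _ nn_integral_slab_line[OF ne], of "\<lambda>x. indicator (slab e) x * F x"]) measurable
  moreover have "(\<integral>\<^sup>+\<tau>. indicator (slab e) (y + \<tau> *\<^sub>R e) * F (y + \<tau> *\<^sub>R e) \<partial>lborel) = F y" for y
  proof -
    have *: "indicator (slab e) (y + \<tau> *\<^sub>R e) = (indicator {- (y \<bullet> e) .. 1 - y \<bullet> e} \<tau> :: ennreal)" for \<tau>
      by (auto simp: indicator_def slab_def inner_add_left ee)
    show ?thesis by (simp add: inv nn_integral_multc *)
  qed
  ultimately have "(\<integral>\<^sup>+y. indicator (slab n) y * F y \<partial>lborel)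
    = ennreal (1 / \<bar>n \<bullet> e\<bar>) * (\<integral>\<^sup>+z. indicator (slab e) z * F z \<partial>lborel)" by simp
  moreover have "ennreal \<bar>n \<bullet> e\<bar> * ennreal (1 / \<bar>n \<bullet> e\<bar>) = 1"
    using ne by (subst ennreal_mult[symmetric]) auto
  ultimately show ?thesis by (simp add: mult.assoc[symmetric])
qed

text \<open>Projecting along \<open>v\<close> instead of \<open>n\<close> is a shear. In the layer
  at level \<open>s\<close> the two projections differ by the translation
  \<open>(c - s) *\<^sub>R (v - n)\<close>, which is parallel to the plane and leaves the volume
  unchanged.\<close>

lemma nn_integral_plane_measure_oblique:
  fixes f :: "'a::euclidean_space \<Rightarrow> ennreal"
  assumes [measurable]: "f \<in> borel_measurable borel" and n: "norm n = 1" and v: "v \<bullet> n = 1"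
  shows "(\<integral>\<^sup>+x. f x \<partial>plane_measure n c) = (\<integral>\<^sup>+x. indicator (slab n) x * f (x + (c - x \<bullet> n) *\<^sub>R v) \<partial>lborel)"
proof -
  have nn: "n \<bullet> n = 1" using n by (simp add: dot_square_norm)
  have layers: "(\<integral>\<^sup>+x. indicator (slab n) x * f (x + (c - x \<bullet> n) *\<^sub>R v) \<partial>lborel) =
    (\<integral>\<^sup>+s. indicator {0..1} s * (\<integral>\<^sup>+y. indicator (slab n) y * f (y + (s - y \<bullet> n) *\<^sub>R n + (c - s) *\<^sub>R v) \<partial>lborel) \<partial>lborel)"
    (is "?L = _") for v
  proof -
    let ?G = "\<lambda>x. indicator (slab n) x * f (x + (c - x \<bullet> n) *\<^sub>R v)"
    have "?L = (\<integral>\<^sup>+y. indicator (slab n) y * (\<integral>\<^sup>+\<tau>. ?G (y + \<tau> *\<^sub>R n) \<partial>lborel) \<partial>lborel)"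
      by (subst nn_integral_lborel_lines[OF _ _ nn_integral_slab_line]) (simp_all add: nn)
    also have "\<dots> = (\<integral>\<^sup>+y. indicator (slab n) y * (\<integral>\<^sup>+s. indicator {0..1} s * f (y + (s - y \<bullet> n) *\<^sub>R n + (c - s) *\<^sub>R v) \<partial>lborel) \<partial>lborel)"
    proof (rule nn_integral_cong)
      fix y
      have "(\<integral>\<^sup>+\<tau>. ?G (y + \<tau> *\<^sub>R n) \<partial>lborel) = (\<integral>\<^sup>+s. ?G (y + (s + - (y \<bullet> n)) *\<^sub>R n) \<partial>lborel)"
        by (subst nn_integral_lborel_translate[of "\<lambda>\<tau>. ?G (y + \<tau> *\<^sub>R n)"]) auto
      also have "\<dots> = (\<integral>\<^sup>+s. indicator {0..1} s * f (y + (s - y \<bullet> n) *\<^sub>R n + (c - s) *\<^sub>R v) \<partial>lborel)"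
        by (intro nn_integral_cong) (auto simp: slab_def indicator_def inner_add_left nn)
      finally show "indicator (slab n) y * (\<integral>\<^sup>+\<tau>. ?G (y + \<tau> *\<^sub>R n) \<partial>lborel) = indicator (slab n) y *
        (\<integral>\<^sup>+s. indicator {0..1} s * f (y + (s - y \<bullet> n) *\<^sub>R n + (c - s) *\<^sub>R v) \<partial>lborel)" by (simp only:)
    qed
    also have "\<dots> = (\<integral>\<^sup>+y. \<integral>\<^sup>+s. indicator {0..1} s * (indicator (slab n) y * f (y + (s - y \<bullet> n) *\<^sub>R n + (c - s) *\<^sub>R v)) \<partial>lborel \<partial>lborel)"
      by (subst nn_integral_cmult[symmetric]) (simp_all add: mult.left_commute)
    also have "\<dots> = (\<integral>\<^sup>+s. \<integral>\<^sup>+y. indicator {0..1} s * (indicator (slab n) y * f (y + (s - y \<bullet> n) *\<^sub>R n + (c - s) *\<^sub>R v)) \<partial>lborel \<partial>lborel)"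
      by (rule lborel_pair.Fubini') measurable
    also have "\<dots> = (\<integral>\<^sup>+s. indicator {0..1} s * (\<integral>\<^sup>+y. indicator (slab n) y * f (y + (s - y \<bullet> n) *\<^sub>R n + (c - s) *\<^sub>R v) \<partial>lborel) \<partial>lborel)"
      by (intro nn_integral_cong nn_integral_cmult) measurable
    finally show ?thesis .
  qed
  have "(\<integral>\<^sup>+y. indicator (slab n) y * f (y + (s - y \<bullet> n) *\<^sub>R n + (c - s) *\<^sub>R v) \<partial>lborel) =
    (\<integral>\<^sup>+y. indicator (slab n) y * f (y + (s - y \<bullet> n) *\<^sub>R n + (c - s) *\<^sub>R n) \<partial>lborel)" for s
  proof -
    let ?w = "(c - s) *\<^sub>R (v - n)"
    have w: "(y + ?w) \<bullet> n = y \<bullet> n" for y using v nn by (simp add: inner_add_left inner_diff_left)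
    have "(\<integral>\<^sup>+y. indicator (slab n) y * f (y + (s - y \<bullet> n) *\<^sub>R n + (c - s) *\<^sub>R n) \<partial>lborel)
      = (\<integral>\<^sup>+y. indicator (slab n) (y + ?w) * f (y + ?w + (s - (y + ?w) \<bullet> n) *\<^sub>R n + (c - s) *\<^sub>R n) \<partial>lborel)"
      by (subst nn_integral_lborel_translate[of "\<lambda>y. indicator (slab n) y * f (y + (s - y \<bullet> n) *\<^sub>R n + (c - s) *\<^sub>R n)"]) auto
    also have "\<dots> = (\<integral>\<^sup>+y. indicator (slab n) y * f (y + (s - y \<bullet> n) *\<^sub>R n + (c - s) *\<^sub>R v) \<partial>lborel)"
      unfolding w by (intro nn_integral_cong arg_cong2[where f = "(*)"] arg_cong[where f = f])
        (simp_all add: slab_def indicator_def w algebra_simps nn v)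
    finally show ?thesis by simp
  qed
  then show ?thesis
    by (simp add: nn_integral_plane_measure layers[of v] layers[of n])
qed

text \<open>The plane is a graph in direction \<open>e\<close>. Normalising \<open>e\<close> to an
  oblique projection and then exchanging the slab of \<open>n\<close> for that of \<open>e\<close>
  produces the cosine factor between area and projected area.\<close>

lemma nn_integral_plane_measure_graph:
  fixes f :: "'a::euclidean_space \<Rightarrow> ennreal"
  assumes [measurable]: "f \<in> borel_measurable borel" and n: "norm n = 1" and e: "norm e = 1"
    and ne: "n \<bullet> e \<noteq> 0"
  shows "ennreal \<bar>n \<bullet> e\<bar> * (\<integral>\<^sup>+x. f x \<partial>plane_measure n c) =
    (\<integral>\<^sup>+y. indicator (slab e) y * f (y + ((c - y \<bullet> n) / (n \<bullet> e)) *\<^sub>R e) \<partial>lborel)"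
proof -
  let ?F = "\<lambda>y. f (y + ((c - y \<bullet> n) / (n \<bullet> e)) *\<^sub>R e)"
  have "(1 / (n \<bullet> e)) *\<^sub>R e \<bullet> n = 1" using ne by (simp add: inner_commute)
  then have "(\<integral>\<^sup>+x. f x \<partial>plane_measure n c) = (\<integral>\<^sup>+y. indicator (slab n) y * ?F y \<partial>lborel)"
    using n by (subst nn_integral_plane_measure_oblique[of f n "(1 / (n \<bullet> e)) *\<^sub>R e"]) auto
  moreover have "?F (x + \<tau> *\<^sub>R e) = ?F x" for x \<tau>
  proof -
    have "x + \<tau> *\<^sub>R e + ((c - (x + \<tau> *\<^sub>R e) \<bullet> n) / (n \<bullet> e)) *\<^sub>R e = x + ((c - x \<bullet> n) / (n \<bullet> e)) *\<^sub>R e"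
      using ne by (simp add: inner_add_left inner_commute[of e n] diff_divide_distrib add_divide_distrib algebra_simps)
    then show ?thesis by (simp only:)
  qed
  ultimately show ?thesis using nn_integral_slab_change[of ?F e n] e ne by simp
qed

lemma emeasure_plane_measure_bounded:
  assumes "norm n = 1" "bounded A" "A \<in> sets borel"
  shows "emeasure (plane_measure n c) A < \<infinity>"
proof -
  obtain R where R: "\<And>x. x \<in> A \<Longrightarrow> norm x \<le> R" using assms(2) by (auto simp: bounded_iff)
  have [measurable]: "A \<in> sets borel" by (rule assms(3))
  have "emeasure (plane_measure n c) A = (\<integral>\<^sup>+x. indicator A x \<partial>plane_measure n c)"
    using assms(3) by simp
  also have "\<dots> = (\<integral>\<^sup>+x. indicator (slab n) x * indicator A (x + (c - x \<bullet> n) *\<^sub>R n) \<partial>lborel)"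
    by (intro nn_integral_plane_measure) measurable
  also have "\<dots> \<le> (\<integral>\<^sup>+x. indicator (cball (0 :: 'a) (R + (\<bar>c\<bar> + 1))) x \<partial>lborel)"
  proof (intro nn_integral_mono)
    fix x
    have "norm x \<le> R + (\<bar>c\<bar> + 1)" if "x \<in> slab n" "x + (c - x \<bullet> n) *\<^sub>R n \<in> A"
    proof -
      have "norm x \<le> norm (x + (c - x \<bullet> n) *\<^sub>R n) + norm ((c - x \<bullet> n) *\<^sub>R n)"
        by (metis add_diff_cancel_right' norm_triangle_ineq4)
      also have "norm ((c - x \<bullet> n) *\<^sub>R n) \<le> \<bar>c\<bar> + 1" using that(1) assms(1) by (simp add: slab_def) linarith
      finally show ?thesis using R[OF that(2)] by simp
    qed
    then show "indicator (slab n) x * indicator A (x + (c - x \<bullet> n) *\<^sub>R n)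
      \<le> (indicator (cball 0 (R + (\<bar>c\<bar> + 1))) x :: ennreal)"
      by (auto simp: indicator_def)
  qed
  also have "\<dots> = emeasure lborel (cball (0 :: 'a) (R + (\<bar>c\<bar> + 1)))" by simp
  also have "\<dots> < \<infinity>" by (rule emeasure_bounded_finite) simp
  finally show ?thesis .
qed

text \<open>As an equality of measures, the graph formula also transports integrals of signed
  functions.\<close>

lemma density_plane_measure_eq_graph:
  fixes n e :: "'a::euclidean_space"
  assumes n: "norm n = 1" and e: "norm e = 1" and ne: "n \<bullet> e \<noteq> 0"
  shows "density (plane_measure n c) (\<lambda>_. ennreal \<bar>n \<bullet> e\<bar>) =
    distr (density lborel (\<lambda>y. ennreal (indicator (slab e) y))) borel (\<lambda>y. y + ((c - y \<bullet> n) / (n \<bullet> e)) *\<^sub>R e)"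
    (is "?L = ?R")
proof (rule measure_eqI)
  show "sets ?L = sets ?R" by simp
  fix A assume "A \<in> sets ?L"
  then have [measurable]: "A \<in> sets borel" by simp
  let ?h = "\<lambda>y. y + ((c - y \<bullet> n) / (n \<bullet> e)) *\<^sub>R e"
  have "?h \<in> borel_measurable borel" by measurable
  then have pre: "?h -` A \<in> sets borel" using measurable_sets[of ?h borel borel A] by simp
  have "emeasure ?L A = (\<integral>\<^sup>+x. ennreal \<bar>n \<bullet> e\<bar> * indicator A x \<partial>plane_measure n c)"
    by (subst emeasure_density) auto
  also have "\<dots> = ennreal \<bar>n \<bullet> e\<bar> * (\<integral>\<^sup>+x. indicator A x \<partial>plane_measure n c)"
    by (rule nn_integral_cmult) measurable
  also have "\<dots> = (\<integral>\<^sup>+y. indicator (slab e) y * indicator A (?h y) \<partial>lborel)"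
    by (rule nn_integral_plane_measure_graph[OF _ n e ne]) measurable
  also have "\<dots> = emeasure (density lborel (\<lambda>y. ennreal (indicator (slab e) y))) (?h -` A \<inter> space lborel)"
    using pre by (subst emeasure_density) (auto intro!: nn_integral_cong simp: indicator_def)
  also have "\<dots> = emeasure ?R A"
    by (subst emeasure_distr) auto
  finally show "emeasure ?L A = emeasure ?R A" .
qed

lemma
  fixes f :: "'a::euclidean_space \<Rightarrow> real"
  assumes n: "norm n = 1" and e: "norm e = 1" and ne: "n \<bullet> e \<noteq> 0"
    and f: "integrable (plane_measure n c) f"
  defines "h \<equiv> (\<lambda>y. y + ((c - y \<bullet> n) / (n \<bullet> e)) *\<^sub>R e)"
  shows integrable_plane_measure_graph: "integrable lborel (\<lambda>y. indicator (slab e) y * f (h y))"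
    and integral_plane_measure_graph:
      "(\<integral>y. indicator (slab e) y * f (h y) \<partial>lborel) = \<bar>n \<bullet> e\<bar> * (\<integral>x. f x \<partial>plane_measure n c)"
proof -
  have [measurable]: "f \<in> borel_measurable borel"
    using borel_measurable_integrable[OF f] by simp
  have [measurable]: "h \<in> borel_measurable borel" unfolding h_def by measurable
  note eq = density_plane_measure_eq_graph[OF n e ne, of c, folded h_def]
  have "integrable (density (plane_measure n c) (\<lambda>_. ennreal \<bar>n \<bullet> e\<bar>)) f"
    using f by (subst integrable_density) auto
  then show "integrable lborel (\<lambda>y. indicator (slab e) y * f (h y))"
    unfolding eq by (subst (asm) integrable_distr_eq; (subst (asm) integrable_density)?; simp)
  have "\<bar>n \<bullet> e\<bar> * (\<integral>x. f x \<partial>plane_measure n c) = (\<integral>x. f x \<partial>density (plane_measure n c) (\<lambda>_. ennreal \<bar>n \<bullet> e\<bar>))"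
    by (subst integral_density) auto
  also have "\<dots> = (\<integral>y. f (h y) \<partial>density lborel (\<lambda>y. ennreal (indicator (slab e) y)))"
    unfolding eq by (subst integral_distr) auto
  also have "\<dots> = (\<integral>y. indicator (slab e) y * f (h y) \<partial>lborel)"
    by (subst integral_density) auto
  finally show "(\<integral>y. indicator (slab e) y * f (h y) \<partial>lborel) = \<bar>n \<bullet> e\<bar> * (\<integral>x. f x \<partial>plane_measure n c)" ..
qed

text \<open>Lebesgue measure is the image of the product of \<open>slab e\<close> with a line under
  \<open>y + \<tau> *\<^sub>R e\<close>, which reduces the signed case to Fubini on a
  product.\<close>

lemma integral_lborel_lines:
  fixes g :: "'a::euclidean_space \<Rightarrow> real"
  assumes g: "integrable lborel g" and e: "norm e = 1"
  shows "(\<integral>x. g x \<partial>lborel) = (\<integral>y. indicator (slab e) y * (\<integral>\<tau>. g (y + \<tau> *\<^sub>R e) \<partial>lborel) \<partial>lborel)"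
proof -
  have ee: "e \<bullet> e \<noteq> 0" "\<bar>e \<bullet> e\<bar> = 1" using e by (simp_all add: dot_square_norm)
  define D where "D = density (lborel \<Otimes>\<^sub>M lborel) (\<lambda>p :: 'a \<times> real. ennreal (indicator (slab e) (fst p)))"
  have m: "(\<lambda>p. fst p + snd p *\<^sub>R e) \<in> borel_measurable (lborel \<Otimes>\<^sub>M lborel)" by measurable
  have sD: "sets D = sets (lborel \<Otimes>\<^sub>M lborel)" by (simp add: D_def)
  have mD [measurable]: "(\<lambda>p. fst p + snd p *\<^sub>R e) \<in> borel_measurable D"
    unfolding measurable_cong_sets[OF sD refl] by (rule m)
  have eq: "lborel = distr D borel (\<lambda>p. fst p + snd p *\<^sub>R e)"
  proof (rule measure_eqI)
    show "sets lborel = sets (distr D borel (\<lambda>p. fst p + snd p *\<^sub>R e))" by simp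
    fix A :: "'a set" assume "A \<in> sets lborel"
    then have [measurable]: "A \<in> sets borel" by simp
    have pre: "(\<lambda>p. fst p + snd p *\<^sub>R e) -` A \<inter> space (lborel \<Otimes>\<^sub>M lborel) \<in> sets (lborel \<Otimes>\<^sub>M (lborel :: real measure))"
      by (rule measurable_sets[OF m]) simp
    have "emeasure lborel A = 1 * (\<integral>\<^sup>+x. indicator A x \<partial>lborel)" by simp
    also have "\<dots> = (\<integral>\<^sup>+y. indicator (slab e) y * (\<integral>\<^sup>+\<tau>. indicator A (y + \<tau> *\<^sub>R e) \<partial>lborel) \<partial>lborel)"
      using nn_integral_slab_line[OF ee(1)] ee(2)
      by (intro nn_integral_lborel_lines[symmetric]) auto
    also have "\<dots> = (\<integral>\<^sup>+y. \<integral>\<^sup>+\<tau>. indicator (slab e) y * indicator A (y + \<tau> *\<^sub>R e) \<partial>lborel \<partial>lborel)"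
      by (intro nn_integral_cong nn_integral_cmult[symmetric]) measurable
    also have "\<dots> = (\<integral>\<^sup>+p. indicator (slab e) (fst p) * indicator A (fst p + snd p *\<^sub>R e) \<partial>(lborel \<Otimes>\<^sub>M lborel))"
      by (subst lborel.nn_integral_fst[symmetric]) auto
    also have "\<dots> = emeasure D ((\<lambda>p. fst p + snd p *\<^sub>R e) -` A \<inter> space D)"
      unfolding D_def space_density using pre
      by (subst emeasure_density) (auto intro!: nn_integral_cong simp: indicator_def space_pair_measure)
    also have "\<dots> = emeasure (distr D borel (\<lambda>p. fst p + snd p *\<^sub>R e)) A"
      by (subst emeasure_distr[OF mD]) auto
    finally show "emeasure lborel A = emeasure (distr D borel (\<lambda>p. fst p + snd p *\<^sub>R e)) A" .
  qed
  have [measurable]: "g \<in> borel_measurable borel"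
    using borel_measurable_integrable[OF g] by simp
  have "integrable lborel g = integrable (distr D borel (\<lambda>p. fst p + snd p *\<^sub>R e)) g"
    by (rule arg_cong[OF eq])
  then have "integrable D (\<lambda>p. g (fst p + snd p *\<^sub>R e))"
    using g integrable_distr_eq[OF mD, of g] by simp
  then have int: "integrable (lborel \<Otimes>\<^sub>M lborel) (\<lambda>p. indicator (slab e) (fst p) * g (fst p + snd p *\<^sub>R e))"
    unfolding D_def by (subst (asm) integrable_density) auto
  have "(\<integral>x. g x \<partial>lborel) = (\<integral>x. g x \<partial>distr D borel (\<lambda>p. fst p + snd p *\<^sub>R e))"
    by (rule arg_cong[OF eq])
  also have "\<dots> = (\<integral>p. g (fst p + snd p *\<^sub>R e) \<partial>D)"
    by (rule integral_distr[OF mD]) measurable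
  also have "\<dots> = (\<integral>p. indicator (slab e) (fst p) * g (fst p + snd p *\<^sub>R e) \<partial>(lborel \<Otimes>\<^sub>M lborel))"
    unfolding D_def by (subst integral_density) auto
  also have "\<dots> = (\<integral>y. \<integral>\<tau>. indicator (slab e) y * g (y + \<tau> *\<^sub>R e) \<partial>lborel \<partial>lborel)"
    using lborel_pair.integral_fst'[OF int] by simp
  finally show ?thesis by simp
qed

text \<open>A nonempty \<open>I\<close> is a compact interval, so the left side is the difference of
  \<open>g\<close> at its ends. By \<open>inj\<close> each end belongs to exactly one constraint,
  the sign of \<open>\<alpha>\<close> tells upper from lower, and every other quotient lies outside
  \<open>I\<close>. Constraints with \<open>\<alpha> n = 0\<close> are removed by
  \<open>sgn 0 = 0\<close>.\<close>

lemma integral_derivative_interval_constraints: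
  fixes \<alpha> \<beta> :: "'i \<Rightarrow> real" and g g' :: "real \<Rightarrow> real"
  assumes "finite N"
  defines "I \<equiv> {\<tau>. \<forall>n\<in>N. \<tau> * \<alpha> n \<le> \<beta> n}"
  assumes bdd: "bounded I"
    and inj: "\<And>n m. n \<in> N \<Longrightarrow> m \<in> N \<Longrightarrow> \<alpha> n \<noteq> 0 \<Longrightarrow> \<alpha> m \<noteq> 0 \<Longrightarrow> \<beta> n / \<alpha> n = \<beta> m / \<alpha> m \<Longrightarrow> n = m"
    and deriv: "\<And>\<tau>. (g has_real_derivative g' \<tau>) (at \<tau>)" and cont: "\<And>\<tau>. isCont g' \<tau>"
  shows "(\<integral>\<tau>. indicator I \<tau> * g' \<tau> \<partial>lborel) =
    (\<Sum>n\<in>N. sgn (\<alpha> n) * (indicator I (\<beta> n / \<alpha> n) * g (\<beta> n / \<alpha> n)))"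
proof (cases "I = {}")
  case True
  then show ?thesis by simp
next
  case False
  then obtain t where t: "t \<in> I" by auto
  obtain K where K: "\<And>x. x \<in> I \<Longrightarrow> \<bar>x\<bar> \<le> K" using bdd by (auto simp: bounded_real)
  define h where "h n = \<beta> n / \<alpha> n" for n
  define U where "U = {n\<in>N. \<alpha> n > 0}"
  define L where "L = {n\<in>N. \<alpha> n < 0}"
  have fin: "finite U" "finite L" using \<open>finite N\<close> by (auto simp: U_def L_def)
  have "U \<noteq> {}"
  proof
    assume "U = {}"
    then have "\<alpha> n \<le> 0" if "n \<in> N" for n using that by (force simp: U_def)
    then have "(\<bar>t\<bar> + \<bar>K\<bar> + 1) * \<alpha> n \<le> 0" if "n \<in> N" for n
      using that by (intro mult_nonneg_nonpos) auto
    then have "t + (\<bar>t\<bar> + \<bar>K\<bar> + 1) \<in> I"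
      unfolding I_def mem_Collect_eq distrib_right[of t] using t by (fastforce simp: I_def)
    then show False using K by fastforce
  qed
  have "L \<noteq> {}"
  proof
    assume "L = {}"
    then have "0 \<le> \<alpha> n" if "n \<in> N" for n using that by (force simp: L_def)
    then have "0 \<le> (\<bar>t\<bar> + \<bar>K\<bar> + 1) * \<alpha> n" if "n \<in> N" for n
      using that by (intro mult_nonneg_nonneg) auto
    then have "t - (\<bar>t\<bar> + \<bar>K\<bar> + 1) \<in> I"
      unfolding I_def mem_Collect_eq left_diff_distrib[of t] using t by (fastforce simp: I_def)
    then show False using K by fastforce
  qed
  define b where "b = Min (h ` U)"
  define a where "a = Max (h ` L)"
  have "b \<in> h ` U" unfolding b_def using fin \<open>U \<noteq> {}\<close> by (intro Min_in) auto
  then obtain p where p: "p \<in> U" "h p = b" by blast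
  have "a \<in> h ` L" unfolding a_def using fin \<open>L \<noteq> {}\<close> by (intro Max_in) auto
  then obtain q where q: "q \<in> L" "h q = a" by blast
  have b_le: "b \<le> h n" if "n \<in> U" for n unfolding b_def using that fin by (intro Min_le) auto
  have le_a: "h n \<le> a" if "n \<in> L" for n unfolding a_def using that fin by (intro Max_ge) auto
  have I_eq: "I = {a..b}"
  proof (intro set_eqI iffI)
    fix x assume "x \<in> I"
    then have "x * \<alpha> p \<le> \<beta> p" "x * \<alpha> q \<le> \<beta> q" using p q by (auto simp: I_def U_def L_def)
    then show "x \<in> {a..b}" using p q by (auto simp: h_def U_def L_def field_simps)
  next
    fix x assume x: "x \<in> {a..b}"
    have "x * \<alpha> n \<le> \<beta> n" if nN: "n \<in> N" for n
    proof (cases "\<alpha> n = 0")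
      case True
      then show ?thesis using t nN by (auto simp: I_def)
    next
      case False
      then consider "n \<in> U" | "n \<in> L" using nN unfolding U_def L_def by fastforce
      then show ?thesis
      proof cases
        case 1
        have "x \<le> h n" using b_le[OF 1] x by simp
        then show ?thesis using 1 by (simp add: h_def U_def pos_le_divide_eq)
      next
        case 2
        have "h n \<le> x" using le_a[OF 2] x by simp
        then show ?thesis using 2 by (simp add: h_def L_def neg_divide_le_eq)
      qed
    qed
    then show "x \<in> I" by (simp add: I_def)
  qed
  have "a \<le> b" using t I_eq by auto
  have pN: "p \<in> N" "\<alpha> p > 0" and qN: "q \<in> N" "\<alpha> q < 0" using p q by (auto simp: U_def L_def)
  have h_inj: "n = m" if "n \<in> N" "m \<in> N" "\<alpha> n \<noteq> 0" "\<alpha> m \<noteq> 0" "h n = h m" for n m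
    using inj[OF that(1-4)] that(5) by (simp only: h_def)
  have eq_p: "n = p" if "n \<in> U" "h n \<in> I" for n
  proof (rule h_inj)
    show "h n = h p" using that(2) b_le[OF that(1)] p(2) by (simp add: I_eq)
  qed (use that pN in \<open>auto simp: U_def\<close>)
  have eq_q: "n = q" if "n \<in> L" "h n \<in> I" for n
  proof (rule h_inj)
    show "h n = h q" using that(2) le_a[OF that(1)] q(2) by (simp add: I_eq)
  qed (use that qN in \<open>auto simp: L_def\<close>)
  have "sgn (\<alpha> n) * (indicator I (h n) * g (h n)) = (if n = p then g b else 0) - (if n = q then g a else 0)"
    if "n \<in> N" for n
  proof -
    consider "\<alpha> n = 0" | "n \<in> U" | "n \<in> L" using \<open>n \<in> N\<close> unfolding U_def L_def by fastforce
    then show ?thesis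
    proof cases
      case 1
      then show ?thesis using pN qN by auto
    next
      case 2
      then have "n \<noteq> q" "sgn (\<alpha> n) = 1" using qN by (auto simp: U_def)
      moreover have "indicator I (h n) * g (h n) = (if n = p then g b else 0)"
      proof (cases "n = p")
        case True
        then show ?thesis using p \<open>a \<le> b\<close> by (simp add: I_eq)
      next
        case False
        then have "h n \<notin> I" using eq_p[OF 2] by blast
        then show ?thesis using False by simp
      qed
      ultimately show ?thesis by simp
    next
      case 3
      then have "n \<noteq> p" "sgn (\<alpha> n) = - 1" using pN by (auto simp: L_def)
      moreover have "indicator I (h n) * g (h n) = (if n = q then g a else 0)"
      proof (cases "n = q")
        case True
        then show ?thesis using q \<open>a \<le> b\<close> by (simp add: I_eq)
      next
        case False
        then have "h n \<notin> I" using eq_q[OF 3] by blast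
        then show ?thesis using False by simp
      qed
      ultimately show ?thesis by simp
    qed
  qed
  then have "(\<Sum>n\<in>N. sgn (\<alpha> n) * (indicator I (h n) * g (h n))) = g b - g a"
    using \<open>finite N\<close> pN qN by (simp add: sum_subtractf)
  moreover have "(\<integral>\<tau>. indicator I \<tau> * g' \<tau> \<partial>lborel) = g b - g a"
    unfolding I_eq using integral_FTC_Icc_real[OF \<open>a \<le> b\<close>, of g g'] deriv cont by (simp add: mult.commute)
  ultimately show ?thesis by (simp add: h_def)
qed

section \<open>Bounded polytopes and directional derivatives\<close>

locale bounded_polytope =
  fixes N :: "'a::euclidean_space set" and c :: "'a \<Rightarrow> real" and W :: "'a set"
  defines "W \<equiv> {x. \<forall>n\<in>N. x \<bullet> n \<le> c n}"
  assumes finite_normals: "finite N" and unit_normals: "\<And>n. n \<in> N \<Longrightarrow> norm n = 1"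
    and pos_offsets: "\<And>n. n \<in> N \<Longrightarrow> 0 < c n" and bounded_body: "bounded W"
begin

lemma compact_body: "compact W"
proof -
  have "W = (\<Inter>n\<in>N. {x. x \<bullet> n \<le> c n})" by (auto simp: W_def)
  moreover have "closed (\<Inter>n\<in>N. {x. x \<bullet> n \<le> c n})"
    by (intro closed_INT ballI closed_Collect_le continuous_intros)
  ultimately show ?thesis using bounded_body by (simp add: compact_eq_bounded_closed)
qed

lemma body_borel[measurable]: "W \<in> sets borel"
  by (rule borel_compact[OF compact_body])

text \<open>Two constraints with distinct unit normals could share a bounding hyperplane only if
  both normals and offsets were opposite, which positive offsets exclude. Hence equations comparing
  two constraints are nontrivial and their solutions negligible.\<close>

lemma normals_independent:
  assumes "n \<in> N" "m \<in> N" "n \<noteq> m" "a \<noteq> 0"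
  shows "a *\<^sub>R n - b *\<^sub>R m \<noteq> 0 \<or> a * c n - b * c m \<noteq> 0"
proof (rule ccontr)
  assume "\<not> ?thesis"
  then have eq: "a *\<^sub>R n = b *\<^sub>R m" "a * c n = b * c m" by auto
  then have "\<bar>a\<bar> = \<bar>b\<bar>"
    using arg_cong[OF eq(1), of norm] unit_normals[OF assms(1)] unit_normals[OF assms(2)]
    by (metis norm_scaleR mult_1_right)
  then consider "a = b" | "a = - b" by linarith
  then show False
  proof cases
    case 1
    with eq assms show False by simp
  next
    case 2
    then have "a * (c n + c m) = 0" using eq(2) by (simp add: algebra_simps)
    then show False using \<open>a \<noteq> 0\<close> pos_offsets[OF assms(1)] pos_offsets[OF assms(2)] by simp
  qed
qed

lemma integrable_body_lborel:
  assumes "continuous_on UNIV f"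
  shows "integrable lborel (\<lambda>x. indicator W x * f x :: real)"
  using borel_integrable_compact[OF compact_body continuous_on_subset[OF assms subset_UNIV]]
  unfolding real_scaleR_def .

lemma integrable_body_plane_measure:
  assumes f: "continuous_on UNIV f" and n: "n \<in> N" and A: "A \<in> sets borel" "A \<subseteq> W"
  shows "integrable (plane_measure n k) (\<lambda>x. indicator A x * f x :: real)"
proof -
  obtain B where B: "\<And>x. x \<in> W \<Longrightarrow> norm (f x) \<le> B"
    using compact_imp_bounded[OF compact_continuous_image[OF continuous_on_subset[OF f] compact_body]]
    by (auto simp: bounded_iff)
  have [measurable]: "f \<in> borel_measurable borel" using f by (rule borel_measurable_continuous_onI)
  have "integrable (plane_measure n k) (\<lambda>x. indicator A x *\<^sub>R f x)"
    using A B emeasure_plane_measure_bounded[OF unit_normals[OF n] bounded_subset[OF bounded_body A(2)] A(1)]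
    by (intro integrableI_bounded_set_indicator[where B = B]) auto
  then show ?thesis by simp
qed

text \<open>On each chord of direction \<open>e\<close> the fundamental theorem leaves the values of
  \<open>f\<close> at the two ends, every end on the plane of one constraint. Integrating over
  chords, the graph formula contributes \<open>\<bar>n \<bullet> e\<bar>\<close>, which the sign of
  the end completes to \<open>n \<bullet> e\<close>.\<close>

theorem integral_directional_derivative:
  fixes f D :: "'a \<Rightarrow> real"
  assumes e: "norm e = 1"
    and deriv: "\<And>x \<tau>. ((\<lambda>\<tau>. f (x + \<tau> *\<^sub>R e)) has_real_derivative D (x + \<tau> *\<^sub>R e)) (at \<tau>)"
    and f: "continuous_on UNIV f" and D: "continuous_on UNIV D"
  shows "(\<integral>x. indicator W x * D x \<partial>lborel) =
    (\<Sum>n\<in>N. (n \<bullet> e) * (\<integral>x. indicator W x * f x \<partial>plane_measure n (c n)))"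
proof -
  have [measurable]: "f \<in> borel_measurable borel" "D \<in> borel_measurable borel"
    using f D by (auto intro: borel_measurable_continuous_onI)
  define h where "h n y = (c n - y \<bullet> n) / (n \<bullet> e)" for n y
  have [measurable]: "h n \<in> borel_measurable borel" for n unfolding h_def by measurable
  \<comment> \<open>Lines that meet two constraint planes at the same point pass through a null set
    of base points: coincidence of two crossing parameters is an affine equation in
    \<open>y\<close>, nontrivial by \<open>normals_independent\<close>.\<close>
  have "AE y in lborel. \<forall>n\<in>N. \<forall>m\<in>N. n \<bullet> e \<noteq> 0 \<and> m \<bullet> e \<noteq> 0 \<and> n \<noteq> m \<longrightarrow> h n y \<noteq> h m y"
  proof (intro AE_finite_allI[OF finite_normals])
    fix n m assume nm: "n \<in> N" "m \<in> N"
    show "AE y in lborel. n \<bullet> e \<noteq> 0 \<and> m \<bullet> e \<noteq> 0 \<and> n \<noteq> m \<longrightarrow> h n y \<noteq> h m y"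
    proof (cases "n \<bullet> e \<noteq> 0 \<and> m \<bullet> e \<noteq> 0 \<and> n \<noteq> m")
      case True
      let ?a = "(m \<bullet> e) *\<^sub>R n - (n \<bullet> e) *\<^sub>R m" and ?b = "(m \<bullet> e) * c n - (n \<bullet> e) * c m"
      have "?a \<noteq> 0 \<or> ?b \<noteq> 0" using normals_independent nm True by blast
      then have "negligible {y. ?a \<bullet> y = ?b}" by (rule negligible_hyperplane)
      moreover have "closed {y. ?a \<bullet> y = ?b}" by (rule closed_hyperplane)
      ultimately have "{y. ?a \<bullet> y = ?b} \<in> null_sets lborel"
        by (simp add: negligible_iff_null_sets null_sets_completion_iff borel_closed)
      then have "AE y in lborel. y \<notin> {y. ?a \<bullet> y = ?b}" by (rule AE_not_in)
      then show ?thesis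
      proof eventually_elim
        case (elim y)
        then show ?case using True
          by (auto simp: h_def frac_eq_eq inner_diff_left inner_commute[of y] algebra_simps)
      qed
    qed auto
  qed
  then have "AE y in lborel. (\<integral>\<tau>. indicator W (y + \<tau> *\<^sub>R e) * D (y + \<tau> *\<^sub>R e) \<partial>lborel) =
      (\<Sum>n\<in>N. sgn (n \<bullet> e) * (indicator W (y + h n y *\<^sub>R e) * f (y + h n y *\<^sub>R e)))"
  proof eventually_elim
    case (elim y)
    define I where "I = {\<tau>. \<forall>n\<in>N. \<tau> * (n \<bullet> e) \<le> c n - y \<bullet> n}"
    have I: "y + \<tau> *\<^sub>R e \<in> W \<longleftrightarrow> \<tau> \<in> I" for \<tau>
      by (auto simp: W_def I_def inner_add_left inner_commute[of e] algebra_simps)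
    then have ind: "indicator W (y + \<tau> *\<^sub>R e) = (indicator I \<tau> :: real)" for \<tau>
      by (simp add: indicator_def)
    obtain B where B: "\<And>x. x \<in> W \<Longrightarrow> norm x \<le> B" using bounded_body by (auto simp: bounded_iff)
    have "norm \<tau> \<le> B + norm y" if "\<tau> \<in> I" for \<tau>
    proof -
      have "norm (\<tau> *\<^sub>R e) \<le> norm (y + \<tau> *\<^sub>R e) + norm y"
        using norm_triangle_ineq4[of "y + \<tau> *\<^sub>R e" y] by simp
      then show ?thesis using B[of "y + \<tau> *\<^sub>R e"] I that e by simp
    qed
    then have "bounded I" unfolding bounded_iff by blast
    have "continuous_on UNIV (\<lambda>\<tau>. D (y + \<tau> *\<^sub>R e))"
      by (rule continuous_on_compose2[OF D]) (auto intro!: continuous_intros)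
    then have cont: "isCont (\<lambda>\<tau>. D (y + \<tau> *\<^sub>R e)) \<tau>" for \<tau>
      by (simp add: continuous_on_eq_continuous_at)
    have inj: "n = m" if "n \<in> N" "m \<in> N" "n \<bullet> e \<noteq> 0" "m \<bullet> e \<noteq> 0"
      "(c n - y \<bullet> n) / (n \<bullet> e) = (c m - y \<bullet> m) / (m \<bullet> e)" for n m
      using elim that unfolding h_def by blast
    show ?case
      unfolding ind h_def I_def
      by (rule integral_derivative_interval_constraints[of N "\<lambda>n. n \<bullet> e" "\<lambda>n. c n - y \<bullet> n",
            OF finite_normals \<open>bounded I\<close>[unfolded I_def] inj deriv cont])
  qed
  then have "(\<integral>x. indicator W x * D x \<partial>lborel) = (\<integral>y. (\<Sum>n\<in>N. sgn (n \<bullet> e) *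
     (indicator (slab e) y * (indicator W (y + h n y *\<^sub>R e) * f (y + h n y *\<^sub>R e)))) \<partial>lborel)"
    unfolding integral_lborel_lines[OF integrable_body_lborel[OF D] e]
  proof (intro integral_cong_AE)
    show "AE y in lborel. indicator (slab e) y * (\<integral>\<tau>. indicator W (y + \<tau> *\<^sub>R e) * D (y + \<tau> *\<^sub>R e) \<partial>lborel) =
      (\<Sum>n\<in>N. sgn (n \<bullet> e) * (indicator (slab e) y * (indicator W (y + h n y *\<^sub>R e) * f (y + h n y *\<^sub>R e))))"
      if "AE y in lborel. (\<integral>\<tau>. indicator W (y + \<tau> *\<^sub>R e) * D (y + \<tau> *\<^sub>R e) \<partial>lborel) =
        (\<Sum>n\<in>N. sgn (n \<bullet> e) * (indicator W (y + h n y *\<^sub>R e) * f (y + h n y *\<^sub>R e)))"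
      using that by eventually_elim (simp add: sum_distrib_left mult.left_commute)
  qed measurable
  also have "\<dots> = (\<Sum>n\<in>N. \<integral>y. sgn (n \<bullet> e) *
     (indicator (slab e) y * (indicator W (y + h n y *\<^sub>R e) * f (y + h n y *\<^sub>R e))) \<partial>lborel)"
  proof (rule Bochner_Integration.integral_sum)
    fix n assume "n \<in> N"
    show "integrable lborel (\<lambda>y. sgn (n \<bullet> e) *
     (indicator (slab e) y * (indicator W (y + h n y *\<^sub>R e) * f (y + h n y *\<^sub>R e))))"
      using integrable_plane_measure_graph[OF unit_normals[OF \<open>n \<in> N\<close>] e _
          integrable_body_plane_measure[OF f \<open>n \<in> N\<close> body_borel subset_refl], of "c n"]
      by (cases "n \<bullet> e = 0") (auto simp: h_def)
  qed
  also have "\<dots> = (\<Sum>n\<in>N. (n \<bullet> e) * (\<integral>x. indicator W x * f x \<partial>plane_measure n (c n)))"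
  proof (rule sum.cong[OF refl])
    fix n assume "n \<in> N"
    have "(\<integral>y. indicator (slab e) y * (indicator W (y + h n y *\<^sub>R e) * f (y + h n y *\<^sub>R e)) \<partial>lborel)
      = \<bar>n \<bullet> e\<bar> * (\<integral>x. indicator W x * f x \<partial>plane_measure n (c n))" if "n \<bullet> e \<noteq> 0"
      using integral_plane_measure_graph[OF unit_normals[OF \<open>n \<in> N\<close>] e that
          integrable_body_plane_measure[OF f \<open>n \<in> N\<close> body_borel subset_refl], of "c n"]
      by (simp only: h_def)
    note graph = this
    show "(\<integral>y. sgn (n \<bullet> e) * (indicator (slab e) y * (indicator W (y + h n y *\<^sub>R e) * f (y + h n y *\<^sub>R e))) \<partial>lborel)
      = (n \<bullet> e) * (\<integral>x. indicator W x * f x \<partial>plane_measure n (c n))"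
    proof (cases "n \<bullet> e = 0")
      case False
      show ?thesis
        unfolding integral_mult_right_zero graph[OF False] by (metis mult.assoc sgn_mult_abs)
    qed simp
  qed
  finally show ?thesis .
qed

end

section \<open>Plane measure and Hausdorff measure in three-space\<close>

lemma distr_lborel_orthogonal_transformation:
  fixes f :: "real ^ 3 \<Rightarrow> real ^ 3"
  assumes "orthogonal_transformation f"
  shows "distr lborel borel f = lborel"
proof (rule lborel_eqI[symmetric])
  have m: "f \<in> borel_measurable borel"
    using assms by (intro borel_measurable_continuous_onI linear_continuous_on)
      (simp add: orthogonal_transformation_linear linear_conv_bounded_linear[symmetric])
  have bij: "bij f" and inv: "orthogonal_transformation (inv f)"
    using assms by (simp_all add: orthogonal_transformation_bij orthogonal_transformation_inv)
  fix l u :: "real ^ 3" assume lu: "\<And>b. b \<in> Basis \<Longrightarrow> l \<bullet> b \<le> u \<bullet> b"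
  have pre: "f -` box l u = inv f ` box l u" using bij by (simp add: bij_vimage_eq_inv_image)
  have B: "f -` box l u \<in> sets borel" using measurable_sets[OF m, of "box l u"] by simp
  have lm: "box l u \<in> lmeasurable" by simp
  have "emeasure (distr lborel borel f) (box l u) = emeasure lborel (f -` box l u)"
    using m by (subst emeasure_distr) auto
  also have "\<dots> = emeasure lebesgue (f -` box l u)"
    using B by (simp add: emeasure_completion)
  also have "\<dots> = ennreal (measure lebesgue (inv f ` box l u))"
    unfolding pre using measurable_orthogonal_image[OF inv lm] by (rule emeasure_eq_measure2)
  also have "\<dots> = ennreal (measure lebesgue (box l u))"
    by (simp only: measure_orthogonal_image[OF inv lm])
  also have "\<dots> = emeasure lborel (box l u)"
    using emeasure_eq_measure2[OF lm] by simp
  also have "\<dots> = (\<Prod>b\<in>Basis. (u - l) \<bullet> b)"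
    using lu by (simp add: emeasure_lborel_box_eq)
  finally show "emeasure (distr lborel borel f) (box l u) = (\<Prod>b\<in>Basis. (u - l) \<bullet> b)" .
qed simp

lemma vector_3_axis: "vector [a, b, c] = a *\<^sub>R axis 1 1 + b *\<^sub>R axis 2 1 + c *\<^sub>R (axis 3 1 :: real ^ 3)"
  by (simp add: vec_eq_iff forall_3 axis_def)

lemma distr_lborel_vector_3:
  "distr lborel borel (\<lambda>p :: (real \<times> real) \<times> real. vector [fst (fst p), snd (fst p), snd p] :: real ^ 3) = lborel"
    (is "distr _ _ ?f = _")
proof (rule lborel_eqI[symmetric])
  have "continuous_on UNIV ?f"
    unfolding vector_3_axis by (intro continuous_intros)
  then have m: "?f \<in> borel_measurable borel" by (rule borel_measurable_continuous_onI)
  fix l u :: "real ^ 3" assume lu: "\<And>b. b \<in> Basis \<Longrightarrow> l \<bullet> b \<le> u \<bullet> b"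
  have comp: "l $ i \<le> u $ i" for i using lu[of "axis i 1"] by (simp add: axis_in_Basis_iff inner_axis)
  have "emeasure (distr lborel borel ?f) (box l u) = emeasure lborel (?f -` box l u)"
    using m by (subst emeasure_distr) auto
  also have "?f -` box l u = ({l$1<..<u$1} \<times> {l$2<..<u$2}) \<times> {l$3<..<u$3}"
    by (auto simp: mem_box_cart forall_3)
  also have "emeasure lborel \<dots> = emeasure (lborel \<Otimes>\<^sub>M lborel) (({l$1<..<u$1} \<times> {l$2<..<u$2}) \<times> {l$3<..<u$3})"
    by (simp add: lborel_prod)
  also have "\<dots> = emeasure lborel ({l$1<..<u$1} \<times> {l$2<..<u$2}) * emeasure lborel {l$3<..<u$3}"
    by (intro lborel.emeasure_pair_measure_Times) (auto simp: borel_prod[symmetric])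
  also have "emeasure lborel ({l$1<..<u$1} \<times> {l$2<..<u$2}) = emeasure (lborel \<Otimes>\<^sub>M lborel) ({l$1<..<u$1} \<times> {l$2<..<u$2})"
    by (simp add: lborel_prod)
  also have "\<dots> = emeasure lborel {l$1<..<u$1} * emeasure lborel {l$2<..<u$2}"
    by (intro lborel.emeasure_pair_measure_Times) auto
  also have "\<dots> * emeasure lborel {l$3<..<u$3} = ennreal ((u$1 - l$1) * (u$2 - l$2) * (u$3 - l$3))"
    using comp by (simp add: ennreal_mult)
  also have "(u$1 - l$1) * (u$2 - l$2) * (u$3 - l$3) = (\<Prod>i\<in>UNIV. (u - l) $ i)"
    unfolding UNIV_3 by simp
  also have "\<dots> = (\<Prod>b\<in>Basis. (u - l) \<bullet> b)"
  proof -
    have "Basis = range (\<lambda>i. axis i 1 :: real ^ 3)" by (auto simp: Basis_vec_def)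
    then have "(\<Prod>b\<in>Basis. (u - l) \<bullet> b) = (\<Prod>b\<in>range (\<lambda>i. axis i 1). (u - l) \<bullet> b)" by (rule arg_cong)
    then show ?thesis by (simp add: prod.reindex inj_on_def axis_eq_axis inner_axis)
  qed
  finally show "emeasure (distr lborel borel ?f) (box l u) = (\<Prod>b\<in>Basis. (u - l) \<bullet> b)" .
qed simp

text \<open>An orthogonal map that takes the third axis to \<open>n\<close> turns the plane into a
  horizontal one and the slab into a product with the unit interval. Tonelli then identifies the
  plane measure with area in the parameter plane.\<close>

lemma plane_isometric_parametrization:
  fixes n :: "real ^ 3"
  assumes "norm n = 1"
  shows "\<exists>\<iota> :: real \<times> real \<Rightarrow> real ^ 3. (\<forall>p q. dist (\<iota> p) (\<iota> q) = dist p q) \<and>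
    range \<iota> = {x. x \<bullet> n = c} \<and> \<iota> \<in> borel_measurable borel \<and>
    (\<forall>A\<in>sets borel. emeasure (plane_measure n c) A = emeasure lborel (\<iota> -` A))"
proof -
  obtain R :: "real ^ 3 \<Rightarrow> real ^ 3" where R: "orthogonal_transformation R" "R (axis 3 1) = n"
    using orthogonal_transformation_exists_1[of "axis 3 1" n] assms by auto
  have lin: "linear R" by (rule orthogonal_transformation_linear[OF R(1)])
  let ?v = "\<lambda>p :: (real \<times> real) \<times> real. vector [fst (fst p), snd (fst p), snd p] :: real ^ 3"
  define \<iota> where "\<iota> q = R (?v (q, c))" for q
  have inn: "R x \<bullet> n = x $ 3" for x
    using R(1) unfolding R(2)[symmetric] orthogonal_transformation_def by (simp add: cart_eq_inner_axis)
  have dR: "dist (R x) (R y) = dist x y" for x y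
    unfolding dist_norm linear_diff[OF lin, symmetric] by (rule orthogonal_transformation_norm[OF R(1)])
  have iso: "dist (\<iota> p) (\<iota> q) = dist p q" for p q
  proof -
    have "dist (\<iota> p) (\<iota> q) = dist (?v (p, c)) (?v (q, c))" by (simp only: \<iota>_def dR)
    also have "\<dots> = dist p q" by (simp add: dist_vec_def L2_set_def sum_3 dist_prod_def)
    finally show ?thesis .
  qed
  have ran: "range \<iota> = {x. x \<bullet> n = c}"
  proof (intro equalityI subsetI)
    fix x assume "x \<in> {x. x \<bullet> n = c}"
    obtain y where y: "x = R y" using R(1) by (metis orthogonal_transformation_surj surjD)
    then have "y $ 3 = c" using inn[of y] \<open>x \<in> _\<close> by simp
    then have "x = \<iota> (y $ 1, y $ 2)" unfolding y \<iota>_def by (intro arg_cong[where f = R]) (simp add: vec_eq_iff forall_3)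
    then show "x \<in> range \<iota>" by simp
  qed (auto simp: \<iota>_def inn)
  have "continuous_on UNIV \<iota>"
    unfolding continuous_on_iff using iso by auto
  then have m: "\<iota> \<in> borel_measurable borel" by (rule borel_measurable_continuous_onI)
  have [measurable]: "R \<in> borel_measurable borel"
    using lin by (intro borel_measurable_continuous_onI linear_continuous_on) (simp add: linear_conv_bounded_linear[symmetric])
  have "continuous_on UNIV ?v"
    unfolding vector_3_axis by (intro continuous_intros)
  then have v[measurable]: "?v \<in> borel_measurable borel" by (rule borel_measurable_continuous_onI)
  have "emeasure (plane_measure n c) A = emeasure lborel (\<iota> -` A)" if A: "A \<in> sets borel" for A
  proof -
    have [measurable]: "A \<in> sets borel" by (rule A)
    have [measurable]: "\<iota> \<in> borel_measurable borel" by (rule m)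
    have pre: "\<iota> -` A \<in> sets borel" using measurable_sets[OF m A] by simp
    define g where "g = (\<lambda>x. indicator (slab n) x * indicator A (x + (c - x \<bullet> n) *\<^sub>R n) :: ennreal)"
    have [measurable]: "g \<in> borel_measurable borel" unfolding g_def by measurable
    have "emeasure (plane_measure n c) A = (\<integral>\<^sup>+x. indicator A x \<partial>plane_measure n c)" by simp
    also have "\<dots> = (\<integral>\<^sup>+x. g x \<partial>lborel)"
      unfolding g_def by (rule nn_integral_plane_measure) measurable
    also have "\<dots> = (\<integral>\<^sup>+x. g x \<partial>distr (distr lborel borel ?v) borel R)"
      by (simp only: distr_lborel_vector_3 distr_lborel_orthogonal_transformation[OF R(1)])
    also have "\<dots> = (\<integral>\<^sup>+x. g (R x) \<partial>distr lborel borel ?v)"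
      by (rule nn_integral_distr) measurable
    also have "\<dots> = (\<integral>\<^sup>+p. g (R (?v p)) \<partial>lborel)"
      by (rule nn_integral_distr) (use v in \<open>auto\<close>)
    also have "\<dots> = (\<integral>\<^sup>+p. indicator (\<iota> -` A) (fst p) * indicator {0..1 :: real} (snd p) \<partial>(lborel \<Otimes>\<^sub>M lborel))"
    proof -
      have "g (R (?v p)) = indicator (\<iota> -` A) (fst p) * indicator {0..1 :: real} (snd p)" for p
      proof -
        have "R (?v p) + (c - snd p) *\<^sub>R n = \<iota> (fst p)"
          unfolding \<iota>_def R(2)[symmetric] linear_scale[OF lin, symmetric] linear_add[OF lin, symmetric]
          by (intro arg_cong[where f = R]) (simp add: vec_eq_iff forall_3 axis_def)
        then show ?thesis by (simp add: g_def inn slab_def indicator_def)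
      qed
      then show ?thesis by (simp add: lborel_prod)
    qed
    also have "\<dots> = (\<integral>\<^sup>+q. \<integral>\<^sup>+t. indicator (\<iota> -` A) q * indicator {0..1 :: real} t \<partial>lborel \<partial>lborel)"
    proof -
      have "(\<lambda>p. indicator (\<iota> -` A) (fst p) * indicator {0..1 :: real} (snd p) :: ennreal) \<in> borel_measurable (lborel \<Otimes>\<^sub>M (lborel :: real measure))"
        using pre by measurable
      from lborel.nn_integral_fst[OF this] show ?thesis by simp
    qed
    also have "\<dots> = (\<integral>\<^sup>+q. indicator (\<iota> -` A) q \<partial>lborel)"
      by (subst nn_integral_cmult) auto
    also have "\<dots> = emeasure lborel (\<iota> -` A)" using pre by simp
    finally show ?thesis .
  qed
  with iso ran m show ?thesis by blast
qed

lemma emeasure_hausdorff_measure_plane: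
  fixes n :: "real ^ 3"
  assumes "norm n = 1" "A \<in> sets borel" "A \<subseteq> {x. x \<bullet> n = c}"
  shows "emeasure (hausdorff_measure 2) A = emeasure (plane_measure n c) A"
proof -
  obtain \<iota> :: "real \<times> real \<Rightarrow> real ^ 3"
  where \<iota>: "\<And>p q. dist (\<iota> p) (\<iota> q) = dist p q" "range \<iota> = {x. x \<bullet> n = c}" "\<iota> \<in> borel_measurable borel"
    "\<And>A. A \<in> sets borel \<Longrightarrow> emeasure (plane_measure n c) A = emeasure lborel (\<iota> -` A)"
    using plane_isometric_parametrization[OF assms(1), of c] by blast
  have A: "A = \<iota> ` (\<iota> -` A)" using assms(3) \<iota>(2) by (simp add: image_vimage_eq Int_absorb2)
  have "emeasure (hausdorff_measure 2) A = hausdorff_outer_measure 2 A"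
    by (rule emeasure_hausdorff_measure) (use assms in auto)
  also have "\<dots> = hausdorff_outer_measure 2 (\<iota> ` (\<iota> -` A))" using A by (rule arg_cong)
  also have "\<dots> = emeasure lborel (\<iota> -` A)"
    by (rule hausdorff_outer_measure_isometric_plane[OF \<iota>(1)]) (use measurable_sets[OF \<iota>(3) assms(2)] in simp)
  also have "\<dots> = emeasure (plane_measure n c) A" using \<iota>(4)[OF assms(2)] by (rule sym)
  finally show ?thesis .
qed

text \<open>A ball that meets the plane lies in a ball of twice the radius centred at a point of the
  plane, which gives the bound for arbitrary centres.\<close>

lemma
  fixes n :: "real ^ 3"
  assumes "norm n = 1" "0 < r"
  shows emeasure_plane_measure_ball: "y \<bullet> n = c \<Longrightarrow> emeasure (plane_measure n c) (ball y r) = ennreal (pi * r\<^sup>2)"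
    and emeasure_plane_measure_ball_le: "emeasure (plane_measure n c) (ball x r) \<le> ennreal (pi * (2 * r)\<^sup>2)"
proof -
  obtain \<iota> :: "real \<times> real \<Rightarrow> real ^ 3"
  where \<iota>: "\<And>p q. dist (\<iota> p) (\<iota> q) = dist p q" "range \<iota> = {x. x \<bullet> n = c}" "\<iota> \<in> borel_measurable borel"
    "\<And>A. A \<in> sets borel \<Longrightarrow> emeasure (plane_measure n c) A = emeasure lborel (\<iota> -` A)"
    using plane_isometric_parametrization[OF assms(1), of c] by blast
  have *: "emeasure (plane_measure n c) (ball y r) = ennreal (pi * r\<^sup>2)" if "y \<bullet> n = c" "0 < r" for y r
  proof -
    have "y \<in> range \<iota>" unfolding \<iota>(2) using that by simp
    then obtain q where q: "y = \<iota> q" by blast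
    have "\<iota> -` ball y r = ball q r" by (simp add: set_eq_iff q \<iota>(1))
    then have "emeasure (plane_measure n c) (ball y r) = emeasure lborel (ball q r)" using \<iota>(4) by simp
    also have "\<dots> = ennreal (pi * r\<^sup>2)" using \<open>0 < r\<close> by (simp add: emeasure_ball unit_ball_vol_2 power2_eq_square)
    finally show ?thesis .
  qed
  then show "y \<bullet> n = c \<Longrightarrow> emeasure (plane_measure n c) (ball y r) = ennreal (pi * r\<^sup>2)" using assms by simp
  show "emeasure (plane_measure n c) (ball x r) \<le> ennreal (pi * (2 * r)\<^sup>2)"
  proof (cases "ball x r \<inter> range \<iota> = {}")
    case True
    then have "\<iota> -` ball x r = {}" by blast
    then show ?thesis using \<iota>(4)[of "ball x r"] by simp
  next
    case False
    then obtain z where z: "z \<in> ball x r" "z \<bullet> n = c" unfolding \<iota>(2) by blast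
    have "ball x r \<subseteq> ball z (2 * r)"
    proof
      fix y assume "y \<in> ball x r"
      then show "y \<in> ball z (2 * r)" using z(1) dist_triangle2[of z y x] by (simp add: dist_commute)
    qed
    then have "emeasure (plane_measure n c) (ball x r) \<le> emeasure (plane_measure n c) (ball z (2 * r))"
      by (intro emeasure_mono) auto
    also have "\<dots> = ennreal (pi * (2 * r)\<^sup>2)" using *[OF z(2), of "2 * r"] \<open>0 < r\<close> by simp
    finally show ?thesis .
  qed
qed

section \<open>Relative interiors of facets\<close>

context bounded_polytope
begin

definition relfacet :: "'a \<Rightarrow> 'a set" where
  "relfacet n = {x. x \<bullet> n = c n \<and> (\<forall>m\<in>N - {n}. x \<bullet> m < c m)}"

lemma relfacet_subset_body: "n \<in> N \<Longrightarrow> relfacet n \<subseteq> W"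
  by (force simp: relfacet_def W_def)

lemma relfacet_disjoint: "n \<in> N \<Longrightarrow> m \<in> N \<Longrightarrow> n \<noteq> m \<Longrightarrow> relfacet n \<inter> relfacet m = {}"
  by (force simp: relfacet_def)

lemma relfacet_borel[measurable]: "relfacet n \<in> sets borel"
proof -
  have "relfacet n = {x. x \<bullet> n = c n} \<inter> (\<Inter>m\<in>N - {n}. {x. x \<bullet> m < c m})" by (auto simp: relfacet_def)
  moreover have "closed {x. x \<bullet> n = c n}" by (intro closed_Collect_eq continuous_intros)
  moreover have "open (\<Inter>m\<in>N - {n}. {x. x \<bullet> m < c m})"
    using finite_normals by (intro open_INT ballI open_Collect_less continuous_intros) auto
  ultimately show ?thesis by (simp add: borel_closed borel_open sets.Int)
qed

text \<open>Pulled back under the projection, equality in another constraint is an affine equation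
  that \<open>normals_independent\<close> makes nontrivial, so edges and vertices have surface
  measure zero.\<close>

lemma AE_plane_measure_relfacet:
  assumes n: "n \<in> N"
  shows "AE x in plane_measure n (c n). indicator W x = (indicator (relfacet n) x :: real)"
proof -
  have nn: "n \<bullet> n = 1" using unit_normals[OF n] by (simp add: dot_square_norm)
  let ?p = "\<lambda>x. x + (c n - x \<bullet> n) *\<^sub>R n"
  have "AE x in lborel. \<forall>m\<in>N - {n}. ?p x \<bullet> m \<noteq> c m"
  proof (intro AE_finite_allI)
    fix m assume m: "m \<in> N - {n}"
    let ?a = "1 *\<^sub>R m - (n \<bullet> m) *\<^sub>R n" and ?b = "1 * c m - (n \<bullet> m) * c n"
    have "?a \<noteq> 0 \<or> ?b \<noteq> 0" using m n by (intro normals_independent) auto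
    then have "negligible {y. ?a \<bullet> y = ?b}" by (rule negligible_hyperplane)
    moreover have "closed {y. ?a \<bullet> y = ?b}" by (rule closed_hyperplane)
    ultimately have "{y. ?a \<bullet> y = ?b} \<in> null_sets lborel"
      by (simp add: negligible_iff_null_sets null_sets_completion_iff borel_closed)
    then have "AE y in lborel. y \<notin> {y. ?a \<bullet> y = ?b}" by (rule AE_not_in)
    then show "AE x in lborel. ?p x \<bullet> m \<noteq> c m"
      by eventually_elim (auto simp: inner_diff_left inner_add_left inner_commute algebra_simps)
  qed (use finite_normals in auto)
  then have "AE x in lborel. indicator W (?p x) = (indicator (relfacet n) (?p x) :: real)"
  proof eventually_elim
    case (elim x)
    have "?p x \<bullet> n = c n" by (simp add: inner_add_left nn)
    then have "?p x \<in> W \<longleftrightarrow> ?p x \<in> relfacet n"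
      using elim relfacet_subset_body[OF n] by (auto simp: relfacet_def W_def order.strict_iff_order)
    then show ?case by (simp add: indicator_def)
  qed
  then show ?thesis
    unfolding plane_measure_def
    by (subst AE_distr_iff; (subst AE_density)?; measurable; auto)
qed

lemma integral_plane_measure_relfacet:
  fixes f :: "'a \<Rightarrow> real"
  assumes "n \<in> N" and f[measurable]: "f \<in> borel_measurable borel"
  shows "(\<integral>x. indicator W x * f x \<partial>plane_measure n (c n)) = (\<integral>x. indicator (relfacet n) x * f x \<partial>plane_measure n (c n))"
proof (rule integral_cong_AE)
  show "AE x in plane_measure n (c n). indicator W x * f x = indicator (relfacet n) x * f x"
    using AE_plane_measure_relfacet[OF assms(1)] by eventually_elim simp
qed measurable

end

section \<open>The divergence theorem and the Gauss-Green measure in three-space\<close>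

lemma C1_vector_field_directional:
  fixes F :: "real ^ 'n \<Rightarrow> real ^ 'n"
  assumes "C1_vector_field F"
  shows "((\<lambda>\<tau>. F (x + \<tau> *\<^sub>R axis k 1) $ k) has_real_derivative
      jacobian F (at (x + \<tau> *\<^sub>R axis k 1)) $ k $ k) (at \<tau>)"
    and "continuous_on UNIV (\<lambda>x. F x $ k)"
    and "continuous_on UNIV (\<lambda>x. jacobian F (at x) $ k $ k)"
proof -
  have d: "F differentiable (at x)" for x using assms by (simp add: C1_vector_field_def)
  have F: "(F has_derivative (\<lambda>h. jacobian F (at x) *v h)) (at x)" for x
    using d jacobian_works by blast
  have "continuous_on UNIV F"
    using d differentiable_imp_continuous_within by (auto simp: continuous_on_eq_continuous_at)
  then show "continuous_on UNIV (\<lambda>x. F x $ k)" by (intro continuous_intros)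
  show "continuous_on UNIV (\<lambda>x. jacobian F (at x) $ k $ k)"
    using assms unfolding C1_vector_field_def by (intro continuous_on_component) auto
  let ?y = "x + \<tau> *\<^sub>R axis k 1"
  have 1: "((\<lambda>t. x + t *\<^sub>R axis k 1) has_derivative (\<lambda>t. t *\<^sub>R axis k 1)) (at \<tau>)"
    by (auto intro!: derivative_eq_intros)
  have 2: "((\<lambda>\<tau>. F (x + \<tau> *\<^sub>R axis k 1)) has_derivative (\<lambda>t. jacobian F (at ?y) *v (t *\<^sub>R axis k 1))) (at \<tau>)"
    using diff_chain_at[OF 1 F[of ?y]] by (simp add: o_def)
  have "((\<lambda>\<tau>. F (x + \<tau> *\<^sub>R axis k 1) $ k) has_derivative (\<lambda>t. (jacobian F (at ?y) *v (t *\<^sub>R axis k 1)) $ k)) (at \<tau>)"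
    by (rule bounded_linear.has_derivative[OF bounded_linear_vec_nth 2])
  also have "(\<lambda>t. (jacobian F (at ?y) *v (t *\<^sub>R axis k 1)) $ k) = (*) (jacobian F (at ?y) $ k $ k)"
    by (simp add: matrix_vector_mult_scaleR matrix_vector_mult_basis column_def fun_eq_iff)
  finally show "((\<lambda>\<tau>. F (x + \<tau> *\<^sub>R axis k 1) $ k) has_real_derivative jacobian F (at ?y) $ k $ k) (at \<tau>)"
    by (simp add: has_field_derivative_def)
qed

locale bounded_polytope3 = bounded_polytope N c W for N :: "(real ^ 3) set" and c W
begin

theorem divergence_theorem:
  assumes F: "C1_vector_field F"
  shows "(\<integral>x. indicator W x * divergence F x \<partial>lborel) =
    (\<Sum>n\<in>N. \<integral>x. indicator W x * (F x \<bullet> n) \<partial>plane_measure n (c n))"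
proof -
  note D = C1_vector_field_directional[OF F]
  have "(\<integral>x. indicator W x * divergence F x \<partial>lborel) =
    (\<integral>x. (\<Sum>k\<in>UNIV. indicator W x * jacobian F (at x) $ k $ k) \<partial>lborel)"
    by (simp add: divergence_def trace_def sum_distrib_left)
  also have "\<dots> = (\<Sum>k\<in>UNIV. \<integral>x. indicator W x * jacobian F (at x) $ k $ k \<partial>lborel)"
    by (rule Bochner_Integration.integral_sum) (rule integrable_body_lborel[OF D(3)])
  also have "\<dots> = (\<Sum>k\<in>UNIV. \<Sum>n\<in>N. (n \<bullet> axis k 1) * (\<integral>x. indicator W x * F x $ k \<partial>plane_measure n (c n)))"
    by (intro sum.cong refl integral_directional_derivative[OF _ D]) simp
  also have "\<dots> = (\<Sum>n\<in>N. \<Sum>k\<in>UNIV. (n \<bullet> axis k 1) * (\<integral>x. indicator W x * F x $ k \<partial>plane_measure n (c n)))"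
    by (rule sum.swap)
  also have "\<dots> = (\<Sum>n\<in>N. \<integral>x. indicator W x * (F x \<bullet> n) \<partial>plane_measure n (c n))"
  proof (rule sum.cong[OF refl])
    fix n assume n: "n \<in> N"
    have "(\<Sum>k\<in>UNIV. (n \<bullet> axis k 1) * (\<integral>x. indicator W x * F x $ k \<partial>plane_measure n (c n)))
      = (\<integral>x. (\<Sum>k\<in>UNIV. (n \<bullet> axis k 1) * (indicator W x * F x $ k)) \<partial>plane_measure n (c n))"
      using integrable_body_plane_measure[OF D(2) n body_borel subset_refl]
      by (subst Bochner_Integration.integral_sum) auto
    also have "\<dots> = (\<integral>x. indicator W x * (F x \<bullet> n) \<partial>plane_measure n (c n))"
      by (intro Bochner_Integration.integral_cong refl)
        (simp add: inner_axis inner_vec_def[of "F _" n] sum_distrib_left mult_ac)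
    finally show "(\<Sum>k\<in>UNIV. (n \<bullet> axis k 1) * (\<integral>x. indicator W x * F x $ k \<partial>plane_measure n (c n)))
      = (\<integral>x. indicator W x * (F x \<bullet> n) \<partial>plane_measure n (c n))" .
  qed
  finally show ?thesis .
qed

definition facet_measure :: "(real ^ 3) measure" where
  "facet_measure = density (hausdorff_measure 2) (indicator (\<Union>n\<in>N. relfacet n))"

text \<open>The sets \<open>relfacet n\<close> are disjoint, so at most one summand is nonzero; off
  the facets the value is 0.\<close>

definition facet_normal :: "real ^ 3 \<Rightarrow> real ^ 3" where
  "facet_normal x = (\<Sum>n\<in>N. indicator (relfacet n) x *\<^sub>R n)"

lemma sets_hausdorff_2[measurable_cong, simp]: "sets (hausdorff_measure 2 :: (real ^ 3) measure) = sets borel"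
  by (rule sets_hausdorff_measure) simp

lemma sets_facet_measure[measurable_cong, simp]: "sets facet_measure = sets borel"
  by (simp add: facet_measure_def)

lemma UN_relfacet_borel[measurable]: "(\<Union>n\<in>N. relfacet n) \<in> sets borel"
  using finite_normals by (intro sets.finite_UN relfacet_borel)

lemma emeasure_hausdorff_relfacet:
  assumes "n \<in> N" "A \<in> sets borel" "A \<subseteq> relfacet n"
  shows "emeasure (hausdorff_measure 2) A = emeasure (plane_measure n (c n)) A"
  by (rule emeasure_hausdorff_measure_plane) (use assms unit_normals in \<open>auto simp: relfacet_def\<close>)

lemma emeasure_facet_measure:
  assumes "A \<in> sets borel"
  shows "emeasure facet_measure A = (\<Sum>n\<in>N. emeasure (plane_measure n (c n)) (A \<inter> relfacet n))"
proof -
  have [measurable]: "A \<in> sets borel" by fact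
  have "emeasure facet_measure A = emeasure (hausdorff_measure 2) ((\<Union>n\<in>N. relfacet n) \<inter> A)"
    unfolding facet_measure_def
    by (subst emeasure_density) (auto simp: indicator_inter_arith[symmetric])
  also have "(\<Union>n\<in>N. relfacet n) \<inter> A = (\<Union>n\<in>N. A \<inter> relfacet n)" by blast
  also have "emeasure (hausdorff_measure 2) \<dots> = (\<Sum>n\<in>N. emeasure (hausdorff_measure 2) (A \<inter> relfacet n))"
    using finite_normals relfacet_disjoint
    by (intro sum_emeasure[symmetric]) (auto simp: disjoint_family_on_def)
  also have "\<dots> = (\<Sum>n\<in>N. emeasure (plane_measure n (c n)) (A \<inter> relfacet n))"
    by (intro sum.cong refl emeasure_hausdorff_relfacet) auto
  finally show ?thesis .
qed

text \<open>Hausdorff measure and plane measure agree only on subsets of the plane, so integrals are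
  compared after restriction to one facet.\<close>

lemma density_hausdorff_relfacet:
  assumes n: "n \<in> N"
  shows "density (hausdorff_measure 2) (\<lambda>x. ennreal (indicator (relfacet n) x)) =
    density (plane_measure n (c n)) (\<lambda>x. ennreal (indicator (relfacet n) x))"
proof (rule measure_eqI)
  fix A assume "A \<in> sets (density (hausdorff_measure 2) (\<lambda>x. ennreal (indicator (relfacet n) x)))"
  then have [measurable]: "A \<in> sets borel" by simp
  have "emeasure (hausdorff_measure 2) (relfacet n \<inter> A) = emeasure (plane_measure n (c n)) (relfacet n \<inter> A)"
    by (rule emeasure_hausdorff_relfacet[OF n]) auto
  then show "emeasure (density (hausdorff_measure 2) (\<lambda>x. ennreal (indicator (relfacet n) x))) A =
    emeasure (density (plane_measure n (c n)) (\<lambda>x. ennreal (indicator (relfacet n) x))) A"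
    by (simp add: emeasure_density ennreal_indicator indicator_inter_arith[symmetric])
qed simp

lemma
  fixes f :: "real ^ 3 \<Rightarrow> real"
  assumes n: "n \<in> N" and [measurable]: "f \<in> borel_measurable borel"
  shows integrable_hausdorff_relfacet: "integrable (hausdorff_measure 2) (\<lambda>x. indicator (relfacet n) x * f x) \<longleftrightarrow>
      integrable (plane_measure n (c n)) (\<lambda>x. indicator (relfacet n) x * f x)"
    and integral_hausdorff_relfacet: "(\<integral>x. indicator (relfacet n) x * f x \<partial>hausdorff_measure 2) =
      (\<integral>x. indicator (relfacet n) x * f x \<partial>plane_measure n (c n))"
proof -
  have i: "integrable (density K (\<lambda>x. ennreal (indicator (relfacet n) x))) f =
     integrable K (\<lambda>x. indicator (relfacet n) x * f x)"
    "(\<integral>x. f x \<partial>density K (\<lambda>x. ennreal (indicator (relfacet n) x))) = (\<integral>x. indicator (relfacet n) x * f x \<partial>K)"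
    if [measurable_cong, simp]: "sets K = sets borel" for K :: "(real ^ 3) measure"
    by (subst integrable_density; simp) (subst integral_density; simp)
  show "integrable (hausdorff_measure 2) (\<lambda>x. indicator (relfacet n) x * f x) \<longleftrightarrow>
      integrable (plane_measure n (c n)) (\<lambda>x. indicator (relfacet n) x * f x)"
    using i(1)[of "hausdorff_measure 2"] i(1)[of "plane_measure n (c n)"] density_hausdorff_relfacet[OF n] by simp
  show "(\<integral>x. indicator (relfacet n) x * f x \<partial>hausdorff_measure 2) =
      (\<integral>x. indicator (relfacet n) x * f x \<partial>plane_measure n (c n))"
    using i(2)[of "hausdorff_measure 2"] i(2)[of "plane_measure n (c n)"] density_hausdorff_relfacet[OF n] by simp
qed

lemma facet_normal_eq: "n \<in> N \<Longrightarrow> x \<in> relfacet n \<Longrightarrow> facet_normal x = n"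
proof -
  assume n: "n \<in> N" "x \<in> relfacet n"
  have "facet_normal x = (\<Sum>m\<in>N. if m = n then n else 0)"
    unfolding facet_normal_def using relfacet_disjoint[OF n(1)] n(2)
    by (intro sum.cong refl) (auto simp: indicator_def)
  then show ?thesis using n finite_normals by simp
qed

lemma facet_normal_measurable[measurable]: "facet_normal \<in> borel_measurable borel"
  unfolding facet_normal_def by measurable

lemma integral_facet_measure:
  assumes F: "continuous_on UNIV F"
  shows "(\<integral>x. F x \<bullet> facet_normal x \<partial>facet_measure) =
    (\<Sum>n\<in>N. \<integral>x. indicator W x * (F x \<bullet> n) \<partial>plane_measure n (c n))"
proof -
  have [measurable]: "F \<in> borel_measurable borel" using F by (rule borel_measurable_continuous_onI)
  let ?U = "\<Union>n\<in>N. relfacet n"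
  have "(\<integral>x. F x \<bullet> facet_normal x \<partial>facet_measure) = (\<integral>x. indicator ?U x * (F x \<bullet> facet_normal x) \<partial>hausdorff_measure 2)"
    unfolding facet_measure_def ennreal_indicator[symmetric]
    by (subst integral_density) auto
  also have "\<dots> = (\<integral>x. (\<Sum>n\<in>N. indicator (relfacet n) x * (F x \<bullet> n)) \<partial>hausdorff_measure 2)"
  proof (rule Bochner_Integration.integral_cong[OF refl])
    fix x
    show "indicator ?U x * (F x \<bullet> facet_normal x) = (\<Sum>n\<in>N. indicator (relfacet n) x * (F x \<bullet> n))"
      by (cases "x \<in> ?U") (auto simp: facet_normal_def inner_sum_right)
  qed
  also have "\<dots> = (\<Sum>n\<in>N. \<integral>x. indicator (relfacet n) x * (F x \<bullet> n) \<partial>hausdorff_measure 2)"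
    using F by (intro Bochner_Integration.integral_sum)
      (simp add: integrable_hausdorff_relfacet integrable_body_plane_measure relfacet_subset_body continuous_on_inner)
  also have "\<dots> = (\<Sum>n\<in>N. \<integral>x. indicator W x * (F x \<bullet> n) \<partial>plane_measure n (c n))"
    by (intro sum.cong refl) (simp add: integral_hausdorff_relfacet integral_plane_measure_relfacet)
  finally show ?thesis .
qed

lemma emeasure_facet_measure_bounded:
  assumes "A \<in> sets borel" "bounded A"
  shows "emeasure facet_measure A < \<infinity>"
proof -
  have "emeasure (plane_measure n (c n)) (A \<inter> relfacet n) < top" if "n \<in> N" for n
    using emeasure_plane_measure_bounded[OF unit_normals[OF that], of "A \<inter> relfacet n" "c n"] assms
    by (auto intro: bounded_subset)
  then show ?thesis
    using finite_normals by (simp add: emeasure_facet_measure[OF assms(1)] ennreal_sum_less_top)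
qed

text \<open>The divergence theorem with its facet sum written as one integral. This pair is the
  reference with which every other witness of an outer normal is compared.\<close>

theorem is_gauss_green_measure_facets: "is_gauss_green_measure W facet_measure facet_normal"
  unfolding is_gauss_green_measure_def
proof (intro conjI allI impI)
  show "W \<in> sets lebesgue" using body_borel by simp
  show "sets facet_measure = sets borel" by simp
  show "emeasure facet_measure K < \<infinity>" if "compact K" for K
    using that by (intro emeasure_facet_measure_bounded borel_compact compact_imp_bounded)
  show "facet_normal \<in> borel_measurable facet_measure" by measurable
  show "AE x in facet_measure. norm (facet_normal x) = 1"
    unfolding facet_measure_def
    by (subst AE_density) (auto simp: indicator_def facet_normal_eq unit_normals)
  fix F :: "real ^ 3 \<Rightarrow> real ^ 3"
  assume "C1_vector_field F \<and> compact (closure {x. F x \<noteq> 0})"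
  then have F: "C1_vector_field F" by simp
  then have cF: "continuous_on UNIV F"
    using differentiable_imp_continuous_within unfolding C1_vector_field_def
    by (auto simp: continuous_on_eq_continuous_at)
  have "continuous_on UNIV (divergence F)"
    unfolding divergence_def[abs_def] trace_def
    by (intro continuous_on_sum C1_vector_field_directional(3)[OF F])
  then have [measurable]: "divergence F \<in> borel_measurable borel" by (rule borel_measurable_continuous_onI)
  have "(LINT x:W|lebesgue. divergence F x) = (\<integral>x. indicator W x * divergence F x \<partial>lborel)"
    unfolding set_lebesgue_integral_def by (subst integral_completion) auto
  also have "\<dots> = (\<integral>x. F x \<bullet> facet_normal x \<partial>facet_measure)"
    unfolding divergence_theorem[OF F] integral_facet_measure[OF cF] ..
  finally show "(LINT x:W|lebesgue. divergence F x) = (\<integral>x. F x \<bullet> facet_normal x \<partial>facet_measure)" .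
qed

end

section \<open>The reduced boundary of a polytope\<close>

lemma has_real_derivative_max_0_square:
  "((\<lambda>u. (max 0 u)\<^sup>2) has_real_derivative 2 * max 0 u) (at (u :: real))"
proof -
  consider "u > 0" | "u < 0" | "u = 0" by linarith
  then show ?thesis
  proof cases
    case 1
    have "((\<lambda>u. u\<^sup>2) has_real_derivative 2 * u) (at u)" by (auto intro!: derivative_eq_intros)
    moreover have "\<forall>\<^sub>F v in nhds u. v\<^sup>2 = (max 0 v)\<^sup>2"
      using eventually_nhds_in_open[of "{0<..}" u] 1 by (auto elim: eventually_mono)
    ultimately have "((\<lambda>v. (max 0 v)\<^sup>2) has_real_derivative 2 * u) (at u)"
      by (rule iffD1[OF DERIV_cong_ev[OF refl _ refl], rotated])
    then show ?thesis using 1 by simp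
  next
    case 2
    have "((\<lambda>u. 0) has_real_derivative 0) (at u)" by simp
    moreover have "\<forall>\<^sub>F v in nhds u. 0 = (max 0 v)\<^sup>2"
      using eventually_nhds_in_open[of "{..<0}" u] 2 by (auto elim: eventually_mono)
    ultimately have "((\<lambda>v. (max 0 v)\<^sup>2) has_real_derivative 0) (at u)"
      by (rule iffD1[OF DERIV_cong_ev[OF refl _ refl], rotated])
    then show ?thesis using 2 by simp
  next
    case 3
    have "((\<lambda>h. (max 0 h)\<^sup>2 / h) \<longlongrightarrow> 0) (at (0 :: real))"
    proof (rule Lim_null_comparison)
      show "\<forall>\<^sub>F h in at (0 :: real). norm ((max 0 h)\<^sup>2 / h) \<le> \<bar>h\<bar>"
        by (rule always_eventually) (auto simp: max_def power2_eq_square)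
      show "((\<lambda>h. \<bar>h\<bar>) \<longlongrightarrow> 0) (at (0 :: real))" by (auto intro!: tendsto_eq_intros)
    qed
    then show ?thesis using 3 by (simp add: DERIV_def)
  qed
qed

text \<open>With \<open>u\<close> the positive part of
  \<open>r\<^sup>2 - (x - y) \<bullet> (x - y)\<close>, this is
  \<open>j * u\<^sup>2 / (1 + j * u\<^sup>2)\<close>: it vanishes off the ball and tends to 1 inside
  as \<open>j\<close> grows. Squaring \<open>u\<close> removes its kink, so the function is
  continuously differentiable.\<close>

definition bump :: "real ^ 'n \<Rightarrow> real \<Rightarrow> nat \<Rightarrow> real ^ 'n \<Rightarrow> real" where
  "bump y r j x = 1 - inverse (1 + real j * (max 0 (r\<^sup>2 - (x - y) \<bullet> (x - y)))\<^sup>2)"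

lemma bump_bounds: "0 \<le> bump y r j x" "bump y r j x \<le> 1"
proof -
  have "1 \<le> 1 + real j * (max 0 (r\<^sup>2 - (x - y) \<bullet> (x - y)))\<^sup>2" by simp
  then have "inverse (1 + real j * (max 0 (r\<^sup>2 - (x - y) \<bullet> (x - y)))\<^sup>2) \<le> 1" by (rule inverse_le_1_iff[THEN iffD2, OF disjI2])
  then show "0 \<le> bump y r j x" by (simp add: bump_def)
  have "0 \<le> inverse (1 + real j * (max 0 (r\<^sup>2 - (x - y) \<bullet> (x - y)))\<^sup>2)" by simp
  then show "bump y r j x \<le> 1" by (simp only: bump_def)
qed

lemma bump_outside: "0 < r \<Longrightarrow> x \<notin> ball y r \<Longrightarrow> bump y r j x = 0"
proof -
  assume "0 < r" "x \<notin> ball y r"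
  then have "r\<^sup>2 \<le> (norm (x - y))\<^sup>2" by (intro power_mono) (auto simp: dist_norm norm_minus_commute)
  then show ?thesis by (simp add: bump_def dot_square_norm)
qed

lemma bump_tendsto:
  assumes "0 < r"
  shows "(\<lambda>j. bump y r j x) \<longlonglongrightarrow> indicator (ball y r) x"
proof (cases "x \<in> ball y r")
  case True
  then have "(norm (x - y))\<^sup>2 < r\<^sup>2" by (intro power_strict_mono) (auto simp: dist_norm norm_minus_commute)
  then have "0 < (max 0 (r\<^sup>2 - (x - y) \<bullet> (x - y)))\<^sup>2" by (simp add: dot_square_norm)
  then have "filterlim (\<lambda>j. 1 + real j * (max 0 (r\<^sup>2 - (x - y) \<bullet> (x - y)))\<^sup>2) at_top sequentially"
    by (intro filterlim_tendsto_add_at_top[OF tendsto_const] filterlim_at_top_mult_tendsto_pos[OF tendsto_const]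
        filterlim_real_sequentially)
  then have "(\<lambda>j. inverse (1 + real j * (max 0 (r\<^sup>2 - (x - y) \<bullet> (x - y)))\<^sup>2)) \<longlonglongrightarrow> 0"
    by (rule tendsto_inverse_0_at_top)
  then have "(\<lambda>j. bump y r j x) \<longlonglongrightarrow> 1 - 0" unfolding bump_def by (intro tendsto_diff tendsto_const)
  then show ?thesis using True by simp
next
  case False
  then show ?thesis using assms by (simp add: bump_outside)
qed

lemma C1_vector_field_bump:
  fixes e :: "real ^ 'n"
  shows "C1_vector_field (\<lambda>x. bump y r j x *\<^sub>R e)"
proof -
  define s where "s x = r\<^sup>2 - (x - y) \<bullet> (x - y)" for x :: "real ^ 'n"
  define q where "q x = 1 + real j * (max 0 (s x))\<^sup>2" for x
  define a where "a x = - (4 * real j * max 0 (s x) / (q x)\<^sup>2)" for x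
  have q: "q x \<ge> 1" for x by (simp add: q_def)
  then have q0: "q x \<noteq> 0" for x by (metis not_one_le_zero)
  have deriv: "((\<lambda>x. bump y r j x *\<^sub>R e) has_derivative (\<lambda>h. (a x * (h \<bullet> (x - y))) *\<^sub>R e)) (at x)" for x
  proof -
    have s: "(s has_derivative (\<lambda>h. - 2 * (h \<bullet> (x - y)))) (at x)"
      unfolding s_def by (auto intro!: derivative_eq_intros simp: inner_commute)
    have "((\<lambda>u. 1 + real j * (max 0 u)\<^sup>2) has_real_derivative 0 + real j * (2 * max 0 (s x))) (at (s x))"
      by (intro DERIV_add DERIV_const DERIV_cmult has_real_derivative_max_0_square)
    from DERIV_diff[OF DERIV_const DERIV_inverse_fun[OF this]]
    have "((\<lambda>u. 1 - inverse (1 + real j * (max 0 u)\<^sup>2)) has_real_derivative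
        (real j * (2 * max 0 (s x))) / (q x)\<^sup>2) (at (s x))"
      using q0[of x] unfolding q_def by (simp add: power2_eq_square divide_inverse mult_ac)
    then have "((\<lambda>u. 1 - inverse (1 + real j * (max 0 u)\<^sup>2)) has_derivative
        (*) ((real j * (2 * max 0 (s x))) / (q x)\<^sup>2)) (at (s x))"
      by (simp add: has_field_derivative_def)
    from diff_chain_at[OF s this]
    have "((\<lambda>x. bump y r j x) has_derivative (\<lambda>h. a x * (h \<bullet> (x - y)))) (at x)"
      by (simp add: o_def bump_def s_def a_def mult_ac)
    then show ?thesis by (intro has_derivative_scaleR_left)
  qed
  have cs: "continuous_on UNIV s" unfolding s_def by (intro continuous_intros)
  have ca: "continuous_on UNIV a"
    unfolding a_def q_def using q0 unfolding q_def
    by (intro continuous_intros cs continuous_on_max) auto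
  have J: "jacobian (\<lambda>x. bump y r j x *\<^sub>R e) (at x) = (\<chi> i k. (a x * (axis k 1 \<bullet> (x - y))) * e $ i)" for x
    unfolding jacobian_def frechet_derivative_at[OF deriv, symmetric] matrix_def by (simp add: vec_eq_iff)
  show ?thesis
    unfolding C1_vector_field_def J
  proof (intro conjI allI)
    show "(\<lambda>x. bump y r j x *\<^sub>R e) differentiable at x" for x
      using deriv differentiableI by blast
    show "continuous_on UNIV (\<lambda>x. \<chi> i k. (a x * (axis k 1 \<bullet> (x - y))) * e $ i)"
      by (intro continuous_on_vec_lambda continuous_intros ca)
  qed
qed

text \<open>The \<open>C\<^sup>1\<close> fields \<open>bump y r j x *\<^sub>R e\<close> approximate the discontinuous field that is \<open>e\<close> on the ball and
  zero outside.\<close>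

lemma gauss_green_ball_integral:
  fixes M :: "(real ^ 'n) measure"
  assumes G: "is_gauss_green_measure E M \<sigma>" and "0 < r"
  shows "(\<lambda>j. LINT x:E|lebesgue. divergence (\<lambda>x. bump y r j x *\<^sub>R e) x) \<longlonglongrightarrow> e \<bullet> (LINT x:ball y r|M. \<sigma> x)"
    and "integrable M (\<lambda>x. indicator (ball y r) x *\<^sub>R \<sigma> x)"
proof -
  have M[measurable_cong, simp]: "sets M = sets borel" and fin: "\<And>K. compact K \<Longrightarrow> emeasure M K < \<infinity>"
    and \<sigma>: "\<sigma> \<in> borel_measurable M" "AE x in M. norm (\<sigma> x) = 1"
    using G by (auto simp: is_gauss_green_measure_def)
  note [measurable] = \<sigma>(1)
  have finB: "emeasure M (ball y r) < \<infinity>"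
    using fin[of "cball y r"] emeasure_mono[of "ball y r" "cball y r" M] by (auto intro: le_less_trans)
  show int: "integrable M (\<lambda>x. indicator (ball y r) x *\<^sub>R \<sigma> x)"
    by (rule integrableI_bounded_set_indicator[where B = 1]) (use finB \<sigma> in auto)
  have eq: "(LINT x:E|lebesgue. divergence (\<lambda>x. bump y r j x *\<^sub>R e) x) = (LINT x|M. bump y r j x * (e \<bullet> \<sigma> x))" for j
  proof -
    have "{x. bump y r j x *\<^sub>R e \<noteq> 0} \<subseteq> cball y r"
      using bump_outside[OF \<open>0 < r\<close>, of _ y j] ball_subset_cball by fastforce
    then have "compact (closure {x. bump y r j x *\<^sub>R e \<noteq> 0})"
      using bounded_subset[OF bounded_cball] by (auto simp: compact_closure)
    then show ?thesis
      using G C1_vector_field_bump[of y r j e] by (simp add: is_gauss_green_measure_def)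
  qed
  have "bump y r j \<in> borel_measurable borel" for j
    unfolding bump_def by measurable
  then have [measurable]: "bump y r j \<in> borel_measurable M" for j
    unfolding measurable_cong_sets[OF M refl] .
  have [measurable]: "(\<lambda>x. e \<bullet> \<sigma> x) \<in> borel_measurable M" "ball y r \<in> sets M"
    using \<sigma>(1) by (auto intro: borel_measurable_inner)
  have "(\<lambda>j. LINT x|M. bump y r j x * (e \<bullet> \<sigma> x)) \<longlonglongrightarrow> (LINT x|M. indicator (ball y r) x * (e \<bullet> \<sigma> x))"
  proof (rule integral_dominated_convergence[where w = "\<lambda>x. indicator (ball y r) x *\<^sub>R norm e"])
    show "integrable M (\<lambda>x. indicator (ball y r) x *\<^sub>R norm e)"
      by (rule integrableI_bounded_set_indicator[where B = "norm e"]) (use finB in auto)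
    show "AE x in M. (\<lambda>j. bump y r j x * (e \<bullet> \<sigma> x)) \<longlonglongrightarrow> indicator (ball y r) x * (e \<bullet> \<sigma> x)"
      by (intro AE_I2 tendsto_mult bump_tendsto tendsto_const \<open>0 < r\<close>)
    show "AE x in M. norm (bump y r j x * (e \<bullet> \<sigma> x)) \<le> indicator (ball y r) x *\<^sub>R norm e" for j
      using \<sigma>(2)
    proof eventually_elim
      case (elim x)
      have "\<bar>e \<bullet> \<sigma> x\<bar> \<le> norm e" using Cauchy_Schwarz_ineq2[of e "\<sigma> x"] elim by simp
      moreover have "\<bar>bump y r j x\<bar> \<le> indicator (ball y r) x"
        using bump_bounds[of y r j x] bump_outside[OF \<open>0 < r\<close>, of x y j] by (auto simp: indicator_def)
      ultimately show ?case by (simp add: abs_mult mult_mono)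
    qed
  qed measurable
  also have "(LINT x|M. indicator (ball y r) x * (e \<bullet> \<sigma> x)) = e \<bullet> (LINT x:ball y r|M. \<sigma> x)"
    unfolding set_lebesgue_integral_def by (subst integral_inner_right[symmetric]) (use int in auto)
  finally show "(\<lambda>j. LINT x:E|lebesgue. divergence (\<lambda>x. bump y r j x *\<^sub>R e) x) \<longlonglongrightarrow> e \<bullet> (LINT x:ball y r|M. \<sigma> x)"
    by (simp only: eq)
qed

text \<open>The integrals of divergences in \<open>gauss_green_ball_integral\<close> depend on
  \<open>E\<close> alone, hence so do their limits. This determines the vector integrals over balls,
  and nothing is asserted about the masses of \<open>M\<close> and \<open>M'\<close>.\<close>

lemma gauss_green_ball_unique:
  assumes "is_gauss_green_measure E M \<sigma>" "is_gauss_green_measure E M' \<sigma>'" "0 < r"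
  shows "(LINT x:ball y r|M. \<sigma> x) = (LINT x:ball y r|M'. \<sigma>' x)"
proof -
  have "e \<bullet> (LINT x:ball y r|M. \<sigma> x) = e \<bullet> (LINT x:ball y r|M'. \<sigma>' x)" for e
    using gauss_green_ball_integral(1)[OF assms(1,3)] gauss_green_ball_integral(1)[OF assms(2,3)]
    by (rule LIMSEQ_unique)
  then show ?thesis using vector_eq_ldot by blast
qed

text \<open>In the third claim both sides are integrals of
  \<open>1 - \<sigma> x \<bullet> \<nu>\<close>, which is nonnegative almost everywhere for unit
  vectors; so the defect of alignment with \<open>\<nu>\<close> grows with the ball.\<close>

lemma gauss_green_ball_norm_le:
  fixes M :: "(real ^ 'n) measure"
  assumes G: "is_gauss_green_measure E M \<sigma>" and "0 < r"
  shows "norm (LINT x:ball y r|M. \<sigma> x) \<le> measure M (ball y r)" "emeasure M (ball y r) = ennreal (measure M (ball y r))"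
    and "norm \<nu> = 1 \<Longrightarrow> ball z s \<subseteq> ball y r \<Longrightarrow> 0 < s \<Longrightarrow>
      measure M (ball z s) - (LINT x:ball z s|M. \<sigma> x) \<bullet> \<nu> \<le> measure M (ball y r) - (LINT x:ball y r|M. \<sigma> x) \<bullet> \<nu>"
proof -
  have M[measurable_cong, simp]: "sets M = sets borel" and fin: "\<And>K. compact K \<Longrightarrow> emeasure M K < \<infinity>"
    and \<sigma>: "\<sigma> \<in> borel_measurable M" "AE x in M. norm (\<sigma> x) = 1"
    using G by (auto simp: is_gauss_green_measure_def)
  note [measurable] = \<sigma>(1)
  have finB: "emeasure M (ball z s) < \<infinity>" for z s
    using fin[of "cball z s"] emeasure_mono[of "ball z s" "cball z s" M] by (auto intro: le_less_trans)
  show "emeasure M (ball y r) = ennreal (measure M (ball y r))"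
    by (rule emeasure_eq_ennreal_measure) (metis finB infinity_ennreal_def less_irrefl)
  have int1: "integrable M (indicator (ball z s) :: _ \<Rightarrow> real)" for z s
    using finB[of z s] by (intro integrable_real_indicator) auto
  note int = gauss_green_ball_integral(2)[OF G]
  have "norm (LINT x:ball y r|M. \<sigma> x) \<le> (\<integral>x. norm (indicator (ball y r) x *\<^sub>R \<sigma> x) \<partial>M)"
    unfolding set_lebesgue_integral_def by (rule integral_norm_bound)
  also have "\<dots> = (\<integral>x. indicator (ball y r) x \<partial>M)"
  proof (rule integral_cong_AE)
    have [measurable]: "ball y r \<in> sets M" by simp
    show "(\<lambda>x. norm (indicator (ball y r) x *\<^sub>R \<sigma> x)) \<in> borel_measurable M"
      "(indicator (ball y r) :: _ \<Rightarrow> real) \<in> borel_measurable M"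
      by (auto intro!: borel_measurable_norm borel_measurable_scaleR borel_measurable_indicator \<sigma>(1) simp del: norm_scaleR)
  qed (use \<sigma>(2) in \<open>auto elim!: eventually_mono\<close>)
  finally show "norm (LINT x:ball y r|M. \<sigma> x) \<le> measure M (ball y r)" by simp
  assume \<nu>: "norm \<nu> = 1" and sub: "ball z s \<subseteq> ball y r" "0 < s"
  have eq: "measure M (ball z s) - (LINT x:ball z s|M. \<sigma> x) \<bullet> \<nu> = (\<integral>x. indicator (ball z s) x * (1 - \<sigma> x \<bullet> \<nu>) \<partial>M)"
      "integrable M (\<lambda>x. indicator (ball z s) x * (1 - \<sigma> x \<bullet> \<nu>))"
    if "0 < s" for z s
  proof -
    have *: "(\<lambda>x. indicator (ball z s) x * (1 - \<sigma> x \<bullet> \<nu>)) = (\<lambda>x. indicator (ball z s) x - (indicator (ball z s) x *\<^sub>R \<sigma> x) \<bullet> \<nu>)"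
      by (simp add: fun_eq_iff algebra_simps)
    have i: "integrable M (\<lambda>x. (indicator (ball z s) x *\<^sub>R \<sigma> x) \<bullet> \<nu>)"
      by (rule integrable_inner_left) (rule int[OF that])
    show "integrable M (\<lambda>x. indicator (ball z s) x * (1 - \<sigma> x \<bullet> \<nu>))"
      unfolding * using int1 i by (rule Bochner_Integration.integrable_diff)
    show "measure M (ball z s) - (LINT x:ball z s|M. \<sigma> x) \<bullet> \<nu> = (\<integral>x. indicator (ball z s) x * (1 - \<sigma> x \<bullet> \<nu>) \<partial>M)"
      unfolding * Bochner_Integration.integral_diff[OF int1 i] set_lebesgue_integral_def
      by (subst integral_inner_left) (use int[OF that] in auto)
  qed
  have nonneg: "AE x in M. 0 \<le> 1 - \<sigma> x \<bullet> \<nu>"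
    using \<sigma>(2)
  proof eventually_elim
    case (elim x)
    then show ?case using norm_cauchy_schwarz[of "\<sigma> x" \<nu>] \<nu> by simp
  qed
  show "measure M (ball z s) - (LINT x:ball z s|M. \<sigma> x) \<bullet> \<nu> \<le> measure M (ball y r) - (LINT x:ball y r|M. \<sigma> x) \<bullet> \<nu>"
    unfolding eq(1)[OF \<open>0 < s\<close>] eq(1)[OF \<open>0 < r\<close>]
  proof (rule integral_mono_AE[OF eq(2)[OF \<open>0 < s\<close>] eq(2)[OF \<open>0 < r\<close>]])
    show "AE x in M. indicator (ball z s) x * (1 - \<sigma> x \<bullet> \<nu>) \<le> indicator (ball y r) x * (1 - \<sigma> x \<bullet> \<nu>)"
      using nonneg sub by (auto elim!: eventually_mono simp: indicator_def)
  qed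
qed

section \<open>Outer normals of a polytope\<close>

context bounded_polytope3
begin

text \<open>The other normals are unit vectors, so a slack of \<open>r\<close> at the centre keeps
  the open ball strictly inside every other constraint. The facet then looks like its whole plane
  within the ball.\<close>

lemma ball_meeting_one_facet:
  assumes n: "n \<in> N" and y: "y \<bullet> n = c n" and r: "0 < r" and far: "\<And>m. m \<in> N - {n} \<Longrightarrow> y \<bullet> m + r \<le> c m"
  shows "emeasure facet_measure (ball y r) = ennreal (pi * r\<^sup>2)"
    and "(LINT x:ball y r|facet_measure. facet_normal x) = (pi * r\<^sup>2) *\<^sub>R n"
    and "ball y r \<inter> (\<Union>m\<in>N. relfacet m) \<subseteq> relfacet n"
proof -
  have [measurable]: "ball y r \<in> sets borel" by simp
  have lt: "x \<bullet> m < c m" if "x \<in> ball y r" "m \<in> N - {n}" for x m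
  proof -
    have "(x - y) \<bullet> m \<le> norm (x - y) * norm m" by (rule norm_cauchy_schwarz)
    also have "\<dots> < r" using that unit_normals by (auto simp: dist_norm norm_minus_commute)
    finally show ?thesis using far[OF that(2)] by (simp add: inner_diff_left)
  qed
  then show sub: "ball y r \<inter> (\<Union>m\<in>N. relfacet m) \<subseteq> relfacet n"
    using n by (force simp: relfacet_def)
  have 1: "ball y r \<inter> relfacet m = {}" if "m \<in> N - {n}" for m
    using lt[OF _ that] by (force simp: relfacet_def)
  have "emeasure facet_measure (ball y r) = (\<Sum>m\<in>N. if m = n then emeasure (plane_measure n (c n)) (ball y r \<inter> relfacet n) else 0)"
    by (subst emeasure_facet_measure) (auto intro!: sum.cong simp: 1)
  also have "\<dots> = emeasure (plane_measure n (c n)) (ball y r \<inter> relfacet n)"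
    using n finite_normals by simp
  also have "\<dots> = emeasure (plane_measure n (c n)) (ball y r)"
  proof (rule emeasure_eq_AE)
    show "AE x in plane_measure n (c n). (x \<in> ball y r \<inter> relfacet n) = (x \<in> ball y r)"
    proof -
      have "AE x in plane_measure n (c n). x \<bullet> n = c n"
        unfolding plane_measure_def using unit_normals[OF n]
        by (subst AE_distr_iff; (subst AE_density)?; (measurable)?) (auto simp: inner_add_left dot_square_norm)
      then show ?thesis using lt by (auto elim!: eventually_mono simp: relfacet_def)
    qed
  qed auto
  also have "\<dots> = ennreal (pi * r\<^sup>2)" by (rule emeasure_plane_measure_ball[OF unit_normals[OF n] r y])
  finally show e: "emeasure facet_measure (ball y r) = ennreal (pi * r\<^sup>2)" .
  have "(LINT x:ball y r|facet_measure. facet_normal x) = (\<integral>x. indicator (ball y r) x *\<^sub>R n \<partial>facet_measure)"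
    unfolding set_lebesgue_integral_def
  proof (rule integral_cong_AE)
    have "AE x in facet_measure. x \<in> (\<Union>m\<in>N. relfacet m)"
      unfolding facet_measure_def by (subst AE_density) (auto simp: indicator_def)
    then show "AE x in facet_measure. indicator (ball y r) x *\<^sub>R facet_normal x = indicator (ball y r) x *\<^sub>R n"
    proof eventually_elim
      case (elim x)
      then show ?case using sub facet_normal_eq[OF n] by (cases "x \<in> ball y r") auto
    qed
  qed measurable
  also have "\<dots> = measure facet_measure (ball y r) *\<^sub>R n"
    using e by (subst integral_scaleR_left) (auto intro: integrable_real_indicator)
  also have "measure facet_measure (ball y r) = pi * r\<^sup>2" using e by (simp add: measure_def)
  finally show "(LINT x:ball y r|facet_measure. facet_normal x) = (pi * r\<^sup>2) *\<^sub>R n" .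
qed

lemma measure_facet_measure_ball_le:
  assumes "0 < r"
  shows "measure facet_measure (ball x r) \<le> real (card N) * (4 * pi) * r\<^sup>2"
proof -
  have "emeasure facet_measure (ball x r) \<le> (\<Sum>n\<in>N. ennreal (pi * (2 * r)\<^sup>2))"
    unfolding emeasure_facet_measure[OF borel_open[OF open_ball]]
  proof (rule sum_mono)
    fix n assume n: "n \<in> N"
    have "emeasure (plane_measure n (c n)) (ball x r \<inter> relfacet n) \<le> emeasure (plane_measure n (c n)) (ball x r)"
      by (intro emeasure_mono) auto
    then show "emeasure (plane_measure n (c n)) (ball x r \<inter> relfacet n) \<le> ennreal (pi * (2 * r)\<^sup>2)"
      using emeasure_plane_measure_ball_le[OF unit_normals[OF n] assms] order_trans by blast
  qed
  also have "\<dots> = ennreal (real (card N) * (4 * pi) * r\<^sup>2)"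
    by (simp add: ennreal_of_nat_eq_real_of_nat ennreal_mult power_mult_distrib mult_ac flip: ennreal_mult)
  finally show ?thesis
    unfolding measure_def by (intro enn2real_leI) auto
qed

text \<open>In a small ball around a point of a facet, a fixed proportion of the mass lies in a smaller ball
  that meets only this facet, where the normal is constant. So an approximate normal that comes close
  to being a unit vector is close to the normal of the facet.\<close>

lemma is_outer_normal_at_facet:
  assumes out: "is_outer_normal_at W x \<nu>" and n: "n \<in> N" and z: "z \<in> relfacet n"
    and x: "x \<in> W" "x \<bullet> n = c n"
  shows "\<nu> = n"
proof -
  obtain M \<sigma> where G: "is_gauss_green_measure W M \<sigma>" and pos: "\<And>r. 0 < r \<Longrightarrow> 0 < emeasure M (ball x r)"
    and \<nu>: "norm \<nu> = 1"
    and lim: "((\<lambda>r. (LINT y:ball x r|M. \<sigma> y) /\<^sub>R measure M (ball x r)) \<longlongrightarrow> \<nu>) (at_right 0)"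
    using out unfolding is_outer_normal_at_def by blast
  define a where "a r = (LINT y:ball x r|M. \<sigma> y) /\<^sub>R measure M (ball x r)" for r
  \<comment> \<open>The least slack of the other constraints at \<open>z\<close>; inserting 1 keeps
    the minimum defined when there are none.\<close>
  define \<delta> where "\<delta> = Min (insert 1 ((\<lambda>m. c m - z \<bullet> m) ` (N - {n})))"
  have \<delta>: "0 < \<delta>" "\<And>m. m \<in> N - {n} \<Longrightarrow> \<delta> \<le> c m - z \<bullet> m"
    using z finite_normals by (auto simp: \<delta>_def relfacet_def)
  \<comment> \<open>A ball of radius \<open>t * \<delta>\<close> around the point at fraction
    \<open>t\<close> of the segment from \<open>x\<close> to \<open>z\<close> stays within distance
    \<open>t * L\<close> of \<open>x\<close>; hence the choice \<open>t = r / L\<close>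
    below.\<close>
  define L where "L = norm (z - x) + \<delta> + 1"
  have L: "0 < L" "L \<ge> 1" using \<delta>(1) by (auto simp: L_def add_nonneg_pos)
  define \<epsilon> where "\<epsilon> = \<delta> / L"
  have \<epsilon>: "0 < \<epsilon>" using \<delta>(1) L by (simp add: \<epsilon>_def)
  define K where "K = real (card N) * (4 * pi)"
  \<comment> \<open>The mass of \<open>M\<close> on the ball is not controlled from above, but its
    product with \<open>norm (a r)\<close> is the length of a vector integral, which the facet
    measure bounds by \<open>K * r\<^sup>2\<close>. The extra factor tends to
    \<open>norm \<nu> = 1\<close>.\<close>
  have ineq: "pi * \<epsilon>\<^sup>2 * (1 - n \<bullet> \<nu>) * norm (a r) \<le> K * (1 - a r \<bullet> \<nu>)" if r: "0 < r" "r < 1" for r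
  proof -
    define t where "t = r / L"
    have t: "0 < t" "t \<le> 1" using r L by (auto simp: t_def divide_le_eq)
    \<comment> \<open>Moving towards \<open>z\<close> stays in the plane of the facet and gains
      slack \<open>t * \<delta>\<close> in every other constraint, because those hold at
      \<open>x\<close> and have slack \<open>\<delta>\<close> at \<open>z\<close>.\<close>
    define y where "y = x + t *\<^sub>R (z - x)"
    define \<rho> where "\<rho> = \<epsilon> * r"
    have \<rho>: "0 < \<rho>" "\<rho> = t * \<delta>"
      unfolding \<rho>_def using \<epsilon> r by (auto intro: mult_pos_pos) (simp add: \<epsilon>_def t_def)
    have yn: "y \<bullet> n = c n" using x(2) z by (simp add: y_def inner_add_left inner_diff_left relfacet_def)
    have far: "y \<bullet> m + \<rho> \<le> c m" if m: "m \<in> N - {n}" for m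
    proof -
      have "y \<bullet> m = (1 - t) * (x \<bullet> m) + t * (z \<bullet> m)" by (simp add: y_def algebra_simps inner_add_left inner_diff_left)
      also have "\<dots> \<le> (1 - t) * c m + t * (c m - \<delta>)"
        using x(1) m \<delta>(2)[OF m] t by (intro add_mono mult_left_mono) (auto simp: W_def)
      finally show ?thesis by (simp add: \<rho>(2) algebra_simps)
    qed
    have sub: "ball y \<rho> \<subseteq> ball x r"
    proof
      fix w assume "w \<in> ball y \<rho>"
      then have "dist x w < dist x y + \<rho>" using dist_triangle[of x w y] by simp
      also have "dist x y = t * norm (z - x)" using t by (simp add: y_def dist_commute[of x] dist_norm)
      also have "t * norm (z - x) + \<rho> = t * (norm (z - x) + \<delta>)" by (simp add: \<rho>(2) distrib_left)
      also have "\<dots> \<le> t * L" using t by (intro mult_left_mono) (auto simp: L_def)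
      also have "\<dots> = r" using L by (simp add: t_def)
      finally show "w \<in> ball x r" by simp
    qed
    have V: "(LINT y:ball y \<rho>|M. \<sigma> y) = (pi * \<rho>\<^sup>2) *\<^sub>R n"
      using gauss_green_ball_unique[OF G is_gauss_green_measure_facets \<rho>(1)] ball_meeting_one_facet(2)[OF n yn \<rho>(1) far] by simp
    have nn: "norm n = 1" by (rule unit_normals[OF n])
    have "pi * \<rho>\<^sup>2 * (1 - n \<bullet> \<nu>) \<le> measure M (ball y \<rho>) - (LINT y:ball y \<rho>|M. \<sigma> y) \<bullet> \<nu>"
      using gauss_green_ball_norm_le(1)[OF G \<rho>(1), of y] unfolding V by (simp add: nn algebra_simps)
    also have "\<dots> \<le> measure M (ball x r) - (LINT y:ball x r|M. \<sigma> y) \<bullet> \<nu>"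
      by (rule gauss_green_ball_norm_le(3)[OF G r(1) \<nu> sub \<rho>(1)])
    also have "\<dots> = measure M (ball x r) * (1 - a r \<bullet> \<nu>)"
    proof -
      have "measure M (ball x r) \<noteq> 0"
        using pos[OF r(1)] gauss_green_ball_norm_le(2)[OF G r(1), of x] by auto
      then show ?thesis by (simp add: a_def algebra_simps)
    qed
    finally have 1: "pi * \<rho>\<^sup>2 * (1 - n \<bullet> \<nu>) \<le> measure M (ball x r) * (1 - a r \<bullet> \<nu>)" .
    have mp: "0 < measure M (ball x r)"
      using pos[OF r(1)] gauss_green_ball_norm_le(2)[OF G r(1), of x] by simp
    have "measure M (ball x r) * norm (a r) = norm (LINT y:ball x r|M. \<sigma> y)"
      using mp by (simp add: a_def)
    also have "\<dots> \<le> measure facet_measure (ball x r)"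
      unfolding gauss_green_ball_unique[OF G is_gauss_green_measure_facets r(1)]
      by (rule gauss_green_ball_norm_le(1)[OF is_gauss_green_measure_facets r(1)])
    also have "\<dots> \<le> K * r\<^sup>2" unfolding K_def by (rule measure_facet_measure_ball_le[OF r(1)])
    finally have 2: "measure M (ball x r) * norm (a r) \<le> K * r\<^sup>2" .
    have "a r \<bullet> \<nu> \<le> 1"
    proof -
      have "norm (a r) \<le> 1"
        using gauss_green_ball_norm_le(1)[OF G r(1), of x] mp by (simp add: a_def field_simps)
      then show ?thesis using norm_cauchy_schwarz[of "a r" \<nu>] \<nu> by simp
    qed
    have "(pi * \<rho>\<^sup>2 * (1 - n \<bullet> \<nu>)) * norm (a r) \<le> (measure M (ball x r) * (1 - a r \<bullet> \<nu>)) * norm (a r)"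
      using 1 by (rule mult_right_mono) simp
    also have "\<dots> = (measure M (ball x r) * norm (a r)) * (1 - a r \<bullet> \<nu>)" by simp
    also have "\<dots> \<le> (K * r\<^sup>2) * (1 - a r \<bullet> \<nu>)"
      using 2 \<open>a r \<bullet> \<nu> \<le> 1\<close> by (intro mult_right_mono) auto
    finally have "r\<^sup>2 * (pi * \<epsilon>\<^sup>2 * (1 - n \<bullet> \<nu>) * norm (a r)) \<le> r\<^sup>2 * (K * (1 - a r \<bullet> \<nu>))"
      by (simp add: \<rho>_def power_mult_distrib mult_ac)
    then show ?thesis using r(1) by simp
  qed
  have lim': "(a \<longlongrightarrow> \<nu>) (at_right 0)" using lim by (simp add: a_def[abs_def])
  \<comment> \<open>In the limit the right side is 0 because \<open>\<nu>\<close> is a unit vector,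
    which forces equality in the Cauchy-Schwarz inequality for \<open>n\<close> and
    \<open>\<nu>\<close>.\<close>
  have "pi * \<epsilon>\<^sup>2 * (1 - n \<bullet> \<nu>) * norm \<nu> \<le> K * (1 - \<nu> \<bullet> \<nu>)"
  proof (rule tendsto_le)
    show "((\<lambda>r. K * (1 - a r \<bullet> \<nu>)) \<longlongrightarrow> K * (1 - \<nu> \<bullet> \<nu>)) (at_right 0)"
      by (intro tendsto_intros lim')
    show "((\<lambda>r. pi * \<epsilon>\<^sup>2 * (1 - n \<bullet> \<nu>) * norm (a r)) \<longlongrightarrow> pi * \<epsilon>\<^sup>2 * (1 - n \<bullet> \<nu>) * norm \<nu>) (at_right 0)"
      by (intro tendsto_intros lim')
    show "\<forall>\<^sub>F r in at_right 0. pi * \<epsilon>\<^sup>2 * (1 - n \<bullet> \<nu>) * norm (a r) \<le> K * (1 - a r \<bullet> \<nu>)"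
      using eventually_at_right_less[of 0] eventually_at_right_field[of "\<lambda>r. r < 1" 0]
      by (auto intro!: eventually_at_rightI[of 0 1] ineq)
  qed simp
  then have "pi * \<epsilon>\<^sup>2 * (1 - n \<bullet> \<nu>) \<le> 0" using \<nu> by (simp add: dot_square_norm)
  then have "1 \<le> n \<bullet> \<nu>" using \<epsilon> pi_gt_zero by (simp add: mult_le_0_iff)
  then have "n \<bullet> \<nu> = norm n * norm \<nu>"
    using norm_cauchy_schwarz[of n \<nu>] \<nu> unit_normals[OF n] by simp
  then have "norm n *\<^sub>R \<nu> = norm \<nu> *\<^sub>R n" by (simp only: norm_cauchy_schwarz_eq)
  then show "\<nu> = n" using \<nu> unit_normals[OF n] by simp
qed

text \<open>Near a point off the closed facets the facet measure vanishes, so the vector integrals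
  of every other pair vanish on small balls as well. The averages are then 0 and cannot tend to a
  unit vector.\<close>

lemma is_outer_normal_at_imp_facet:
  assumes out: "is_outer_normal_at W x \<nu>"
  shows "\<exists>n\<in>N. x \<in> W \<and> x \<bullet> n = c n"
proof (rule ccontr)
  assume no: "\<not> ?thesis"
  define C where "C = (\<Union>n\<in>N. W \<inter> {x. x \<bullet> n = c n})"
  have "closed C"
    unfolding C_def using finite_normals compact_imp_closed[OF compact_body]
    by (intro closed_UN ballI closed_Int closed_Collect_eq continuous_intros) auto
  moreover have "x \<notin> C" using no by (auto simp: C_def)
  ultimately obtain s where s: "0 < s" "ball x s \<subseteq> - C"
    using openE[of "- C" x] by (auto simp: open_Compl)
  have rel: "(\<Union>n\<in>N. relfacet n) \<subseteq> C" using relfacet_subset_body by (force simp: C_def relfacet_def)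
  obtain M \<sigma> where G: "is_gauss_green_measure W M \<sigma>"
    and \<nu>: "norm \<nu> = 1"
    and lim: "((\<lambda>r. (LINT y:ball x r|M. \<sigma> y) /\<^sub>R measure M (ball x r)) \<longlongrightarrow> \<nu>) (at_right 0)"
    using out unfolding is_outer_normal_at_def by blast
  have "(LINT y:ball x r|M. \<sigma> y) = 0" if "0 < r" "r < s" for r
  proof -
    have "ball x r \<inter> relfacet n = {}" if "n \<in> N" for n
      using rel s that \<open>r < s\<close> by force
    then have "emeasure facet_measure (ball x r) = 0"
      by (simp add: emeasure_facet_measure)
    then have "norm (LINT y:ball x r|facet_measure. facet_normal y) \<le> 0"
      using gauss_green_ball_norm_le(1)[OF is_gauss_green_measure_facets \<open>0 < r\<close>, of x] by (simp add: measure_def)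
    then show ?thesis using gauss_green_ball_unique[OF G is_gauss_green_measure_facets \<open>0 < r\<close>, of x] by simp
  qed
  then have "\<forall>\<^sub>F r in at_right 0. (LINT y:ball x r|M. \<sigma> y) /\<^sub>R measure M (ball x r) = 0"
    using s(1) by (auto intro!: eventually_at_rightI[of 0 s])
  then have "((\<lambda>r. (LINT y:ball x r|M. \<sigma> y) /\<^sub>R measure M (ball x r)) \<longlongrightarrow> 0) (at_right 0)"
    by (rule tendsto_eventually)
  then have "\<nu> = 0" using tendsto_unique[OF _ lim] by simp
  then show False using \<nu> by simp
qed

lemma is_outer_normal_at_relfacet:
  assumes n: "n \<in> N" and x: "x \<in> relfacet n"
  shows "is_outer_normal_at W x n"
proof -
  define \<delta> where "\<delta> = Min (insert 1 ((\<lambda>m. c m - x \<bullet> m) ` (N - {n})))"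
  have \<delta>: "0 < \<delta>" "\<And>m. m \<in> N - {n} \<Longrightarrow> \<delta> \<le> c m - x \<bullet> m"
    using x finite_normals by (auto simp: \<delta>_def relfacet_def)
  have xn: "x \<bullet> n = c n" using x by (simp add: relfacet_def)
  have far: "x \<bullet> m + r \<le> c m" if "r \<le> \<delta>" "m \<in> N - {n}" for r m using \<delta>(2)[OF that(2)] that(1) by linarith
  show ?thesis
    unfolding is_outer_normal_at_def
  proof (intro exI conjI allI impI)
    show "is_gauss_green_measure W facet_measure facet_normal" by (rule is_gauss_green_measure_facets)
    show "norm n = 1" by (rule unit_normals[OF n])
    show "0 < emeasure facet_measure (ball x r)" if "0 < r" for r
    proof -
      have "0 < ennreal (pi * (min r \<delta>)\<^sup>2)" using that \<delta>(1) by simp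
      also have "\<dots> = emeasure facet_measure (ball x (min r \<delta>))"
        using that \<delta>(1) far by (intro ball_meeting_one_facet(1)[OF n xn, symmetric]) auto
      also have "\<dots> \<le> emeasure facet_measure (ball x r)"
        by (intro emeasure_mono) auto
      finally show ?thesis .
    qed
    have "(LINT y:ball x r|facet_measure. facet_normal y) /\<^sub>R measure facet_measure (ball x r) = n"
      if "0 < r" "r < \<delta>" for r
    proof -
      have "measure facet_measure (ball x r) = pi * r\<^sup>2" "pi * r\<^sup>2 \<noteq> 0"
        using ball_meeting_one_facet(1)[OF n xn that(1) far] that by (simp_all add: measure_def)
      moreover have "(LINT y:ball x r|facet_measure. facet_normal y) = (pi * r\<^sup>2) *\<^sub>R n"
        using that by (intro ball_meeting_one_facet(2)[OF n xn that(1) far]) auto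
      ultimately show ?thesis by (simp only: scaleR_scaleR left_inverse not_False_eq_True scaleR_one)
    qed
    then have "\<forall>\<^sub>F r in at_right 0. (LINT y:ball x r|facet_measure. facet_normal y) /\<^sub>R measure facet_measure (ball x r) = n"
      using \<delta>(1) by (auto intro!: eventually_at_rightI[of 0 \<delta>])
    then show "((\<lambda>r. (LINT y:ball x r|facet_measure. facet_normal y) /\<^sub>R measure facet_measure (ball x r)) \<longlongrightarrow> n) (at_right 0)"
      by (rule tendsto_eventually)
  qed
qed

context
  assumes facets: "\<And>n. n \<in> N \<Longrightarrow> relfacet n \<noteq> {}"
begin

text \<open>An outer normal at a point shared by two closed facets would equal both facet normals,
  so edges and vertices drop out. \<open>is_outer_normal_at_facet\<close> uses a point in the
  relative interior of each facet, which \<open>facets\<close> provides.\<close>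

lemma reduced_boundary_polytope: "reduced_boundary W = (\<Union>n\<in>N. relfacet n)"
proof (intro equalityI subsetI)
  fix x assume "x \<in> reduced_boundary W"
  then obtain \<nu> where out: "is_outer_normal_at W x \<nu>" by (auto simp: reduced_boundary_def)
  have \<nu>: "\<nu> = m" if "m \<in> N" "x \<in> W" "x \<bullet> m = c m" for m
    using is_outer_normal_at_facet[OF out] facets that by blast
  obtain n where n: "n \<in> N" "x \<in> W" "x \<bullet> n = c n" using is_outer_normal_at_imp_facet[OF out] by blast
  have "x \<bullet> m < c m" if "m \<in> N - {n}" for m
    using \<nu>[OF n] \<nu>[of m] n(2) that by (auto simp: W_def order.strict_iff_order)
  then show "x \<in> (\<Union>n\<in>N. relfacet n)" using n by (auto simp: relfacet_def)
next
  fix x assume "x \<in> (\<Union>n\<in>N. relfacet n)"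
  then show "x \<in> reduced_boundary W" using is_outer_normal_at_relfacet by (auto simp: reduced_boundary_def)
qed

lemma outer_normal_polytope:
  assumes "n \<in> N" "x \<in> relfacet n"
  shows "outer_normal W x = n"
  unfolding outer_normal_def
proof (rule the_equality)
  show "is_outer_normal_at W x n" by (rule is_outer_normal_at_relfacet[OF assms])
  fix \<nu> assume "is_outer_normal_at W x \<nu>"
  then show "\<nu> = n"
    using is_outer_normal_at_facet[OF _ assms] relfacet_subset_body[OF assms(1)] assms(2)
    by (auto simp: relfacet_def)
qed

text \<open>The divergence theorem for the identity field: the polytope is the union of the pyramids with apex
  \<open>0\<close> over its facets.\<close>

theorem surface_energy_polytope:
  assumes "\<And>n. n \<in> N \<Longrightarrow> \<phi> n = c n"
  shows "surface_energy \<phi> W = 3 * measure lebesgue W"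
proof -
  have id: "C1_vector_field (\<lambda>x :: real ^ 3. x)" "divergence (\<lambda>x :: real ^ 3. x) x = 3" for x
  proof -
    have J: "jacobian (\<lambda>x :: real ^ 3. x) (at x) = mat 1" for x
      unfolding jacobian_def by (simp add: frechet_derivative_ident matrix_def mat_def axis_def vec_eq_iff)
    show "C1_vector_field (\<lambda>x :: real ^ 3. x)" by (simp add: C1_vector_field_def J)
    show "divergence (\<lambda>x :: real ^ 3. x) x = 3" by (simp add: divergence_def J trace_I)
  qed
  have "surface_energy \<phi> W = (\<integral>x. (\<Sum>n\<in>N. indicator (relfacet n) x * (x \<bullet> n)) \<partial>hausdorff_measure 2)"
    unfolding surface_energy_def set_lebesgue_integral_def reduced_boundary_polytope
  proof (rule Bochner_Integration.integral_cong[OF refl])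
    fix x
    show "indicator (\<Union>n\<in>N. relfacet n) x *\<^sub>R \<phi> (outer_normal W x) = (\<Sum>n\<in>N. indicator (relfacet n) x * (x \<bullet> n))"
    proof (cases "x \<in> (\<Union>n\<in>N. relfacet n)")
      case True
      then obtain n where n: "n \<in> N" "x \<in> relfacet n" by blast
      have "(\<Sum>m\<in>N. indicator (relfacet m) x * (x \<bullet> m)) = (\<Sum>m\<in>N. if m = n then c n else 0)"
        using relfacet_disjoint[OF n(1)] n(2)
        by (intro sum.cong refl) (auto simp: indicator_def relfacet_def)
      then show ?thesis using True n finite_normals assms by (simp add: outer_normal_polytope)
    qed auto
  qed
  also have "\<dots> = (\<Sum>n\<in>N. \<integral>x. indicator (relfacet n) x * (x \<bullet> n) \<partial>hausdorff_measure 2)"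
    by (intro Bochner_Integration.integral_sum)
      (simp add: integrable_hausdorff_relfacet integrable_body_plane_measure relfacet_subset_body continuous_on_inner)
  also have "\<dots> = (\<Sum>n\<in>N. \<integral>x. indicator W x * (x \<bullet> n) \<partial>plane_measure n (c n))"
    by (intro sum.cong refl) (simp add: integral_hausdorff_relfacet integral_plane_measure_relfacet)
  also have "\<dots> = (\<integral>x. indicator W x * 3 \<partial>lborel)"
    using divergence_theorem[OF id(1)] by (simp add: id(2))
  also have "\<dots> = 3 * measure lebesgue W"
    by (simp add: measure_completion)
  finally show ?thesis .
qed

end

end

section \<open>Lattice points in a layer\<close>

lemma orthonormal_basis_through_cases:
  assumes "orthonormal_basis_through \<nu> B"
  obtains b c where "B = {\<nu>, b, c}" "\<nu> \<bullet> \<nu> = 1" "b \<bullet> b = 1" "c \<bullet> c = 1"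
    "\<nu> \<bullet> b = 0" "\<nu> \<bullet> c = 0" "b \<bullet> c = 0" "b \<noteq> \<nu>" "c \<noteq> \<nu>"
proof -
  have B: "\<nu> \<in> B" "card B = 3" "pairwise orthogonal B" "\<And>b. b \<in> B \<Longrightarrow> norm b = 1"
    using assms by (auto simp: orthonormal_basis_through_def)
  have "card (B - {\<nu>}) = 2" using B(1,2) by simp
  then obtain b c where bc: "B - {\<nu>} = {b, c}" "b \<noteq> c" by (meson card_2_iff)
  then have "B = {\<nu>, b, c}" "b \<noteq> \<nu>" "c \<noteq> \<nu>" using B(1) by blast+
  moreover have "x \<bullet> x = 1" if "x \<in> B" for x using B(4)[OF that] by (simp add: dot_square_norm)
  moreover have "x \<bullet> y = 0" if "x \<in> B" "y \<in> B" "x \<noteq> y" for x y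
    using B(3) that by (auto simp: pairwise_def orthogonal_def)
  ultimately show ?thesis using that[of b c] bc(2) by blast
qed

lemma orthonormal_box_measure:
  assumes B: "orthonormal_basis_through \<nu> B" and "0 \<le> s" "0 \<le> h"
  defines "S \<equiv> {x. (\<forall>b\<in>B - {\<nu>}. \<bar>x \<bullet> b\<bar> \<le> s / 2) \<and> - h \<le> x \<bullet> \<nu> \<and> x \<bullet> \<nu> \<le> 0}"
  shows "S \<in> lmeasurable" "measure lebesgue S = s\<^sup>2 * h"
proof -
  obtain b c where bc: "B = {\<nu>, b, c}" "\<nu> \<bullet> \<nu> = 1" "b \<bullet> b = 1" "c \<bullet> c = 1"
    "\<nu> \<bullet> b = 0" "\<nu> \<bullet> c = 0" "b \<bullet> c = 0" "b \<noteq> \<nu>" "c \<noteq> \<nu>"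
    using orthonormal_basis_through_cases[OF B] by metis
  have bc': "b \<bullet> \<nu> = 0" "c \<bullet> \<nu> = 0" "c \<bullet> b = 0" using bc by (simp_all add: inner_commute)
  define R where "R x = x $ 1 *\<^sub>R b + x $ 2 *\<^sub>R c + x $ 3 *\<^sub>R \<nu>" for x :: "real ^ 3"
  have "linear R" by (rule linearI) (simp_all add: R_def algebra_simps)
  moreover have "R x \<bullet> R y = x \<bullet> y" for x y
  proof -
    have "R x \<bullet> R y = x $ 1 * y $ 1 + x $ 2 * y $ 2 + x $ 3 * y $ 3"
      by (simp add: R_def inner_add_left inner_add_right bc bc')
    then show ?thesis by (simp add: inner_vec_def sum_3)
  qed
  ultimately have R: "orthogonal_transformation R" by (simp add: orthogonal_transformation_def)
  have inner: "R x \<bullet> b = x $ 1" "R x \<bullet> c = x $ 2" "R x \<bullet> \<nu> = x $ 3" for x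
    by (simp_all add: R_def inner_add_left bc bc')
  define l u :: "real ^ 3" where "l = vector [- s / 2, - s / 2, - h]" and "u = vector [s / 2, s / 2, 0]"
  have S: "S = R ` cbox l u"
  proof (intro equalityI subsetI)
    fix x assume x: "x \<in> S"
    obtain y where y: "x = R y" using orthogonal_transformation_surj[OF R] by (metis surjD)
    have "y \<in> cbox l u" using x bc(1,8,9) unfolding S_def y
      by (auto simp: inner mem_box_cart forall_3 l_def u_def abs_le_iff)
    then show "x \<in> R ` cbox l u" using y by blast
  next
    fix x assume "x \<in> R ` cbox l u"
    then show "x \<in> S" using bc(1)
      by (auto simp: S_def inner mem_box_cart forall_3 l_def u_def abs_le_iff)
  qed
  show "S \<in> lmeasurable" unfolding S by (rule measurable_orthogonal_image[OF R]) simp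
  have "measure lebesgue S = measure lborel (cbox l u)"
    unfolding S by (subst measure_orthogonal_image[OF R]) (auto simp: measure_completion)
  also have "\<dots> = (\<Prod>i\<in>UNIV. u $ i - l $ i)"
  proof (rule content_cbox_cart)
    have "l \<in> cbox l u" using assms(2,3) by (simp add: mem_box_cart forall_3 l_def u_def)
    then show "cbox l u \<noteq> {}" by blast
  qed
  also have "\<dots> = s\<^sup>2 * h" unfolding UNIV_3 by (simp add: l_def u_def power2_eq_square)
  finally show "measure lebesgue S = s\<^sup>2 * h" .
qed

text \<open>Each lattice point of the layer \<open>0 \<le> x \<bullet> \<nu> < h\<close> is moved along \<open>v\<close> into the plane \<open>x \<bullet> \<nu> = 0\<close>; the
  points obtained form a two-dimensional lattice, and the translates of its fundamental cell, thickened
  along \<open>v\<close>, tile the slab \<open>- h \<le> x \<bullet> \<nu> \<le> 0\<close>.\<close>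

lemma lattice_layer_count_bounds:
  fixes a1 a2 v \<nu> :: "real ^ 3" and L :: "(real ^ 3) set"
  assumes L: "\<And>x. x \<in> L \<longleftrightarrow> (\<exists>k l m :: int. x = of_int k *\<^sub>R a1 + of_int l *\<^sub>R a2 + of_int m *\<^sub>R v)"
    and D: "D = \<bar>det (vector [a1, a2, v] :: real ^ 3 ^ 3)\<bar>" "0 < D"
    and B: "orthonormal_basis_through \<nu> B" and h: "h = - (v \<bullet> \<nu>)" "0 < h"
    and fin: "\<And>T. finite (L \<inter> open_cube B T)"
  defines "S \<equiv> (\<lambda>T. {x \<in> L \<inter> open_cube B T. 0 \<le> x \<bullet> \<nu> \<and> x \<bullet> \<nu> < h})"
  obtains K where "0 \<le> K" "\<And>T. T \<ge> K \<Longrightarrow> h * (T - K)\<^sup>2 \<le> real (card (S T)) * D"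
    "\<And>T. T \<ge> K \<Longrightarrow> real (card (S T)) * D \<le> h * (T + K)\<^sup>2"
proof -
  obtain b c where bc: "B = {\<nu>, b, c}" "\<nu> \<bullet> \<nu> = 1" "b \<bullet> b = 1" "c \<bullet> c = 1"
    "\<nu> \<bullet> b = 0" "\<nu> \<bullet> c = 0" "b \<bullet> c = 0" "b \<noteq> \<nu>" "c \<noteq> \<nu>"
    using orthonormal_basis_through_cases[OF B] by metis
  have vn: "v \<bullet> \<nu> = - h" using h by simp
  define \<pi> where "\<pi> x = x + ((x \<bullet> \<nu>) / h) *\<^sub>R v" for x
  have lin_\<pi>: "linear \<pi>"
    by (rule linearI) (simp_all add: \<pi>_def algebra_simps inner_add_left add_divide_distrib)
  have \<pi>_v: "\<pi> v = 0" using h by (simp add: \<pi>_def vn)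
  have \<pi>_\<nu>: "\<pi> x \<bullet> \<nu> = 0" for x using h by (simp add: \<pi>_def inner_add_left vn)
  define G where "G y = y $ 1 *\<^sub>R \<pi> a1 + y $ 2 *\<^sub>R \<pi> a2 + y $ 3 *\<^sub>R v" for y :: "real ^ 3"
  have lin_G: "linear G" by (rule linearI) (simp_all add: G_def algebra_simps)
  have det_G: "\<bar>det (matrix G)\<bar> = D"
  proof -
    have "matrix G = transpose (vector [\<pi> a1, \<pi> a2, v])"
      by (simp add: matrix_def transpose_def vec_eq_iff forall_3 G_def axis_def)
    then have "det (matrix G) = det (vector [\<pi> a1, \<pi> a2, v] :: real ^ 3 ^ 3)" by (simp only: det_transpose)
    \<comment> \<open>\<open>\<pi>\<close> adds multiples of the third row to the first two, so the
      determinant is unchanged.\<close>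
    also have "\<dots> = det (vector [a1, a2, v] :: real ^ 3 ^ 3)"
      unfolding det_3 \<pi>_def by (simp add: algebra_simps)
    finally show ?thesis using D by simp
  qed
  have inj_G: "inj G" and surj_G: "surj G"
  proof -
    have "det (matrix G) \<noteq> 0" using det_G D by auto
    then show "inj G" using lin_G by (metis det_nz_iff_inj)
    then show "surj G" using lin_G linear_injective_imp_surjective by blast
  qed
  have G_\<nu>: "G y \<bullet> \<nu> = - h * y $ 3" for y by (simp add: G_def inner_add_left \<pi>_\<nu> vn)
  \<comment> \<open>Bounds the distance from a layer point to any point of its cell.
    \<open>norm v\<close> occurs twice, once for the projection along \<open>v\<close> and once for
    the thickness of the cell.\<close>
  define c0 where "c0 = norm (\<pi> a1) + norm (\<pi> a2) + norm v + norm v"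
  have c0: "0 \<le> c0" by (simp add: c0_def)
  \<comment> \<open>Half of \<open>K\<close> exceeds \<open>c0\<close>, which absorbs the
    displacement between points and their cells on each side, and exceeds \<open>h\<close>, which
    keeps the layer away from the top and bottom of the cube.\<close>
  define K where "K = 2 * c0 + 2 + 2 * h"
  have K: "0 \<le> K" "2 * c0 + 2 \<le> K" "2 * h < K" using c0 h by (auto simp: K_def)
  define Box where "Box s = {x. (\<forall>b\<in>B - {\<nu>}. \<bar>x \<bullet> b\<bar> \<le> s / 2) \<and> - h \<le> x \<bullet> \<nu> \<and> x \<bullet> \<nu> \<le> 0}" for s
  have Box: "Box s \<in> lmeasurable" "measure lebesgue (Box s) = s\<^sup>2 * h" if "0 \<le> s" for s
    using orthonormal_box_measure[OF B that less_imp_le[OF h(2)]] by (simp_all add: Box_def)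
  define cell where "cell Y x = (+) (\<pi> x) ` (G ` Y)" for Y x
  have cell_measure: "cell Y x \<in> lmeasurable" "measure lebesgue (cell Y x) = D * measure lebesgue Y"
    if "Y \<in> lmeasurable" for Y x
    using measurable_linear_image[OF lin_G that] measure_linear_image[OF lin_G that] det_G
    by (simp_all add: cell_def measurable_translation measure_translation)
  have near: "norm (\<pi> x + G y - x) \<le> c0" if "0 \<le> x \<bullet> \<nu>" "x \<bullet> \<nu> < h" "y \<in> cbox 0 1" for x y
  proof -
    have y: "0 \<le> y $ i" "y $ i \<le> 1" for i using that(3) by (auto simp: mem_box_cart)
    have "\<pi> x + G y - x = y $ 1 *\<^sub>R \<pi> a1 + y $ 2 *\<^sub>R \<pi> a2 + y $ 3 *\<^sub>R v + ((x \<bullet> \<nu>) / h) *\<^sub>R v"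
      by (simp add: \<pi>_def G_def)
    also have "norm \<dots> \<le> norm (y $ 1 *\<^sub>R \<pi> a1) + norm (y $ 2 *\<^sub>R \<pi> a2) + norm (y $ 3 *\<^sub>R v) + norm (((x \<bullet> \<nu>) / h) *\<^sub>R v)"
      by (intro norm_triangle_mono order_refl norm_triangle_ineq)
    also have "\<dots> \<le> c0"
      unfolding c0_def norm_scaleR using y that(1,2) h(2)
      by (intro add_mono mult_left_le_one_le) auto
    finally show ?thesis .
  qed
  have unit: "measure lebesgue (cbox 0 (1 :: real ^ 3)) = 1" "measure lebesgue (box 0 (1 :: real ^ 3)) = 1"
  proof -
    have "0 \<in> cbox 0 (1 :: real ^ 3)" by (simp add: mem_box_cart)
    then have "cbox 0 (1 :: real ^ 3) \<noteq> {}" by blast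
    from content_cbox_cart[OF this] show "measure lebesgue (cbox 0 (1 :: real ^ 3)) = 1" by simp
    then show "measure lebesgue (box 0 (1 :: real ^ 3)) = 1" by (simp add: measure_completion measure_lborel_box_eq measure_lborel_cbox_eq)
  qed
  have proj: "x \<bullet> e \<le> y \<bullet> e + c0" "y \<bullet> e \<le> x \<bullet> e + c0"
    if "norm (x - y) \<le> c0" "e \<bullet> e = 1" for x y e :: "real ^ 3"
  proof -
    have "norm e = 1" using that(2) by (simp add: norm_eq_sqrt_inner)
    then have "\<bar>(x - y) \<bullet> e\<bar> \<le> c0" using Cauchy_Schwarz_ineq2[of "x - y" e] that(1) by simp
    then show "x \<bullet> e \<le> y \<bullet> e + c0" "y \<bullet> e \<le> x \<bullet> e + c0" by (simp_all add: inner_diff_left)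
  qed
  show thesis
  proof (rule that[OF K(1)])
    fix T assume T: "T \<ge> K"
    have finS: "finite (S T)" unfolding S_def using fin[of T] by (rule finite_subset[rotated]) auto
    \<comment> \<open>Closed cells cover the smaller box and give the lower bound; open cells are
      disjoint in the larger box and give the upper bound. Both have volume
      \<open>D\<close>.\<close>
    have cover: "Box (T - K) \<subseteq> (\<Union>x\<in>S T. cell (cbox 0 1) x)"
    proof
      fix z assume z: "z \<in> Box (T - K)"
      obtain y where y: "z = G y" using surj_G by (metis surjD)
      define k l where "k = \<lfloor>y $ 1\<rfloor>" and "l = \<lfloor>y $ 2\<rfloor>"
      define s where "s = (of_int k *\<^sub>R a1 + of_int l *\<^sub>R a2) \<bullet> \<nu>"
      \<comment> \<open>Each copy of \<open>v\<close> lowers the level by \<open>h\<close>, so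
        \<open>\<lfloor>s / h\<rfloor>\<close> copies bring the level \<open>s\<close> into the
        layer.\<close>
      define x where "x = of_int k *\<^sub>R a1 + of_int l *\<^sub>R a2 + of_int \<lfloor>s / h\<rfloor> *\<^sub>R v"
      have xL: "x \<in> L" using L x_def by blast
      have x\<nu>: "x \<bullet> \<nu> = s - of_int \<lfloor>s / h\<rfloor> * h"
        by (simp add: x_def s_def inner_add_left vn)
      have "of_int \<lfloor>s / h\<rfloor> * h \<le> s" "s < (of_int \<lfloor>s / h\<rfloor> + 1) * h"
        using floor_divide_lower[OF h(2), of s] floor_divide_upper[OF h(2), of s] by auto
      then have xh: "0 \<le> x \<bullet> \<nu>" "x \<bullet> \<nu> < h" unfolding x\<nu> by (auto simp: algebra_simps)
      have \<pi>x: "\<pi> x = of_int k *\<^sub>R \<pi> a1 + of_int l *\<^sub>R \<pi> a2"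
        unfolding x_def by (simp add: linear_add[OF lin_\<pi>] linear_scale[OF lin_\<pi>] \<pi>_v)
      define w :: "real ^ 3" where "w = vector [y $ 1 - of_int k, y $ 2 - of_int l, y $ 3]"
      have zw: "z = \<pi> x + G w" by (simp add: y G_def w_def \<pi>x algebra_simps)
      have "- h \<le> - h * y $ 3" "- h * y $ 3 \<le> 0" using z G_\<nu>[of y] by (auto simp: Box_def y)
      then have "0 \<le> y $ 3" "y $ 3 \<le> 1" using h(2) by (auto simp: zero_le_mult_iff)
      then have w: "w \<in> cbox 0 1" by (simp add: mem_box_cart forall_3 w_def k_def l_def) linarith
      have nz: "norm (z - x) \<le> c0" using near[OF xh w] by (simp add: zw)
      have "\<bar>x \<bullet> e\<bar> < T / 2" if e: "e \<in> B" for e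
      proof (cases "e = \<nu>")
        case True
        then show ?thesis using xh K(3) T by simp
      next
        case False
        have ee: "e \<bullet> e = 1" using e bc by auto
        have "\<bar>z \<bullet> e\<bar> \<le> (T - K) / 2" using z e False by (auto simp: Box_def)
        then show ?thesis using proj[OF nz ee] K(2) by (simp add: abs_le_iff abs_less_iff field_simps; linarith)
      qed
      then have "x \<in> S T" using xL xh by (simp add: S_def open_cube_def)
      moreover have "z \<in> cell (cbox 0 1) x" unfolding zw cell_def using w by blast
      ultimately show "z \<in> (\<Union>x\<in>S T. cell (cbox 0 1) x)" by blast
    qed
    have "h * (T - K)\<^sup>2 = measure lebesgue (Box (T - K))" using Box(2)[of "T - K"] T by simp
    also have "\<dots> \<le> measure lebesgue (\<Union>x\<in>S T. cell (cbox 0 1) x)"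
      using T by (intro measure_mono_fmeasurable cover fmeasurableD Box fmeasurable.finite_UN finS cell_measure) auto
    also have "\<dots> \<le> (\<Sum>x\<in>S T. measure lebesgue (cell (cbox 0 1) x))"
      by (intro measure_UNION_le finS fmeasurableD cell_measure) auto
    also have "\<dots> = real (card (S T)) * D" by (simp add: cell_measure unit)
    finally show "h * (T - K)\<^sup>2 \<le> real (card (S T)) * D" .
    have sub: "(\<Union>x\<in>S T. cell (box 0 1) x) \<subseteq> Box (T + K)"
    proof
      fix z assume "z \<in> (\<Union>x\<in>S T. cell (box 0 1) x)"
      then obtain x y where x: "x \<in> S T" and y: "y \<in> box 0 1" and z: "z = \<pi> x + G y" by (auto simp: cell_def)
      have y': "y \<in> cbox 0 1" using y box_subset_cbox by blast
      have xh: "0 \<le> x \<bullet> \<nu>" "x \<bullet> \<nu> < h" using x by (auto simp: S_def)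
      have nz: "norm (z - x) \<le> c0" using near[OF xh y'] by (simp add: z)
      have "\<bar>z \<bullet> e\<bar> \<le> (T + K) / 2" if e: "e \<in> B - {\<nu>}" for e
      proof -
        have ee: "e \<bullet> e = 1" using e bc by auto
        have "\<bar>x \<bullet> e\<bar> < T / 2" using x e by (auto simp: S_def open_cube_def)
        then show ?thesis using proj[OF nz ee] K(2) by (simp add: abs_le_iff abs_less_iff field_simps; linarith)
      qed
      moreover have "z \<bullet> \<nu> = - h * y $ 3" by (simp add: z inner_add_left \<pi>_\<nu> G_\<nu>)
      moreover have "0 \<le> y $ 3" "y $ 3 \<le> 1" using y' by (auto simp: mem_box_cart)
      ultimately show "z \<in> Box (T + K)" using h(2) by (simp add: Box_def mult_left_le)
    qed
    have disj: "cell (box 0 1) x \<inter> cell (box 0 1) x' = {}" if x: "x \<in> S T" "x' \<in> S T" "x \<noteq> x'" for x x'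
    proof (rule ccontr)
      assume "\<not> ?thesis"
      then obtain y y' where y: "y \<in> box 0 1" "y' \<in> box 0 1" and eq: "\<pi> x + G y = \<pi> x' + G y'"
        by (auto simp: cell_def)
      obtain k l m k' l' m' :: int where xx: "x = of_int k *\<^sub>R a1 + of_int l *\<^sub>R a2 + of_int m *\<^sub>R v"
        "x' = of_int k' *\<^sub>R a1 + of_int l' *\<^sub>R a2 + of_int m' *\<^sub>R v"
        using x L by (auto simp: S_def)
      have "\<pi> x = of_int k *\<^sub>R \<pi> a1 + of_int l *\<^sub>R \<pi> a2" "\<pi> x' = of_int k' *\<^sub>R \<pi> a1 + of_int l' *\<^sub>R \<pi> a2"
        unfolding xx by (simp_all add: linear_add[OF lin_\<pi>] linear_scale[OF lin_\<pi>] \<pi>_v)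
      then have "G (vector [of_int k, of_int l, 0] + y) = G (vector [of_int k', of_int l', 0] + y')"
        using eq by (simp add: linear_add[OF lin_G]) (simp add: G_def)
      then have "vector [of_int k, of_int l, 0] + y = vector [of_int k', of_int l', 0] + y'"
        using inj_G by (simp add: inj_eq)
      then have "of_int k + y $ 1 = of_int k' + y' $ 1" "of_int l + y $ 2 = of_int l' + y' $ 2"
        by (simp_all add: vec_eq_iff forall_3)
      moreover have "0 < y $ i" "y $ i < 1" "0 < y' $ i" "y' $ i < 1" for i using y by (auto simp: mem_box_cart)
      ultimately have "\<bar>real_of_int (k - k')\<bar> < 1" "\<bar>real_of_int (l - l')\<bar> < 1"
        by (smt (verit) of_int_diff)+
      then have kl: "k = k'" "l = l'" by linarith+
      \<comment> \<open>The two points now differ by a multiple of \<open>v\<close>, hence in level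
        by a multiple of \<open>h\<close>, while the layer has height \<open>h\<close> and contains
        only one of its boundary planes.\<close>
      have "x \<bullet> \<nu> - x' \<bullet> \<nu> = - (real_of_int (m - m') * h)"
        unfolding xx kl by (simp add: inner_add_left vn algebra_simps)
      moreover have "\<bar>x \<bullet> \<nu> - x' \<bullet> \<nu>\<bar> < h" using x by (auto simp: S_def)
      ultimately have "\<bar>real_of_int (m - m')\<bar> * h < 1 * h" using h(2) by (simp add: abs_mult)
      then have "\<bar>real_of_int (m - m')\<bar> < 1" using h(2) by (simp only: mult_less_cancel_right_pos)
      then have "m = m'" by linarith
      then show False using kl xx x(3) by simp
    qed
    have "real (card (S T)) * D = (\<Sum>x\<in>S T. measure lebesgue (cell (box 0 1) x))"
      by (simp add: cell_measure unit)
    also have "\<dots> = measure lebesgue (\<Union>x\<in>S T. cell (box 0 1) x)"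
      using disj by (intro measure_negligible_finite_Union_image[symmetric] finS cell_measure)
        (auto simp: pairwise_def)
    also have "\<dots> \<le> measure lebesgue (Box (T + K))"
      using T K(1) by (intro measure_mono_fmeasurable sub fmeasurableD Box fmeasurable.finite_UN finS cell_measure) auto
    also have "\<dots> = h * (T + K)\<^sup>2" using Box(2)[of "T + K"] T K(1) by simp
    finally show "real (card (S T)) * D \<le> h * (T + K)\<^sup>2" .
  qed
qed

lemma lattice_layer_count_limit:
  fixes a1 a2 v \<nu> :: "real ^ 3" and L :: "(real ^ 3) set"
  assumes L: "\<And>x. x \<in> L \<longleftrightarrow> (\<exists>k l m :: int. x = of_int k *\<^sub>R a1 + of_int l *\<^sub>R a2 + of_int m *\<^sub>R v)"
    and D: "D = \<bar>det (vector [a1, a2, v] :: real ^ 3 ^ 3)\<bar>" "0 < D"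
    and B: "orthonormal_basis_through \<nu> B" and h: "h = - (v \<bullet> \<nu>)" "0 < h"
    and fin: "\<And>T. finite (L \<inter> open_cube B T)"
  shows "((\<lambda>T. real (card {x \<in> L \<inter> open_cube B T. 0 \<le> x \<bullet> \<nu> \<and> x \<bullet> \<nu> < h}) / T\<^sup>2) \<longlongrightarrow> h / D) at_top"
proof -
  obtain K where K: "0 \<le> K"
    "\<And>T. T \<ge> K \<Longrightarrow> h * (T - K)\<^sup>2 \<le> real (card {x \<in> L \<inter> open_cube B T. 0 \<le> x \<bullet> \<nu> \<and> x \<bullet> \<nu> < h}) * D"
    "\<And>T. T \<ge> K \<Longrightarrow> real (card {x \<in> L \<inter> open_cube B T. 0 \<le> x \<bullet> \<nu> \<and> x \<bullet> \<nu> < h}) * D \<le> h * (T + K)\<^sup>2"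
    using lattice_layer_count_bounds[OF assms] by blast
  have lim: "((\<lambda>T. h / D * (1 + k / T)\<^sup>2) \<longlongrightarrow> h / D) at_top" for k :: real
  proof -
    have "((\<lambda>T. k / T) \<longlongrightarrow> 0) at_top" by (rule tendsto_divide_0[OF tendsto_const filterlim_at_top_imp_at_infinity]) (rule filterlim_ident)
    then have "((\<lambda>T. h / D * (1 + k / T)\<^sup>2) \<longlongrightarrow> h / D * (1 + 0)\<^sup>2) at_top" by (intro tendsto_intros)
    then show ?thesis by simp
  qed
  have eq: "h / D * (1 + k / T)\<^sup>2 = h * (T + k)\<^sup>2 / D / T\<^sup>2" if "T > 0" for k T :: real
  proof -
    have "1 + k / T = (T + k) / T" using that by (simp add: field_simps)
    then show ?thesis by (simp add: power_divide)
  qed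
  show ?thesis
  proof (rule tendsto_sandwich[OF _ _ lim[of "- K"] lim[of K]])
    show "\<forall>\<^sub>F T in at_top. h / D * (1 + - K / T)\<^sup>2 \<le> real (card {x \<in> L \<inter> open_cube B T. 0 \<le> x \<bullet> \<nu> \<and> x \<bullet> \<nu> < h}) / T\<^sup>2"
      using eventually_ge_at_top[of "K + 1"]
    proof eventually_elim
      case (elim T)
      then show ?case using K(1) K(2)[of T] eq[of T "- K"] D(2)
        by (simp add: divide_right_mono pos_divide_le_eq)
    qed
    show "\<forall>\<^sub>F T in at_top. real (card {x \<in> L \<inter> open_cube B T. 0 \<le> x \<bullet> \<nu> \<and> x \<bullet> \<nu> < h}) / T\<^sup>2 \<le> h / D * (1 + K / T)\<^sup>2"
      using eventually_ge_at_top[of "K + 1"]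
    proof eventually_elim
      case (elim T)
      then show ?case using K(1) K(3)[of T] eq[of T K] D(2)
        by (simp add: divide_right_mono pos_le_divide_eq)
    qed
  qed
qed

section \<open>The surface density of the FCC lattice\<close>

definition fcc_point :: "int \<times> int \<times> int \<Rightarrow> real ^ 3" where
  "fcc_point t = (case t of (p, q, r) \<Rightarrow> (1 / sqrt 2) *\<^sub>R vector [of_int p, of_int q, of_int r])"

lemma fcc_point_nth:
  "fcc_point (p, q, r) $ 1 = of_int p / sqrt 2" "fcc_point (p, q, r) $ 2 = of_int q / sqrt 2"
  "fcc_point (p, q, r) $ 3 = of_int r / sqrt 2"
  by (simp_all add: fcc_point_def)

lemma fcc_basis_combination:
  "of_int k *\<^sub>R fcc_basis1 + of_int l *\<^sub>R fcc_basis2 + of_int m *\<^sub>R fcc_basis3 = fcc_point (k + l, k + m, l + m)"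
  by (simp add: fcc_basis1_def fcc_basis2_def fcc_basis3_def vec_eq_iff forall_3 fcc_point_nth add_divide_distrib)

lemma inj_fcc_point: "inj fcc_point"
  by (rule injI) (auto simp: vec_eq_iff forall_3 fcc_point_nth)

text \<open>Up to the factor \<open>1 / sqrt 2\<close> these are the integer points of even
  coordinate sum, which turns lattice questions into parity arithmetic. If the sum is
  \<open>2 * s\<close>, the basis coefficients are \<open>s - r\<close>, \<open>s - q\<close>,
  \<open>s - p\<close>.\<close>

lemma fcc_lattice_iff: "x \<in> fcc_lattice \<longleftrightarrow> (\<exists>p q r. x = fcc_point (p, q, r) \<and> even (p + q + r))"
proof
  assume "x \<in> fcc_lattice"
  then obtain k l m where "x = fcc_point (k + l, k + m, l + m)"
    unfolding fcc_lattice_def fcc_basis_combination by blast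
  then show "\<exists>p q r. x = fcc_point (p, q, r) \<and> even (p + q + r)"
    by (intro exI[of _ "k + l"] exI[of _ "k + m"] exI[of _ "l + m"]) simp
next
  assume "\<exists>p q r. x = fcc_point (p, q, r) \<and> even (p + q + r)"
  then obtain p q r where "x = fcc_point (p, q, r)" "even (p + q + r)" by blast
  then obtain s where x: "x = fcc_point (p, q, r)" "p + q + r = 2 * s" by (meson dvdE)
  from x(2) have "(s - r) + (s - q) = p" "(s - r) + (s - p) = q" "(s - q) + (s - p) = r" by linarith+
  then have "x = fcc_point ((s - r) + (s - q), (s - r) + (s - p), (s - q) + (s - p))"
    using x(1) by (simp only:)
  then show "x \<in> fcc_lattice" unfolding fcc_lattice_def fcc_basis_combination by blast
qed

lemma fcc_lattice_add: "x \<in> fcc_lattice \<Longrightarrow> y \<in> fcc_lattice \<Longrightarrow> x + y \<in> fcc_lattice"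
proof -
  assume "x \<in> fcc_lattice" "y \<in> fcc_lattice"
  then obtain p q r p' q' r' where xy: "x = fcc_point (p, q, r)" "y = fcc_point (p', q', r')"
    and ev: "even (p + q + r)" "even (p' + q' + r')"
    unfolding fcc_lattice_iff by blast
  from ev have "even (p + p' + (q + q') + (r + r'))" by presburger
  moreover have "x + y = fcc_point (p + p', q + q', r + r')"
    unfolding xy by (simp add: vec_eq_iff forall_3 fcc_point_nth add_divide_distrib)
  ultimately show ?thesis unfolding fcc_lattice_iff by blast
qed

lemma fcc_lattice_uminus: "x \<in> fcc_lattice \<Longrightarrow> - x \<in> fcc_lattice"
proof -
  assume "x \<in> fcc_lattice"
  then obtain p q r where x: "x = fcc_point (p, q, r)" and ev: "even (p + q + r)"
    unfolding fcc_lattice_iff by blast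
  from ev have "even (- p + - q + - r)" by presburger
  moreover have "- x = fcc_point (- p, - q, - r)"
    unfolding x by (simp add: vec_eq_iff forall_3 fcc_point_nth)
  ultimately show ?thesis unfolding fcc_lattice_iff by blast
qed

lemma finite_fcc_lattice_bounded:
  assumes "bounded A"
  shows "finite (fcc_lattice \<inter> A)"
proof -
  obtain R where R: "\<And>x. x \<in> A \<Longrightarrow> norm x \<le> R" using assms by (auto simp: bounded_iff)
  define K where "K = \<lceil>R * sqrt 2\<rceil>"
  have bound: "\<bar>p\<bar> \<le> K" if "\<bar>real_of_int p / sqrt 2\<bar> \<le> R" for p :: int
  proof -
    have "\<bar>real_of_int p\<bar> \<le> R * sqrt 2" using that by (simp add: abs_divide divide_le_eq)
    then show ?thesis unfolding K_def by linarith
  qed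
  have "fcc_lattice \<inter> A \<subseteq> fcc_point ` ({- K..K} \<times> {- K..K} \<times> {- K..K})"
  proof
    fix x assume x: "x \<in> fcc_lattice \<inter> A"
    then obtain p q r where pqr: "x = fcc_point (p, q, r)" by (auto simp: fcc_lattice_iff)
    have "\<bar>x $ i\<bar> \<le> R" for i using R x component_le_norm_cart[of x i] by (auto intro: order_trans)
    then have "\<bar>p\<bar> \<le> K" "\<bar>q\<bar> \<le> K" "\<bar>r\<bar> \<le> K"
      using bound fcc_point_nth[of p q r] pqr by metis+
    then show "x \<in> fcc_point ` ({- K..K} \<times> {- K..K} \<times> {- K..K})"
      unfolding pqr by (intro imageI) (auto simp: abs_le_iff)
  qed
  then show ?thesis by (rule finite_subset) auto
qed

section \<open>Nearest neighbours and bond counting\<close>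

definition fcc_shell_coords :: "(int \<times> int \<times> int) set" where
  "fcc_shell_coords = {(1,1,0), (1,-1,0), (-1,1,0), (-1,-1,0), (1,0,1), (1,0,-1), (-1,0,1), (-1,0,-1),
     (0,1,1), (0,1,-1), (0,-1,1), (0,-1,-1)}"

definition fcc_shell :: "(real ^ 3) set" where
  "fcc_shell = fcc_point ` fcc_shell_coords"

lemma card_fcc_shell: "card fcc_shell = 12" "finite fcc_shell"
proof -
  have "card fcc_shell_coords = 12" "finite fcc_shell_coords" by (simp_all add: fcc_shell_coords_def)
  then show "card fcc_shell = 12" "finite fcc_shell"
    unfolding fcc_shell_def by (simp_all add: card_image inj_on_subset[OF inj_fcc_point])
qed

text \<open>Norm 1 means that the squares of the integer coordinates sum to 2, so two of them are 1
  or -1 and the third is 0; the coordinate sum is then automatically even.\<close>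

lemma fcc_shell_eq: "fcc_shell = {v \<in> fcc_lattice. norm v = 1}"
proof -
  have norm: "norm (fcc_point (p, q, r)) = 1 \<longleftrightarrow> p\<^sup>2 + q\<^sup>2 + r\<^sup>2 = 2" for p q r
  proof -
    have A: "(norm (fcc_point (p, q, r)))\<^sup>2 = real_of_int (p\<^sup>2 + q\<^sup>2 + r\<^sup>2) / 2"
      unfolding power2_norm_eq_inner
      by (simp add: inner_vec_def sum_3 fcc_point_nth add_divide_distrib power2_eq_square)
    have B: "norm (fcc_point (p, q, r)) = 1 \<longleftrightarrow> (norm (fcc_point (p, q, r)))\<^sup>2 = 1"
      using power2_eq_iff_nonneg[of "norm (fcc_point (p, q, r))" 1] by simp
    have C: "real_of_int (p\<^sup>2 + q\<^sup>2 + r\<^sup>2) / 2 = 1 \<longleftrightarrow> p\<^sup>2 + q\<^sup>2 + r\<^sup>2 = 2"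
      using of_int_eq_iff[of "p\<^sup>2 + q\<^sup>2 + r\<^sup>2" 2, where 'a = real] by (simp del: of_int_eq_iff)
    show ?thesis by (simp only: B A C)
  qed
  have sol: "(p, q, r) \<in> fcc_shell_coords \<longleftrightarrow> p\<^sup>2 + q\<^sup>2 + r\<^sup>2 = 2" for p q r :: int
  proof
    assume eq: "p\<^sup>2 + q\<^sup>2 + r\<^sup>2 = 2"
    have small: "a \<in> {-1, 0, 1}" if "a\<^sup>2 \<le> 2" for a :: int
    proof (rule ccontr)
      assume "a \<notin> {-1, 0, 1}"
      then have "2 \<le> \<bar>a\<bar>" by auto
      then have "2\<^sup>2 \<le> \<bar>a\<bar>\<^sup>2" by (rule power_mono) simp
      then show False using that by simp
    qed
    have sq: "p\<^sup>2 \<le> 2" "q\<^sup>2 \<le> 2" "r\<^sup>2 \<le> 2" using eq zero_le_power2[of p] zero_le_power2[of q] zero_le_power2[of r] by linarith+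
    have "p = -1 \<or> p = 0 \<or> p = 1" "q = -1 \<or> q = 0 \<or> q = 1" "r = -1 \<or> r = 0 \<or> r = 1"
      using small[OF sq(1)] small[OF sq(2)] small[OF sq(3)] by blast+
    then show "(p, q, r) \<in> fcc_shell_coords"
      by (elim disjE; insert eq; simp add: fcc_shell_coords_def)
  qed (auto simp: fcc_shell_coords_def)
  have "even (p + q + r)" if "(p, q, r) \<in> fcc_shell_coords" for p q r
    using that by (auto simp: fcc_shell_coords_def)
  then show ?thesis unfolding fcc_shell_def by (auto simp: fcc_lattice_iff norm sol[symmetric] image_iff) metis+
qed

lemma fcc_neighbours_eq:
  assumes "x \<in> fcc_lattice"
  shows "fcc_neighbours x = (+) x ` fcc_shell"
proof -
  have "y \<in> (+) x ` fcc_shell" if "y \<in> fcc_neighbours x" for y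
  proof (rule image_eqI)
    show "y = x + (y - x)" by simp
    show "y - x \<in> fcc_shell"
      using that fcc_lattice_add[OF _ fcc_lattice_uminus[OF assms], of y]
      by (auto simp: fcc_neighbours_def fcc_shell_eq norm_minus_commute)
  qed
  then show ?thesis using fcc_lattice_add[OF assms] by (auto simp: fcc_neighbours_def fcc_shell_eq)
qed

text \<open>Each site pays one unit for every vacant neighbour. Exchanging the two sums separates
  the bond directions, so that each can be minimised on its own.\<close>

lemma fcc_energy_eq:
  assumes X: "X \<subseteq> fcc_lattice" and A: "bounded A"
  shows "fcc_energy X A = (\<Sum>v\<in>fcc_shell. real (card {x \<in> X \<inter> A. x + v \<notin> X}))"
proof -
  have fin: "finite (X \<inter> A)" by (rule finite_subset[OF _ finite_fcc_lattice_bounded[OF A]]) (use X in auto)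
  have "12 - real (card (fcc_neighbours x \<inter> X)) = (\<Sum>v\<in>fcc_shell. if x + v \<notin> X then 1 else 0)"
    if "x \<in> X \<inter> A" for x
  proof -
    have "fcc_neighbours x \<inter> X = (+) x ` {v \<in> fcc_shell. x + v \<in> X}"
    proof -
      have "x \<in> fcc_lattice" using that X by blast
      from fcc_neighbours_eq[OF this] show ?thesis by auto
    qed
    then have "card (fcc_neighbours x \<inter> X) = card {v \<in> fcc_shell. x + v \<in> X}"
      by (simp add: card_image)
    moreover have "card fcc_shell = card {v \<in> fcc_shell. x + v \<in> X} + card {v \<in> fcc_shell. x + v \<notin> X}"
      using card_fcc_shell(2) by (subst card_Un_disjoint[symmetric]) (auto intro: arg_cong[where f = card])
    ultimately show ?thesis using card_fcc_shell by (simp add: sum.If_cases Int_def)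
  qed
  then have "fcc_energy X A = (\<Sum>x\<in>X \<inter> A. \<Sum>v\<in>fcc_shell. if x + v \<notin> X then 1 else 0)"
    unfolding fcc_energy_def by (intro sum.cong) auto
  also have "\<dots> = (\<Sum>v\<in>fcc_shell. \<Sum>x\<in>X \<inter> A. if x + v \<notin> X then 1 else 0)" by (rule sum.swap)
  also have "\<dots> = (\<Sum>v\<in>fcc_shell. real (card {x \<in> X \<inter> A. x + v \<notin> X}))"
    using fin by (simp add: sum.If_cases Int_def)
  finally show ?thesis .
qed

lemma bounded_open_cube:
  assumes "orthonormal_basis_through \<nu> B"
  shows "bounded (open_cube B T)"
proof -
  obtain b c where bc: "B = {\<nu>, b, c}" "\<nu> \<bullet> \<nu> = 1" "b \<bullet> b = 1" "c \<bullet> c = 1"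
    "\<nu> \<bullet> b = 0" "\<nu> \<bullet> c = 0" "b \<bullet> c = 0" "b \<noteq> \<nu>" "c \<noteq> \<nu>"
    using orthonormal_basis_through_cases[OF assms] by metis
  have bc': "b \<bullet> \<nu> = 0" "c \<bullet> \<nu> = 0" "c \<bullet> b = 0" using bc(5-7) by (simp_all add: inner_commute)
  have "independent B"
    using assms by (intro pairwise_orthogonal_independent) (auto simp: orthonormal_basis_through_def)
  moreover have "card B = dim (UNIV :: (real ^ 3) set)" "finite B"
    using assms bc(1) by (auto simp: orthonormal_basis_through_def)
  ultimately have span: "span B = UNIV" using card_eq_dim[of B UNIV] by auto
  have "norm x \<le> 3 * T" if "x \<in> open_cube B T" for x
  proof -
    have "x \<in> span {\<nu>, b, c}" using span bc(1) by simp
    then obtain \<alpha> \<beta> \<gamma> where x: "x = \<alpha> *\<^sub>R \<nu> + \<beta> *\<^sub>R b + \<gamma> *\<^sub>R c"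
      by (auto simp: span_breakdown_eq algebra_simps)
    have "x \<bullet> \<nu> = \<alpha>" "x \<bullet> b = \<beta>" "x \<bullet> c = \<gamma>"
      unfolding x using bc bc' by (simp_all add: inner_add_left)
    then have "\<bar>\<alpha>\<bar> < T / 2" "\<bar>\<beta>\<bar> < T / 2" "\<bar>\<gamma>\<bar> < T / 2" using that bc(1) by (auto simp: open_cube_def)
    moreover have "norm x \<le> norm (\<alpha> *\<^sub>R \<nu>) + norm (\<beta> *\<^sub>R b) + norm (\<gamma> *\<^sub>R c)"
      unfolding x by (intro norm_triangle_mono order_refl norm_triangle_ineq)
    moreover have "norm \<nu> = 1" "norm b = 1" "norm c = 1" using bc by (simp_all add: norm_eq_sqrt_inner)
    ultimately show ?thesis by simp
  qed
  then show ?thesis unfolding bounded_iff by blast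
qed

section \<open>The half space as a minimiser\<close>

definition fcc_half_space :: "real ^ 3 \<Rightarrow> (real ^ 3) set" where
  "fcc_half_space \<nu> = {x \<in> fcc_lattice. 0 \<le> x \<bullet> \<nu>}"

lemma fcc_half_space_admissible: "fcc_half_space \<nu> \<in> admissible_configurations \<nu> B T"
  by (auto simp: admissible_configurations_def fcc_half_space_def half_space_indicator_def indicator_def)

lemma fcc_half_space_boundary:
  assumes "v \<in> fcc_lattice"
  shows "{x \<in> fcc_half_space \<nu> \<inter> A. x + v \<notin> fcc_half_space \<nu>} =
    {x \<in> fcc_lattice \<inter> A. 0 \<le> x \<bullet> \<nu> \<and> x \<bullet> \<nu> < - (v \<bullet> \<nu>)}"
  using fcc_lattice_add[OF _ assms] by (auto simp: fcc_half_space_def inner_add_left)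

text \<open>On every line in the direction \<open>v\<close> that crosses the plane inside the cube, an admissible
  configuration has at least one bond of direction \<open>v\<close> that leaves it: go back from the crossing to the
  nearest occupied site if the site before the crossing is empty, and otherwise forward to the end of
  the occupied run. The site found stays in the cube because the configuration is fixed near its boundary.\<close>

lemma admissible_boundary_card_ge:
  assumes B: "orthonormal_basis_through \<nu> B" and X: "X \<in> admissible_configurations \<nu> B T"
    and v: "v \<in> fcc_shell"
  shows "card {x \<in> fcc_half_space \<nu> \<inter> open_cube B T. x + v \<notin> fcc_half_space \<nu>}
    \<le> card {x \<in> X \<inter> open_cube B T. x + v \<notin> X}"
proof -
  let ?Q = "open_cube B" and ?H = "fcc_half_space \<nu>"
  define h where "h = - (v \<bullet> \<nu>)"
  have vL: "v \<in> fcc_lattice" and v1: "norm v = 1" using v by (auto simp: fcc_shell_eq)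
  have X_iff: "x \<in> X \<longleftrightarrow> 0 \<le> x \<bullet> \<nu>" if "x \<in> fcc_lattice" "x \<notin> ?Q (T - 3)" for x
  proof -
    have "indicator X x = half_space_indicator \<nu> x" using X that by (auto simp: admissible_configurations_def)
    then show ?thesis by (auto simp: half_space_indicator_def indicator_def split: if_splits)
  qed
  have XL: "X \<subseteq> fcc_lattice" using X by (simp add: admissible_configurations_def)
  have unit: "norm b = 1" if "b \<in> B" for b using B that by (simp add: orthonormal_basis_through_def)
  \<comment> \<open>The margin between the two cubes is 3/2 on each side, more than one bond length,
    so a bond that ends in the inner cube starts in the outer one.\<close>
  have step: "y \<in> ?Q T" if "y + u \<in> ?Q (T - 3)" "norm u \<le> 1" for y u
    unfolding open_cube_def
  proof (intro CollectI ballI)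
    fix b assume b: "b \<in> B"
    have "\<bar>u \<bullet> b\<bar> \<le> 1" using Cauchy_Schwarz_ineq2[of u b] unit[OF b] that(2) by simp
    moreover have "\<bar>(y + u) \<bullet> b\<bar> < (T - 3) / 2" using that(1) b by (auto simp: open_cube_def)
    moreover have "\<bar>s\<bar> < T / 2" if "\<bar>t\<bar> \<le> 1" "\<bar>s + t\<bar> < (T - 3) / 2" for s t :: real
      using that by (simp add: abs_if split: if_splits)
    ultimately show "\<bar>y \<bullet> b\<bar> < T / 2" unfolding inner_add_left by blast
  qed
  have line: "x + of_int k *\<^sub>R v \<in> fcc_lattice" if "x \<in> fcc_lattice" for x and k :: int
  proof (induction k rule: int_induct[of _ 0])
    case base
    then show ?case using that by simp
  next
    case (step1 i)
    then show ?case using fcc_lattice_add[OF step1(2) vL] by (simp add: algebra_simps)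
  next
    case (step2 i)
    then show ?case using fcc_lattice_add[OF step2(2) fcc_lattice_uminus[OF vL]] by (simp add: algebra_simps)
  qed
  have far: "\<exists>n0 :: nat. \<forall>n\<ge>n0. x + (s * real n) *\<^sub>R v \<notin> ?Q (T - 3)" if s: "\<bar>s\<bar> = 1" for x and s :: real
  proof -
    obtain R where R: "\<And>x. x \<in> ?Q (T - 3) \<Longrightarrow> norm x \<le> R"
      using bounded_open_cube[OF B, of "T - 3"] by (auto simp: bounded_iff)
    obtain n0 where n0: "R + norm x < real n0" using reals_Archimedean2 by blast
    have "x + (s * real n) *\<^sub>R v \<notin> ?Q (T - 3)" if "n \<ge> n0" for n
    proof
      assume "x + (s * real n) *\<^sub>R v \<in> ?Q (T - 3)"
      then have "norm (x + (s * real n) *\<^sub>R v) \<le> R" by (rule R)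
      moreover have "real n \<le> norm (x + (s * real n) *\<^sub>R v) + norm x"
        using norm_triangle_ineq4[of "x + (s * real n) *\<^sub>R v" x] s v1 by (simp add: abs_mult)
      ultimately show False using n0 that by linarith
    qed
    then show ?thesis by blast
  qed
  have ex: "\<exists>k :: int. x + of_int k *\<^sub>R v \<in> {y \<in> X \<inter> ?Q T. y + v \<notin> X}"
    if x: "x \<in> {x \<in> ?H \<inter> ?Q T. x + v \<notin> ?H}" for x
  proof -
    have xL: "x \<in> fcc_lattice" and xh: "0 \<le> x \<bullet> \<nu>" "x \<bullet> \<nu> < h" and xQ: "x \<in> ?Q T"
      using x fcc_half_space_boundary[OF vL, of \<nu> "?Q T"] by (auto simp: h_def)
    have h: "0 < h" using xh by linarith
    \<comment> \<open>The level starts in the interval from 0 to \<open>h\<close> and drops by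
      \<open>h\<close> with each step, so the line leaves the half space exactly between the sites 0
      and 1.\<close>
    have pos: "0 \<le> (x + of_int k *\<^sub>R v) \<bullet> \<nu> \<longleftrightarrow> k \<le> 0" for k :: int
    proof -
      have eq: "(x + of_int k *\<^sub>R v) \<bullet> \<nu> = x \<bullet> \<nu> - of_int k * h" by (simp add: h_def inner_add_left)
      show ?thesis
      proof (cases "k \<le> 0")
        case True
        then have "of_int k * h \<le> 0" using h by (simp add: mult_le_0_iff)
        then show ?thesis using True xh eq by simp
      next
        case False
        then have "1 * h \<le> of_int k * h" using h by (intro mult_right_mono) auto
        then have "\<not> 0 \<le> x \<bullet> \<nu> - of_int k * h" using xh(2) by linarith
        then show ?thesis using False eq by simp
      qed
    qed
    show ?thesis
    proof (cases "x \<in> X")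
      case False
      obtain n0 where n0: "\<forall>n\<ge>n0. x + (- 1 * real n) *\<^sub>R v \<notin> ?Q (T - 3)" using far[of "- 1" x] by auto
      define P where "P n \<longleftrightarrow> x + of_int (- int n) *\<^sub>R v \<in> X" for n :: nat
      have "P n0"
      proof -
        have "x + of_int (- int n0) *\<^sub>R v \<notin> ?Q (T - 3)" using n0[rule_format, of n0] by simp
        from X_iff[OF line[OF xL] this] show ?thesis unfolding P_def pos by simp
      qed
      define n where "n = (LEAST n. P n)"
      have n1: "P n" unfolding n_def by (rule LeastI[of P, OF \<open>P n0\<close>])
      have n2: "\<not> P m" if "m < n" for m using that unfolding n_def by (rule not_less_Least)
      have "n \<noteq> 0" using n1 False by (cases "n = 0") (simp_all add: P_def)
      then obtain m where m: "n = Suc m" by (metis not0_implies_Suc)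
      let ?y = "x + of_int (- int n) *\<^sub>R v"
      have yv: "?y + v = x + of_int (- int m) *\<^sub>R v" by (simp add: m algebra_simps)
      have nX: "?y + v \<notin> X" unfolding yv using n2[of m] by (simp add: m P_def)
      \<comment> \<open>A vacant site on the half-space side occurs only in the inner cube, where
        the configuration is free.\<close>
      have "?y + v \<in> ?Q (T - 3)"
      proof (rule ccontr)
        assume "?y + v \<notin> ?Q (T - 3)"
        then have "?y + v \<in> X"
          unfolding yv by (subst X_iff[OF line[OF xL]]) (assumption, subst pos, simp)
        with nX show False ..
      qed
      then have "?y \<in> ?Q T" by (rule step) (simp add: v1)
      then show ?thesis using n1 nX unfolding P_def by blast
    next
      case True
      obtain n0 where n0: "\<forall>n\<ge>n0. x + (1 * real n) *\<^sub>R v \<notin> ?Q (T - 3)" using far[of 1 x] by auto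
      define P where "P n \<longleftrightarrow> x + of_int (int n) *\<^sub>R v \<notin> X" for n :: nat
      have "P (Suc n0)"
      proof -
        have "x + of_int (int (Suc n0)) *\<^sub>R v \<notin> ?Q (T - 3)" using n0[rule_format, of "Suc n0"] by simp
        from X_iff[OF line[OF xL] this] show ?thesis unfolding P_def pos by simp
      qed
      define n where "n = (LEAST n. P n)"
      have n1: "P n" unfolding n_def by (rule LeastI[of P, OF \<open>P (Suc n0)\<close>])
      have n2: "\<not> P m" if "m < n" for m using that unfolding n_def by (rule not_less_Least)
      have "n \<noteq> 0" using n1 True by (cases "n = 0") (simp_all add: P_def)
      then obtain m where m: "n = Suc m" by (metis not0_implies_Suc)
      let ?y = "x + of_int (int m) *\<^sub>R v"
      have yv: "?y + v = x + of_int (int n) *\<^sub>R v" by (simp add: m algebra_simps)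
      have nX: "?y + v \<notin> X" using n1 unfolding yv P_def .
      have yX: "?y \<in> X" using n2[of m] by (simp add: m P_def)
      have "?y \<in> ?Q T"
      \<comment> \<open>For \<open>m = 0\<close> the site is \<open>x\<close> itself. For larger
        \<open>m\<close> it is an occupied site beyond the crossing, so it lies in the inner
        cube.\<close>
      proof (cases "m = 0")
        case True
        then show ?thesis using xQ by simp
      next
        case False
        then have "\<not> 0 \<le> ?y \<bullet> \<nu>" using pos[of "int m"] by simp
        then have "?y \<in> ?Q (T - 3)" using X_iff[OF line[OF xL], of "int m"] yX by blast
        then show ?thesis using step[of ?y 0] by simp
      qed
      then show ?thesis using yX nX by blast
    qed
  qed
  define f where "f x = x + of_int (SOME k :: int. x + of_int k *\<^sub>R v \<in> {y \<in> X \<inter> ?Q T. y + v \<notin> X}) *\<^sub>R v" for x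
  have f: "f x \<in> {y \<in> X \<inter> ?Q T. y + v \<notin> X}" if "x \<in> {x \<in> ?H \<inter> ?Q T. x + v \<notin> ?H}" for x
    unfolding f_def using someI_ex[OF ex[OF that]] by simp
  show ?thesis
  proof (rule card_inj_on_le[of f])
    show "f ` {x \<in> ?H \<inter> ?Q T. x + v \<notin> ?H} \<subseteq> {y \<in> X \<inter> ?Q T. y + v \<notin> X}" using f by blast
    show "finite {y \<in> X \<inter> ?Q T. y + v \<notin> X}"
      by (rule finite_subset[OF _ finite_fcc_lattice_bounded[OF bounded_open_cube[OF B, of T]]]) (use XL in auto)
    \<comment> \<open>Points with the same image lie on one line of direction \<open>v\<close>, and
      such a line meets the layer of height \<open>h\<close> in a single site.\<close>
    show "inj_on f {x \<in> ?H \<inter> ?Q T. x + v \<notin> ?H}"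
    proof (rule inj_onI)
      fix x y assume xy: "x \<in> {x \<in> ?H \<inter> ?Q T. x + v \<notin> ?H}" "y \<in> {x \<in> ?H \<inter> ?Q T. x + v \<notin> ?H}" and "f x = f y"
      then obtain k l :: int where "x + of_int k *\<^sub>R v = y + of_int l *\<^sub>R v" unfolding f_def by blast
      then have eq: "x = y + of_int (l - k) *\<^sub>R v" by (simp add: algebra_simps)
      have "0 \<le> x \<bullet> \<nu>" "x \<bullet> \<nu> < h" "0 \<le> y \<bullet> \<nu>" "y \<bullet> \<nu> < h"
        using xy fcc_half_space_boundary[OF vL, of \<nu> "?Q T"] by (auto simp: h_def)
      moreover from this have h: "0 < h" by linarith
      moreover have "x \<bullet> \<nu> = y \<bullet> \<nu> - of_int (l - k) * h" unfolding eq by (simp add: h_def inner_add_left)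
      ultimately have "\<bar>of_int (l - k) * h\<bar> < 1 * h" by linarith
      then have "\<bar>real_of_int (l - k)\<bar> < 1" using h by (simp add: abs_mult)
      then have "l - k = 0" by linarith
      then show "x = y" using eq by simp
    qed
  qed
qed

text \<open>The half space minimises the bond count in all twelve directions at once, so the infimum
  is attained and equals a sum of layer counts.\<close>

lemma fcc_energy_minimum:
  assumes B: "orthonormal_basis_through \<nu> B"
  shows "(INF X\<in>admissible_configurations \<nu> B T. fcc_energy X (open_cube B T)) =
    (\<Sum>v\<in>fcc_shell. real (card {x \<in> fcc_lattice \<inter> open_cube B T. 0 \<le> x \<bullet> \<nu> \<and> x \<bullet> \<nu> < - (v \<bullet> \<nu>)}))"
proof -
  have H: "fcc_energy (fcc_half_space \<nu>) (open_cube B T) =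
    (\<Sum>v\<in>fcc_shell. real (card {x \<in> fcc_half_space \<nu> \<inter> open_cube B T. x + v \<notin> fcc_half_space \<nu>}))"
    by (rule fcc_energy_eq[OF _ bounded_open_cube[OF B]]) (auto simp: fcc_half_space_def)
  have "(INF X\<in>admissible_configurations \<nu> B T. fcc_energy X (open_cube B T)) = fcc_energy (fcc_half_space \<nu>) (open_cube B T)"
  proof (rule cInf_eq_minimum)
    show "fcc_energy (fcc_half_space \<nu>) (open_cube B T) \<in> (\<lambda>X. fcc_energy X (open_cube B T)) ` admissible_configurations \<nu> B T"
      using fcc_half_space_admissible by blast
    fix E assume "E \<in> (\<lambda>X. fcc_energy X (open_cube B T)) ` admissible_configurations \<nu> B T"
    then obtain X where X: "X \<in> admissible_configurations \<nu> B T" and E: "E = fcc_energy X (open_cube B T)" by blast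
    have "fcc_energy X (open_cube B T) = (\<Sum>v\<in>fcc_shell. real (card {x \<in> X \<inter> open_cube B T. x + v \<notin> X}))"
      using X by (intro fcc_energy_eq bounded_open_cube[OF B]) (auto simp: admissible_configurations_def)
    then show "fcc_energy (fcc_half_space \<nu>) (open_cube B T) \<le> E"
      unfolding E H using admissible_boundary_card_ge[OF B X] by (simp add: sum_mono)
  qed
  also have "\<dots> = (\<Sum>v\<in>fcc_shell. real (card {x \<in> fcc_lattice \<inter> open_cube B T. 0 \<le> x \<bullet> \<nu> \<and> x \<bullet> \<nu> < - (v \<bullet> \<nu>)}))"
    unfolding H by (intro sum.cong refl, subst fcc_half_space_boundary) (auto simp: fcc_shell_eq)
  finally show ?thesis .
qed

text \<open>The value \<open>1 / sqrt 2\<close> is the covolume of the lattice, the same for every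
  basis; dividing by it gives the factor \<open>sqrt 2\<close> in the layer counts.\<close>

definition is_fcc_basis :: "real ^ 3 \<Rightarrow> real ^ 3 \<Rightarrow> real ^ 3 \<Rightarrow> bool" where
  "is_fcc_basis a b c \<longleftrightarrow>
     (\<forall>x. x \<in> fcc_lattice \<longleftrightarrow> (\<exists>k l m :: int. x = of_int k *\<^sub>R a + of_int l *\<^sub>R b + of_int m *\<^sub>R c)) \<and>
     \<bar>det (vector [a, b, c] :: real ^ 3 ^ 3)\<bar> = 1 / sqrt 2"

lemma is_fcc_basis_standard: "is_fcc_basis fcc_basis1 fcc_basis2 fcc_basis3"
proof -
  have "det (vector [fcc_basis1, fcc_basis2, fcc_basis3] :: real ^ 3 ^ 3) = - (2 * (1 / sqrt 2) * ((1 / sqrt 2) * (1 / sqrt 2)))"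
    by (simp add: det_3 fcc_basis1_def fcc_basis2_def fcc_basis3_def)
  also have "\<dots> = - (1 / sqrt 2)" by simp
  finally show ?thesis by (simp add: is_fcc_basis_def fcc_lattice_def)
qed

lemma is_fcc_basis_change:
  assumes abc: "is_fcc_basis a b c"
    and fw: "\<And>k l m :: int. \<exists>k' l' m' :: int. of_int k *\<^sub>R a + of_int l *\<^sub>R b + of_int m *\<^sub>R c =
      of_int k' *\<^sub>R a' + of_int l' *\<^sub>R b' + of_int m' *\<^sub>R c'"
    and bw: "\<And>k l m :: int. \<exists>k' l' m' :: int. of_int k *\<^sub>R a' + of_int l *\<^sub>R b' + of_int m *\<^sub>R c' =
      of_int k' *\<^sub>R a + of_int l' *\<^sub>R b + of_int m' *\<^sub>R c"
    and det: "\<bar>det (vector [a', b', c'] :: real ^ 3 ^ 3)\<bar> = \<bar>det (vector [a, b, c] :: real ^ 3 ^ 3)\<bar>"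
  shows "is_fcc_basis a' b' c'"
  using abc fw bw det unfolding is_fcc_basis_def by metis

lemma is_fcc_basis_rotate:
  assumes "is_fcc_basis a b c"
  shows "is_fcc_basis b c a"
proof (rule is_fcc_basis_change[OF assms])
  show "\<exists>k' l' m' :: int. of_int k *\<^sub>R a + of_int l *\<^sub>R b + of_int m *\<^sub>R c =
      of_int k' *\<^sub>R b + of_int l' *\<^sub>R c + of_int m' *\<^sub>R a" for k l m :: int
    by (intro exI[of _ l] exI[of _ m] exI[of _ k]) simp
  show "\<exists>k' l' m' :: int. of_int k *\<^sub>R b + of_int l *\<^sub>R c + of_int m *\<^sub>R a =
      of_int k' *\<^sub>R a + of_int l' *\<^sub>R b + of_int m' *\<^sub>R c" for k l m :: int
    by (intro exI[of _ m] exI[of _ k] exI[of _ l]) simp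
qed (simp add: det_3 algebra_simps)

lemma is_fcc_basis_uminus:
  assumes "is_fcc_basis a b c"
  shows "is_fcc_basis a b (- c)"
proof (rule is_fcc_basis_change[OF assms])
  show "\<exists>k' l' m' :: int. of_int k *\<^sub>R a + of_int l *\<^sub>R b + of_int m *\<^sub>R c =
      of_int k' *\<^sub>R a + of_int l' *\<^sub>R b + of_int m' *\<^sub>R (- c)" for k l m :: int
    by (intro exI[of _ k] exI[of _ l] exI[of _ "- m"]) simp
  show "\<exists>k' l' m' :: int. of_int k *\<^sub>R a + of_int l *\<^sub>R b + of_int m *\<^sub>R (- c) =
      of_int k' *\<^sub>R a + of_int l' *\<^sub>R b + of_int m' *\<^sub>R c" for k l m :: int
    by (intro exI[of _ k] exI[of _ l] exI[of _ "- m"]) simp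
  have "det (vector [a, b, - c] :: real ^ 3 ^ 3) = - det (vector [a, b, c] :: real ^ 3 ^ 3)"
    by (simp add: det_3 algebra_simps)
  then show "\<bar>det (vector [a, b, - c] :: real ^ 3 ^ 3)\<bar> = \<bar>det (vector [a, b, c] :: real ^ 3 ^ 3)\<bar>" by simp
qed

lemma is_fcc_basis_diff:
  assumes "is_fcc_basis a b c"
  shows "is_fcc_basis a b (c - a)" "is_fcc_basis a b (c - b)"
proof -
  show "is_fcc_basis a b (c - a)"
  proof (rule is_fcc_basis_change[OF assms])
    show "\<exists>k' l' m' :: int. of_int k *\<^sub>R a + of_int l *\<^sub>R b + of_int m *\<^sub>R c =
        of_int k' *\<^sub>R a + of_int l' *\<^sub>R b + of_int m' *\<^sub>R (c - a)" for k l m :: int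
      by (intro exI[of _ "k + m"] exI[of _ l] exI[of _ m]) (simp add: algebra_simps)
    show "\<exists>k' l' m' :: int. of_int k *\<^sub>R a + of_int l *\<^sub>R b + of_int m *\<^sub>R (c - a) =
        of_int k' *\<^sub>R a + of_int l' *\<^sub>R b + of_int m' *\<^sub>R c" for k l m :: int
      by (intro exI[of _ "k - m"] exI[of _ l] exI[of _ m]) (simp add: algebra_simps)
  qed (simp add: det_3 algebra_simps)
  show "is_fcc_basis a b (c - b)"
  proof (rule is_fcc_basis_change[OF assms])
    show "\<exists>k' l' m' :: int. of_int k *\<^sub>R a + of_int l *\<^sub>R b + of_int m *\<^sub>R c =
        of_int k' *\<^sub>R a + of_int l' *\<^sub>R b + of_int m' *\<^sub>R (c - b)" for k l m :: int
      by (intro exI[of _ k] exI[of _ "l + m"] exI[of _ m]) (simp add: algebra_simps)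
    show "\<exists>k' l' m' :: int. of_int k *\<^sub>R a + of_int l *\<^sub>R b + of_int m *\<^sub>R (c - b) =
        of_int k' *\<^sub>R a + of_int l' *\<^sub>R b + of_int m' *\<^sub>R c" for k l m :: int
      by (intro exI[of _ k] exI[of _ "l - m"] exI[of _ m]) (simp add: algebra_simps)
  qed (simp add: det_3 algebra_simps)
qed

text \<open>The layer count requires the bond direction as last vector of a lattice basis. Up to
  sign, every bond is a standard basis vector or a difference of two, and both are reached by
  rotating the basis and subtracting one member from another.\<close>

lemma fcc_shell_basis:
  assumes "v \<in> fcc_shell"
  shows "\<exists>a b. is_fcc_basis a b v"
proof -
  note s = is_fcc_basis_standard
  have pt: "fcc_point (1, 1, 0) = fcc_basis1" "fcc_point (1, 0, 1) = fcc_basis2" "fcc_point (0, 1, 1) = fcc_basis3"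
    "fcc_point (0, 1, -1) = fcc_basis1 - fcc_basis2" "fcc_point (1, 0, -1) = fcc_basis1 - fcc_basis3"
    "fcc_point (1, -1, 0) = fcc_basis2 - fcc_basis3"
    "fcc_point (-1, -1, 0) = - fcc_basis1" "fcc_point (-1, 0, -1) = - fcc_basis2" "fcc_point (0, -1, -1) = - fcc_basis3"
    "fcc_point (0, -1, 1) = - (fcc_basis1 - fcc_basis2)" "fcc_point (-1, 0, 1) = - (fcc_basis1 - fcc_basis3)"
    "fcc_point (-1, 1, 0) = - (fcc_basis2 - fcc_basis3)"
    by (simp_all add: vec_eq_iff forall_3 fcc_point_nth fcc_basis1_def fcc_basis2_def fcc_basis3_def)
  have bases: "is_fcc_basis fcc_basis2 fcc_basis3 fcc_basis1" "is_fcc_basis fcc_basis3 fcc_basis1 fcc_basis2"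
    using s is_fcc_basis_rotate by blast+
  have "\<exists>a b. is_fcc_basis a b w" if "w \<in> {fcc_basis1, fcc_basis2, fcc_basis3, fcc_basis1 - fcc_basis2,
      fcc_basis1 - fcc_basis3, fcc_basis2 - fcc_basis3}" for w
    using that s bases is_fcc_basis_diff[OF bases(1)] is_fcc_basis_diff[OF bases(2)] by blast
  then have "\<exists>a b. is_fcc_basis a b w" "\<exists>a b. is_fcc_basis a b (- w)"
    if "w \<in> {fcc_basis1, fcc_basis2, fcc_basis3, fcc_basis1 - fcc_basis2,
      fcc_basis1 - fcc_basis3, fcc_basis2 - fcc_basis3}" for w
    using that is_fcc_basis_uminus by blast+
  moreover have "v \<in> {fcc_basis1, fcc_basis2, fcc_basis3, fcc_basis1 - fcc_basis2,
      fcc_basis1 - fcc_basis3, fcc_basis2 - fcc_basis3} \<union> uminus ` {fcc_basis1, fcc_basis2, fcc_basis3, fcc_basis1 - fcc_basis2,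
      fcc_basis1 - fcc_basis3, fcc_basis2 - fcc_basis3}"
    using assms unfolding fcc_shell_def fcc_shell_coords_def image_insert image_empty pt by blast
  ultimately show ?thesis by blast
qed

lemma fcc_layer_count_limit:
  assumes B: "orthonormal_basis_through \<nu> B" and v: "v \<in> fcc_shell"
  shows "((\<lambda>T. real (card {x \<in> fcc_lattice \<inter> open_cube B T. 0 \<le> x \<bullet> \<nu> \<and> x \<bullet> \<nu> < - (v \<bullet> \<nu>)}) / T\<^sup>2)
    \<longlongrightarrow> sqrt 2 * max 0 (- (v \<bullet> \<nu>))) at_top"
proof (cases "0 < - (v \<bullet> \<nu>)")
  case True
  obtain a b where ab: "is_fcc_basis a b v" using fcc_shell_basis[OF v] by blast
  have "((\<lambda>T. real (card {x \<in> fcc_lattice \<inter> open_cube B T. 0 \<le> x \<bullet> \<nu> \<and> x \<bullet> \<nu> < - (v \<bullet> \<nu>)}) / T\<^sup>2)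
    \<longlongrightarrow> - (v \<bullet> \<nu>) / (1 / sqrt 2)) at_top"
  proof (rule lattice_layer_count_limit[OF _ _ _ B refl True])
    show "x \<in> fcc_lattice \<longleftrightarrow> (\<exists>k l m :: int. x = of_int k *\<^sub>R a + of_int l *\<^sub>R b + of_int m *\<^sub>R v)" for x
      using ab unfolding is_fcc_basis_def by blast
    show "1 / sqrt 2 = \<bar>det (vector [a, b, v] :: real ^ 3 ^ 3)\<bar>" using ab by (simp add: is_fcc_basis_def)
    show "finite (fcc_lattice \<inter> open_cube B T)" for T
      by (rule finite_fcc_lattice_bounded[OF bounded_open_cube[OF B]])
  qed simp
  then show ?thesis using True by (simp add: mult.commute)
next
  case False
  then have "{x \<in> fcc_lattice \<inter> open_cube B T. 0 \<le> x \<bullet> \<nu> \<and> x \<bullet> \<nu> < - (v \<bullet> \<nu>)} = {}" for T by auto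
  note empty = this
  show ?thesis unfolding empty using False by simp
qed

section \<open>The explicit density\<close>

definition fcc_density :: "real ^ 3 \<Rightarrow> real" where
  "fcc_density \<nu> = \<bar>\<nu> $ 1 + \<nu> $ 2\<bar> + \<bar>\<nu> $ 1 + \<nu> $ 3\<bar> + \<bar>\<nu> $ 2 + \<nu> $ 3\<bar> +
     \<bar>\<nu> $ 1 - \<nu> $ 2\<bar> + \<bar>\<nu> $ 1 - \<nu> $ 3\<bar> + \<bar>\<nu> $ 2 - \<nu> $ 3\<bar>"

text \<open>Only one of two opposite bonds has a positive layer height, so the pair contributes
  \<open>sqrt 2 * \<bar>v \<bullet> \<nu>\<bar>\<close>. The factor \<open>sqrt 2\<close> cancels
  the scaling of the lattice and leaves one absolute value for each of the six pairs.\<close>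

lemma sum_fcc_shell: "(\<Sum>v\<in>fcc_shell. sqrt 2 * max 0 (- (v \<bullet> \<nu>))) = fcc_density \<nu>"
proof -
  define F where "F t = sqrt 2 * max 0 (- (fcc_point t \<bullet> \<nu>))" for t
  have inner: "sqrt 2 * (fcc_point (p, q, r) \<bullet> \<nu>) = of_int p * \<nu> $ 1 + of_int q * \<nu> $ 2 + of_int r * \<nu> $ 3" for p q r
    by (simp add: inner_vec_def sum_3 fcc_point_nth field_simps)
  have pair: "F (p, q, r) + F (- p, - q, - r) = \<bar>of_int p * \<nu> $ 1 + of_int q * \<nu> $ 2 + of_int r * \<nu> $ 3\<bar>" for p q r
  proof -
    have "fcc_point (- p, - q, - r) = - fcc_point (p, q, r)" by (simp add: vec_eq_iff forall_3 fcc_point_nth)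
    then have "F (p, q, r) + F (- p, - q, - r) = sqrt 2 * \<bar>fcc_point (p, q, r) \<bullet> \<nu>\<bar>"
      by (simp add: F_def max_def abs_if)
    also have "\<dots> = \<bar>sqrt 2 * (fcc_point (p, q, r) \<bullet> \<nu>)\<bar>" by (simp add: abs_mult)
    finally show ?thesis by (simp only: inner)
  qed
  have "(\<Sum>v\<in>fcc_shell. sqrt 2 * max 0 (- (v \<bullet> \<nu>))) = sum F fcc_shell_coords"
    unfolding fcc_shell_def F_def by (subst sum.reindex) (auto intro: inj_on_subset[OF inj_fcc_point])
  also have "\<dots> = F (1, 1, 0) + F (- 1, - 1, 0) + (F (1, 0, 1) + F (- 1, 0, - 1)) + (F (0, 1, 1) + F (0, - 1, - 1))
    + (F (1, - 1, 0) + F (- 1, 1, 0)) + (F (1, 0, - 1) + F (- 1, 0, 1)) + (F (0, 1, - 1) + F (0, - 1, 1))"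
    by (simp add: fcc_shell_coords_def)
  also have "\<dots> = fcc_density \<nu>"
    using pair[of 1 1 0] pair[of 1 0 1] pair[of 0 1 1] pair[of 1 "- 1" 0] pair[of 1 0 "- 1"] pair[of 0 1 "- 1"]
    by (simp add: fcc_density_def)
  finally show ?thesis .
qed

lemma convex_on_abs_linear:
  fixes f :: "'a::real_vector \<Rightarrow> real"
  assumes "linear f"
  shows "convex_on UNIV (\<lambda>x. \<bar>f x\<bar>)"
proof (rule convex_onI)
  fix t :: real and x y :: 'a assume t: "0 < t" "t < 1"
  have "\<bar>f ((1 - t) *\<^sub>R x + t *\<^sub>R y)\<bar> = \<bar>(1 - t) * f x + t * f y\<bar>"
    by (simp add: linear_add[OF assms] linear_scale[OF assms])
  also have "\<dots> \<le> \<bar>(1 - t) * f x\<bar> + \<bar>t * f y\<bar>" by (rule abs_triangle_ineq)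
  also have "\<dots> = (1 - t) * \<bar>f x\<bar> + t * \<bar>f y\<bar>" using t by (simp add: abs_mult)
  finally show "\<bar>f ((1 - t) *\<^sub>R x + t *\<^sub>R y)\<bar> \<le> (1 - t) * \<bar>f x\<bar> + t * \<bar>f y\<bar>" .
qed simp

lemma fcc_density_scaleR: "fcc_density (t *\<^sub>R \<nu>) = \<bar>t\<bar> * fcc_density \<nu>"
  by (simp only: fcc_density_def vector_scaleR_component real_scaleR_def abs_mult
      distrib_left[symmetric] right_diff_distrib[symmetric])

lemma is_fcc_surface_density_fcc_density: "is_fcc_surface_density fcc_density"
  unfolding is_fcc_surface_density_def
proof (intro conjI allI impI)
  show "convex_on UNIV fcc_density"
    unfolding fcc_density_def[abs_def]
    by (intro convex_on_add convex_on_abs_linear) (auto intro!: linearI simp: algebra_simps)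
  show "0 \<le> fcc_density \<nu>" for \<nu> by (simp add: fcc_density_def)
  show "fcc_density (t *\<^sub>R \<nu>) = t * fcc_density \<nu>" if "0 \<le> t" for \<nu> t using that by (simp add: fcc_density_scaleR)
  fix \<nu> B assume "norm \<nu> = 1 \<and> orthonormal_basis_through \<nu> B"
  then have B: "orthonormal_basis_through \<nu> B" by simp
  have "((\<lambda>T. \<Sum>v\<in>fcc_shell. real (card {x \<in> fcc_lattice \<inter> open_cube B T. 0 \<le> x \<bullet> \<nu> \<and> x \<bullet> \<nu> < - (v \<bullet> \<nu>)}) / T\<^sup>2)
    \<longlongrightarrow> (\<Sum>v\<in>fcc_shell. sqrt 2 * max 0 (- (v \<bullet> \<nu>)))) at_top"
    by (intro tendsto_sum fcc_layer_count_limit[OF B])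
  then show "((\<lambda>T. 1 / T\<^sup>2 * (INF X\<in>admissible_configurations \<nu> B T. fcc_energy X (open_cube B T)))
          \<longlongrightarrow> fcc_density \<nu>) at_top"
    by (simp add: fcc_energy_minimum[OF B] sum_fcc_shell sum_divide_distrib)
qed

lemma orthonormal_basis_through_exists:
  assumes "norm \<nu> = 1"
  shows "\<exists>B. orthonormal_basis_through \<nu> B"
proof -
  obtain R :: "real ^ 3 \<Rightarrow> real ^ 3" where R: "orthogonal_transformation R" "R (axis 1 1) = \<nu>"
    using orthogonal_transformation_exists_1[of "axis 1 1" \<nu>] assms by auto
  have inner: "R x \<bullet> R y = x \<bullet> y" for x y using R(1) by (simp add: orthogonal_transformation_def)
  have inj: "inj (\<lambda>i. R (axis i 1))"
  proof (rule injI)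
    fix i j :: 3 assume "R (axis i 1) = R (axis j 1)"
    then have "axis i 1 = (axis j 1 :: real ^ 3)" using orthogonal_transformation_inj[OF R(1)] by (rule injD[rotated])
    then show "i = j" by (simp add: axis_eq_axis)
  qed
  let ?B = "range (\<lambda>i. R (axis i 1))"
  have "\<nu> \<in> ?B" using R(2) by blast
  moreover have "card ?B = 3" using card_image[OF inj] by simp
  moreover have "pairwise orthogonal ?B"
    by (auto simp: pairwise_def orthogonal_def inner inner_axis_axis)
  moreover have "norm b = 1" if "b \<in> ?B" for b
    using that orthogonal_transformation_norm[OF R(1)] by auto
  ultimately have "orthonormal_basis_through \<nu> ?B"
    unfolding orthonormal_basis_through_def by (intro conjI ballI)
  then show ?thesis by (rule exI)
qed

text \<open>The description by \<open>THE\<close> needs uniqueness: the limit fixes the values on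
  the unit sphere, provided that some orthonormal basis exists there, and homogeneity fixes all
  others, including 0 at the origin.\<close>

theorem phi_FCC_eq: "phi_FCC = fcc_density"
  unfolding phi_FCC_def
proof (rule the_equality[where P = is_fcc_surface_density and a = fcc_density])
  show "is_fcc_surface_density fcc_density" by (rule is_fcc_surface_density_fcc_density)
  fix \<phi> assume \<phi>: "is_fcc_surface_density \<phi>"
  note homog = \<phi>[unfolded is_fcc_surface_density_def, THEN conjunct2, THEN conjunct2, THEN conjunct1, rule_format]
  note lim = \<phi>[unfolded is_fcc_surface_density_def, THEN conjunct2, THEN conjunct2, THEN conjunct2, rule_format]
  note lim' = is_fcc_surface_density_fcc_density[unfolded is_fcc_surface_density_def, THEN conjunct2, THEN conjunct2, THEN conjunct2, rule_format]
  show "\<phi> = fcc_density"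
  proof
    fix \<nu>
    show "\<phi> \<nu> = fcc_density \<nu>"
    proof (cases "\<nu> = 0")
      case True
      then show ?thesis using homog[of 0 0] by (simp add: fcc_density_def)
    next
      case False
      define u where "u = (1 / norm \<nu>) *\<^sub>R \<nu>"
      have u: "norm u = 1" "\<nu> = norm \<nu> *\<^sub>R u" using False by (simp_all add: u_def)
      obtain B where B: "orthonormal_basis_through u B" using orthonormal_basis_through_exists[OF u(1)] by blast
      have "\<phi> u = fcc_density u"
        using tendsto_unique[OF _ lim lim'] u(1) B by (metis trivial_limit_at_top_linorder)
      then show ?thesis
        using homog[of "norm \<nu>" u] fcc_density_scaleR[of "norm \<nu>" u] u(2) by simp
    qed
  qed
qed

section \<open>The polar function and the Wulff set\<close>

lemma fcc_density_max:
  "fcc_density \<nu> = 2 * (max \<bar>\<nu> $ 1\<bar> \<bar>\<nu> $ 2\<bar> + max \<bar>\<nu> $ 1\<bar> \<bar>\<nu> $ 3\<bar> + max \<bar>\<nu> $ 2\<bar> \<bar>\<nu> $ 3\<bar>)"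
proof -
  have "\<bar>a + b\<bar> + \<bar>a - b\<bar> = 2 * max \<bar>a\<bar> \<bar>b\<bar>" for a b :: real by (simp add: abs_if max_def)
  from this[of "\<nu> $ 1" "\<nu> $ 2"] this[of "\<nu> $ 1" "\<nu> $ 3"] this[of "\<nu> $ 2" "\<nu> $ 3"]
  show ?thesis by (simp add: fcc_density_def)
qed

text \<open>Summation by parts against the decreasing rearrangement of the first factors.\<close>

lemma abel_summation_bound:
  fixes a b c x y z M :: real
  assumes "0 \<le> a" "0 \<le> b" "0 \<le> c" "x \<le> 4 * M" "y \<le> 4 * M" "z \<le> 4 * M" "0 \<le> x" "0 \<le> y" "0 \<le> z" "x + y + z \<le> 6 * M"
  shows "a * x + b * y + c * z \<le> 2 * M * (max a b + max a c + max b c)"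
proof -
  have sorted: "a * x + b * y + c * z \<le> 2 * M * (2 * a + b)"
    if "c \<le> b" "b \<le> a" "0 \<le> c" "x \<le> 4 * M" "0 \<le> z" "x + y + z \<le> 6 * M" for a b c x y z :: real
  proof -
    \<comment> \<open>The partial sums \<open>x\<close>, \<open>x + y\<close> and
      \<open>x + y + z\<close> are bounded by \<open>4 * M\<close>, \<open>6 * M\<close> and
      \<open>6 * M\<close>, the second because \<open>0 \<le> z\<close>. With these weights the
      bounds add up to \<open>4 * M * a + 2 * M * b\<close>.\<close>
    have "(a - b) * x \<le> (a - b) * (4 * M)" "(b - c) * (x + y) \<le> (b - c) * (6 * M)" "c * (x + y + z) \<le> c * (6 * M)"
      using that by (auto intro!: mult_left_mono)
    then show ?thesis by (simp add: algebra_simps)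
  qed
  consider "c \<le> b" "b \<le> a" | "b \<le> c" "c \<le> a" | "c \<le> a" "a \<le> b" | "a \<le> c" "c \<le> b" | "b \<le> a" "a \<le> c" | "a \<le> b" "b \<le> c"
    by linarith
  then show ?thesis
  proof cases
    case 1
    then have "max a b = a" "max a c = a" "max b c = b" by simp_all
    then show ?thesis using 1 sorted[of c b a x z y] assms by (simp add: algebra_simps)
  next
    case 2
    then have "max a b = a" "max a c = a" "max b c = c" by simp_all
    then show ?thesis using 2 sorted[of b c a x y z] assms by (simp add: algebra_simps)
  next
    case 3
    then have "max a b = b" "max a c = a" "max b c = b" by simp_all
    then show ?thesis using 3 sorted[of c a b y z x] assms by (simp add: algebra_simps)
  next
    case 4
    then have "max a b = b" "max a c = c" "max b c = b" by simp_all
    then show ?thesis using 4 sorted[of a c b y x z] assms by (simp add: algebra_simps)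
  next
    case 5
    then have "max a b = a" "max a c = c" "max b c = c" by simp_all
    then show ?thesis using 5 sorted[of b a c z y x] assms by (simp add: algebra_simps)
  next
    case 6
    then have "max a b = b" "max a c = c" "max b c = c" by simp_all
    then show ?thesis using 6 sorted[of a b c z x y] assms by (simp add: algebra_simps)
  qed
qed

lemma inner_le_fcc_density:
  fixes \<nu> \<zeta> :: "real ^ 3"
  assumes "\<And>i. \<bar>\<zeta> $ i\<bar> \<le> 4 * M" "\<bar>\<zeta> $ 1\<bar> + \<bar>\<zeta> $ 2\<bar> + \<bar>\<zeta> $ 3\<bar> \<le> 6 * M"
  shows "\<nu> \<bullet> \<zeta> \<le> M * fcc_density \<nu>"
proof -
  have "\<nu> \<bullet> \<zeta> \<le> \<bar>\<nu> $ 1\<bar> * \<bar>\<zeta> $ 1\<bar> + \<bar>\<nu> $ 2\<bar> * \<bar>\<zeta> $ 2\<bar> + \<bar>\<nu> $ 3\<bar> * \<bar>\<zeta> $ 3\<bar>"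
    unfolding inner_vec_def sum_3 abs_mult[symmetric] by (intro add_mono) auto
  also have "\<dots> \<le> 2 * M * (max \<bar>\<nu> $ 1\<bar> \<bar>\<nu> $ 2\<bar> + max \<bar>\<nu> $ 1\<bar> \<bar>\<nu> $ 3\<bar> + max \<bar>\<nu> $ 2\<bar> \<bar>\<nu> $ 3\<bar>)"
    by (rule abel_summation_bound) (use assms in auto)
  finally show ?thesis by (simp add: fcc_density_max mult_ac)
qed

lemma fcc_density_pos: "\<nu> \<noteq> 0 \<Longrightarrow> 0 < fcc_density \<nu>"
  by (auto simp: fcc_density_max vec_eq_iff forall_3 max_def)

text \<open>Zero entries receive the sign 1, so that all entries have modulus 1 and the vector is
  always normal to a hexagonal facet.\<close>

definition sign_vector :: "real ^ 3 \<Rightarrow> real ^ 3" where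
  "sign_vector x = (\<chi> i. if 0 \<le> x $ i then 1 else - 1)"

lemma sign_vector: "sign_vector x \<bullet> x = \<bar>x $ 1\<bar> + \<bar>x $ 2\<bar> + \<bar>x $ 3\<bar>" "\<bar>sign_vector x $ i\<bar> = 1"
  by (simp_all add: sign_vector_def inner_vec_def sum_3)

lemma norm_signs:
  fixes s :: "real ^ 3"
  assumes "\<And>i. \<bar>s $ i\<bar> = 1"
  shows "norm s = sqrt 3" "fcc_density s = 6"
proof -
  have "(s $ i)\<^sup>2 = 1" for i using assms[of i] by (simp add: abs_square_eq_1)
  then show "norm s = sqrt 3" by (simp add: norm_vec_def L2_set_def sum_3)
  show "fcc_density s = 6" by (simp add: fcc_density_max assms)
qed

lemma fcc_density_axis: "fcc_density (axis i s) = 4 * \<bar>s\<bar>"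
proof -
  have "i = 1 \<or> i = 2 \<or> i = 3" by (rule exhaust_3)
  then show ?thesis by (auto simp: fcc_density_max axis_def)
qed

lemma norm_axis_real: "norm (axis i s :: real ^ 'n) = \<bar>s\<bar>"
  by (simp add: norm_eq_sqrt_inner inner_axis_axis)

lemma infnorm_3: "infnorm (x :: real ^ 3) = max \<bar>x $ 1\<bar> (max \<bar>x $ 2\<bar> \<bar>x $ 3\<bar>)"
proof -
  have B: "(Basis :: (real ^ 3) set) = {axis 1 1, axis 2 1, axis 3 1}"
    by (auto simp: Basis_vec_def) (metis exhaust_3)
  show ?thesis unfolding infnorm_Max B by (simp add: inner_axis)
qed

text \<open>\<open>inner_le_fcc_density\<close> with the claimed value as \<open>M\<close> is the
  upper bound. It is attained at a signed axis vector, of density 4, if the max-norm term is larger,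
  and otherwise at the normalised sign vector, whose unscaled density is 6.\<close>

theorem polar_function_fcc_density:
  "polar_function fcc_density \<zeta> = max (1 / 4 * infnorm \<zeta>) (1 / 6 * (\<Sum>i\<in>UNIV. \<bar>\<zeta> $ i\<bar>))" (is "_ = ?M")
  unfolding polar_function_def
proof (rule cSup_eq_maximum)
  have inf: "\<bar>\<zeta> $ i\<bar> \<le> 4 * ?M" for i
  proof -
    have "\<bar>\<zeta> $ i\<bar> \<le> infnorm \<zeta>" by (rule component_le_infnorm_cart)
    also have "\<dots> \<le> 4 * ?M" by simp
    finally show ?thesis .
  qed
  have "S \<le> 6 * M" if "1 / 6 * S \<le> M" for S M :: real using that by simp
  from this[OF max.cobounded2[of "1 / 6 * (\<Sum>i\<in>UNIV. \<bar>\<zeta> $ i\<bar>)" "1 / 4 * infnorm \<zeta>"]]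
  have one: "\<bar>\<zeta> $ 1\<bar> + \<bar>\<zeta> $ 2\<bar> + \<bar>\<zeta> $ 3\<bar> \<le> 6 * ?M" unfolding sum_3 .
  show "y \<le> ?M" if "y \<in> (\<lambda>\<nu>. \<nu> \<bullet> \<zeta> / fcc_density \<nu>) ` sphere 0 1" for y
  proof -
    obtain \<nu> where \<nu>: "\<nu> \<in> sphere 0 1" "y = \<nu> \<bullet> \<zeta> / fcc_density \<nu>" using \<open>y \<in> _\<close> by blast
    have "\<nu> \<noteq> 0" using \<nu>(1) by auto
    then show ?thesis
      using inner_le_fcc_density[OF inf one, of \<nu>] fcc_density_pos[of \<nu>] by (simp add: \<nu>(2) pos_divide_le_eq)
  qed
  show "?M \<in> (\<lambda>\<nu>. \<nu> \<bullet> \<zeta> / fcc_density \<nu>) ` sphere 0 1"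
  proof (cases "1 / 6 * (\<Sum>i\<in>UNIV. \<bar>\<zeta> $ i\<bar>) \<le> 1 / 4 * infnorm \<zeta>")
    case True
    have "infnorm \<zeta> = \<bar>\<zeta> $ 1\<bar> \<or> infnorm \<zeta> = \<bar>\<zeta> $ 2\<bar> \<or> infnorm \<zeta> = \<bar>\<zeta> $ 3\<bar>"
      by (simp add: infnorm_3 max_def)
    then obtain i where i: "infnorm \<zeta> = \<bar>\<zeta> $ i\<bar>" by blast
    define s :: real where "s = (if 0 \<le> \<zeta> $ i then 1 else - 1)"
    have "axis i s \<bullet> \<zeta> = \<bar>\<zeta> $ i\<bar>" "\<bar>s\<bar> = 1" by (simp_all add: inner_axis' s_def)
    then have "axis i s \<bullet> \<zeta> / fcc_density (axis i s) = 1 / 4 * infnorm \<zeta>" by (simp add: fcc_density_axis i)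
    also have "\<dots> = ?M" using True by (rule max_absorb1[symmetric])
    finally have "axis i s \<bullet> \<zeta> / fcc_density (axis i s) = ?M" .
    moreover have "axis i s \<in> sphere 0 1" by (simp add: s_def norm_axis_real)
    ultimately show ?thesis by (rule image_eqI[OF sym])
  next
    case False
    let ?u = "(1 / sqrt 3) *\<^sub>R sign_vector \<zeta>"
    have "?u \<bullet> \<zeta> / fcc_density ?u = 1 / 6 * (\<Sum>i\<in>UNIV. \<bar>\<zeta> $ i\<bar>)"
      by (simp add: fcc_density_scaleR norm_signs(2) sign_vector sum_3)
    also have "\<dots> = ?M" using False by (intro max_absorb2[symmetric]) simp
    finally have "?u \<bullet> \<zeta> / fcc_density ?u = ?M" .
    moreover have "?u \<in> sphere 0 1" by (simp add: norm_signs(1) sign_vector(2))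
    ultimately show ?thesis by (rule image_eqI[OF sym])
  qed
qed

section \<open>The Wulff set as a polytope with six square and eight hexagonal facets\<close>

definition fcc_wulff_normals :: "(real ^ 3) set" where
  "fcc_wulff_normals = {axis i s | i s. \<bar>s\<bar> = 1} \<union> {(1 / sqrt 3) *\<^sub>R s | s. \<forall>i. \<bar>s $ i\<bar> = 1}"

lemma fcc_wulff_normals_unit: "n \<in> fcc_wulff_normals \<Longrightarrow> norm n = 1"
  by (auto simp: fcc_wulff_normals_def norm_signs norm_axis_real)

definition fcc_wulff :: "(real ^ 3) set" where
  "fcc_wulff = {x. (\<forall>i. \<bar>x $ i\<bar> \<le> 4) \<and> \<bar>x $ 1\<bar> + \<bar>x $ 2\<bar> + \<bar>x $ 3\<bar> \<le> 6}"

text \<open>The axis normals give the coordinate bounds, and the normalised sign vector of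
  \<open>x\<close> itself gives the bound on the sum of moduli. The converse is
  \<open>inner_le_fcc_density\<close> with \<open>M = 1\<close>.\<close>

lemma fcc_wulff_eq_normals: "fcc_wulff = {x. \<forall>n\<in>fcc_wulff_normals. x \<bullet> n \<le> fcc_density n}"
proof (intro equalityI subsetI CollectI ballI)
  fix x n assume "x \<in> fcc_wulff"
  then show "x \<bullet> n \<le> fcc_density n"
    using inner_le_fcc_density[of x 1 n] by (simp add: fcc_wulff_def inner_commute)
next
  fix x :: "real ^ 3" assume x: "x \<in> {x. \<forall>n\<in>fcc_wulff_normals. x \<bullet> n \<le> fcc_density n}"
  have "\<bar>x $ i\<bar> \<le> 4" for i
  proof -
    have "axis i 1 \<in> fcc_wulff_normals" "axis i (- 1) \<in> fcc_wulff_normals"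
      unfolding fcc_wulff_normals_def by force+
    then have "x \<bullet> axis i 1 \<le> 4" "x \<bullet> axis i (- 1) \<le> 4" using x by (auto simp: fcc_density_axis)
    then show ?thesis by (simp add: inner_axis)
  qed
  moreover have "\<bar>x $ 1\<bar> + \<bar>x $ 2\<bar> + \<bar>x $ 3\<bar> \<le> 6"
  proof -
    have "(1 / sqrt 3) *\<^sub>R sign_vector x \<in> fcc_wulff_normals"
      unfolding fcc_wulff_normals_def using sign_vector(2) by blast
    then have "x \<bullet> ((1 / sqrt 3) *\<^sub>R sign_vector x) \<le> fcc_density ((1 / sqrt 3) *\<^sub>R sign_vector x)" using x by blast
    then have "(1 / sqrt 3) * (sign_vector x \<bullet> x) \<le> (1 / sqrt 3) * 6"
      by (simp only: fcc_density_scaleR norm_signs(2) sign_vector(2) inner_scaleR_right inner_commute[of x]) simp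
    then show ?thesis by (simp add: sign_vector(1) divide_le_cancel)
  qed
  ultimately show "x \<in> fcc_wulff" by (simp add: fcc_wulff_def)
qed

lemma wulff_set_fcc_density: "wulff_set fcc_density = fcc_wulff"
proof (intro equalityI subsetI)
  fix x assume "x \<in> wulff_set fcc_density"
  then show "x \<in> fcc_wulff" unfolding fcc_wulff_eq_normals by (auto simp: wulff_set_def fcc_wulff_normals_unit)
next
  fix x assume "x \<in> fcc_wulff"
  then show "x \<in> wulff_set fcc_density"
    using inner_le_fcc_density[of x 1] by (auto simp: fcc_wulff_def wulff_set_def inner_commute)
qed

lemma finite_fcc_wulff_normals: "finite fcc_wulff_normals"
proof -
  have "fcc_wulff_normals \<subseteq> (\<lambda>(a, b, c). vector [a, b, c]) `
    ({-1, 0, 1, 1 / sqrt 3, - 1 / sqrt 3} \<times> {-1, 0, 1, 1 / sqrt 3, - 1 / sqrt 3} \<times> {-1, 0, 1, 1 / sqrt 3, - 1 / sqrt 3})"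
    (is "_ \<subseteq> ?f ` (?A \<times> ?A \<times> ?A)")
  proof
    fix n assume n: "n \<in> fcc_wulff_normals"
    have "n $ i \<in> ?A" for i
      using n by (auto simp: fcc_wulff_normals_def axis_def abs_if split: if_splits)
        (metis (no_types, opaque_lifting) abs_if minus_minus minus_divide_left)
    then have "(n $ 1, n $ 2, n $ 3) \<in> ?A \<times> ?A \<times> ?A" by blast
    moreover have "n = ?f (n $ 1, n $ 2, n $ 3)" by (simp add: vec_eq_iff forall_3)
    ultimately show "n \<in> ?f ` (?A \<times> ?A \<times> ?A)" by (rule rev_image_eqI)
  qed
  then show ?thesis by (rule finite_subset) auto
qed

lemma bounded_fcc_wulff: "bounded fcc_wulff"
proof -
  have "norm x \<le> 6" if "x \<in> fcc_wulff" for x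
    using norm_le_l1_cart[of x] that by (simp add: fcc_wulff_def sum_3)
  then show ?thesis unfolding bounded_iff by blast
qed

interpretation fcc: bounded_polytope3 fcc_wulff_normals fcc_density fcc_wulff
proof unfold_locales
  show "fcc_wulff \<equiv> {x. \<forall>n\<in>fcc_wulff_normals. x \<bullet> n \<le> fcc_density n}"
    using fcc_wulff_eq_normals by (rule eq_reflection)
  show "finite fcc_wulff_normals" by (rule finite_fcc_wulff_normals)
  show "norm n = 1" if "n \<in> fcc_wulff_normals" for n using that by (rule fcc_wulff_normals_unit)
  show "0 < fcc_density n" if "n \<in> fcc_wulff_normals" for n
    using fcc_wulff_normals_unit[OF that] by (intro fcc_density_pos) auto
  show "bounded {x. \<forall>n\<in>fcc_wulff_normals. x \<bullet> n \<le> fcc_density n}"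
    using bounded_fcc_wulff by (simp only: fcc_wulff_eq_normals)
qed

text \<open>The witnesses are the facet centres: \<open>4 *\<^sub>R n\<close> on a square facet and
  \<open>2 *\<^sub>R s\<close> on a hexagonal one.\<close>

lemma fcc_relfacet_nonempty:
  assumes n: "n \<in> fcc_wulff_normals"
  shows "fcc.relfacet n \<noteq> {}"
proof -
  consider i s where "n = axis i s" "\<bar>s\<bar> = 1" | s where "n = (1 / sqrt 3) *\<^sub>R s" "\<And>i. \<bar>s $ i\<bar> = 1"
    using n by (auto simp: fcc_wulff_normals_def)
  then show ?thesis
  proof cases
    case 1
    have ss: "s * s = 1" using 1(2) by (metis abs_mult_self_eq mult_1)
    have "4 *\<^sub>R n \<in> fcc.relfacet n"
      unfolding fcc.relfacet_def
    proof (intro CollectI conjI ballI)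
      show "(4 *\<^sub>R n) \<bullet> n = fcc_density n" using 1 ss by (simp add: fcc_density_axis inner_axis_axis)
      fix m assume m: "m \<in> fcc_wulff_normals - {n}"
      then consider j t where "m = axis j t" "\<bar>t\<bar> = 1" | t where "m = (1 / sqrt 3) *\<^sub>R t" "\<And>i. \<bar>t $ i\<bar> = 1"
        by (auto simp: fcc_wulff_normals_def)
      then show "(4 *\<^sub>R n) \<bullet> m < fcc_density m"
      proof cases
        case a: 1
        have "i \<noteq> j \<or> s \<noteq> t" using m 1 a by auto
        then have "axis i s \<bullet> (axis j t :: real ^ 3) < 1" using 1(2) a(2) by (auto simp: inner_axis_axis abs_if split: if_splits)
        then show ?thesis using 1 a by (simp add: fcc_density_axis)
      next
        case b: 2
        have "s * t $ i \<le> 1" using 1(2) b(2)[of i] by (metis abs_ge_self abs_mult mult_1)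
        then show ?thesis using 1 b by (simp add: fcc_density_scaleR norm_signs(2) inner_axis' divide_strict_right_mono)
      qed
    qed
    then show ?thesis by blast
  next
    case 2
    have ss: "s \<bullet> s = 3" using norm_signs(1)[OF 2(2)] by (simp add: dot_square_norm)
    have "2 *\<^sub>R s \<in> fcc.relfacet n"
      unfolding fcc.relfacet_def
    proof (intro CollectI conjI ballI)
      show "(2 *\<^sub>R s) \<bullet> n = fcc_density n" using 2 ss by (simp add: fcc_density_scaleR norm_signs(2))
      fix m assume m: "m \<in> fcc_wulff_normals - {n}"
      then consider j t where "m = axis j t" "\<bar>t\<bar> = 1" | t where "m = (1 / sqrt 3) *\<^sub>R t" "\<And>i. \<bar>t $ i\<bar> = 1"
        by (auto simp: fcc_wulff_normals_def)
      then show "(2 *\<^sub>R s) \<bullet> m < fcc_density m"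
      proof cases
        case a: 1
        have "s $ j * t \<le> 1" using 2(2)[of j] a(2) by (metis abs_ge_self abs_mult mult_1)
        then show ?thesis using 2 a by (simp add: fcc_density_axis inner_axis mult.commute)
      next
        case b: 2
        have "s \<noteq> t" using m 2(1) b(1) by auto
        have st: "s $ i * t $ i \<le> 1" for i using 2(2)[of i] b(2)[of i] by (metis abs_ge_self abs_mult mult_1)
        have "s \<bullet> t < 3"
        proof (rule ccontr)
          assume "\<not> s \<bullet> t < 3"
          then have "s $ 1 * t $ 1 = 1" "s $ 2 * t $ 2 = 1" "s $ 3 * t $ 3 = 1"
            using st[of 1] st[of 2] st[of 3] by (auto simp: inner_vec_def sum_3)
          then have "s $ i * t $ i = 1" for i using exhaust_3[of i] by auto
          then have "s $ i = t $ i" for i using 2(2)[of i] b(2)[of i] by (metis abs_if minus_mult_right mult.right_neutral mult_minus1_right one_neq_neg_one)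
          then show False using \<open>s \<noteq> t\<close> by (simp add: vec_eq_iff)
        qed
        then show ?thesis using 2 b by (simp add: fcc_density_scaleR norm_signs(2) divide_strict_right_mono)
      qed
    qed
    then show ?thesis by blast
  qed
qed

text \<open>The hull and the half-size body \<open>H\<close> are compared through support functions.
  In every direction some vertex attains half the density, so no hyperplane can separate a point of
  \<open>H\<close> from the hull.\<close>

lemma fcc_wulff_convex_hull:
  "fcc_wulff = (*\<^sub>R) 2 ` (convex hull {v :: real ^ 3. range (\<lambda>i. \<bar>v $ i\<bar>) = {0, 1, 2}})"
proof -
  let ?V = "{v :: real ^ 3. range (\<lambda>i. \<bar>v $ i\<bar>) = {0, 1, 2}}"
  define H :: "(real ^ 3) set" where "H = {x. 2 *\<^sub>R x \<in> fcc_wulff}"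
  have range: "range (\<lambda>i. \<bar>v $ i\<bar>) = {\<bar>v $ 1\<bar>, \<bar>v $ 2\<bar>, \<bar>v $ 3\<bar>}" for v :: "real ^ 3"
    by (auto simp: UNIV_3)
  have "convex H"
  proof -
    have "H = (\<Inter>n\<in>fcc_wulff_normals. {x. (2 *\<^sub>R n) \<bullet> x \<le> fcc_density n})"
      unfolding H_def fcc_wulff_eq_normals by (auto simp: inner_commute)
    then show ?thesis by (simp only:) (intro convex_INT convex_halfspace_le)
  qed
  moreover have "?V \<subseteq> H"
  proof
    fix v assume "v \<in> ?V"
    then have eq: "{\<bar>v $ 1\<bar>, \<bar>v $ 2\<bar>, \<bar>v $ 3\<bar>} = {0, 1, 2}" unfolding range by simp
    \<comment> \<open>The three moduli form a set of three elements, so they are distinct and add up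
      to 0 + 1 + 2.\<close>
    have "card {\<bar>v $ 1\<bar>, \<bar>v $ 2\<bar>, \<bar>v $ 3\<bar>} = 3" unfolding eq by simp
    then have "\<bar>v $ 1\<bar> \<noteq> \<bar>v $ 2\<bar>" "\<bar>v $ 1\<bar> \<noteq> \<bar>v $ 3\<bar>" "\<bar>v $ 2\<bar> \<noteq> \<bar>v $ 3\<bar>"
      by (auto simp: card_insert_if split: if_splits)
    then have "\<bar>v $ 1\<bar> + \<bar>v $ 2\<bar> + \<bar>v $ 3\<bar> = \<Sum>{\<bar>v $ 1\<bar>, \<bar>v $ 2\<bar>, \<bar>v $ 3\<bar>}" by simp
    also have "\<dots> = 3" unfolding eq by simp
    finally have "\<bar>v $ 1\<bar> + \<bar>v $ 2\<bar> + \<bar>v $ 3\<bar> = 3" .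
    moreover have "t \<le> 2" if "t \<in> {\<bar>v $ 1\<bar>, \<bar>v $ 2\<bar>, \<bar>v $ 3\<bar>}" for t using that unfolding eq by auto
    ultimately have "\<bar>v $ 1\<bar> \<le> 2 \<and> \<bar>v $ 2\<bar> \<le> 2 \<and> \<bar>v $ 3\<bar> \<le> 2 \<and> \<bar>v $ 1\<bar> + \<bar>v $ 2\<bar> + \<bar>v $ 3\<bar> = 3"
      by blast
    then show "v \<in> H" by (simp add: H_def fcc_wulff_def forall_3 abs_mult)
  qed
  ultimately have sub: "convex hull ?V \<subseteq> H" by (rule hull_minimal[rotated])
  have "finite ?V"
  proof -
    have "?V \<subseteq> (\<lambda>(a, b, c). vector [a, b, c]) ` ({-2, -1, 0, 1, 2} \<times> {-2, -1, 0, 1, 2} \<times> {-2, -1, 0, 1, 2})"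
      (is "_ \<subseteq> ?f ` (?A \<times> ?A \<times> ?A)")
    proof
      fix v assume "v \<in> ?V"
      then have abs: "\<bar>v $ i\<bar> \<in> {0, 1, 2}" for i by blast
      have "v $ i \<in> ?A" for i using abs[of i] by (auto simp: abs_eq_iff')
      then have "(v $ 1, v $ 2, v $ 3) \<in> ?A \<times> ?A \<times> ?A" by blast
      moreover have "v = ?f (v $ 1, v $ 2, v $ 3)" by (simp add: vec_eq_iff forall_3)
      ultimately show "v \<in> ?f ` (?A \<times> ?A \<times> ?A)" by (rule rev_image_eqI)
    qed
    then show ?thesis by (rule finite_subset) auto
  qed
  then have closed: "closed (convex hull ?V)" by (intro compact_imp_closed compact_convex_hull finite_imp_compact)
  \<comment> \<open>The maximising vertex has moduli 2, 1, 0 at the largest, second and smallest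
    modulus of \<open>\<nu>\<close>, with matching signs.\<close>
  have vertex: "\<exists>v\<in>?V. v \<bullet> \<nu> = fcc_density \<nu> / 2" for \<nu>
  proof -
    define g :: "real \<Rightarrow> real" where "g t = (if 0 \<le> t then 1 else - 1)" for t
    have g: "\<bar>g t\<bar> = 1" "g t * t = \<bar>t\<bar>" for t by (simp_all add: g_def)
    have mem: "vector [a, b, c] \<in> ?V" if "{\<bar>a\<bar>, \<bar>b\<bar>, \<bar>c\<bar>} = {0, 1, 2}" for a b c :: real
      using that by (simp add: range)
    have inner: "vector [a, b, c] \<bullet> \<nu> = a * \<nu> $ 1 + b * \<nu> $ 2 + c * \<nu> $ 3" for a b c
      by (simp add: inner_vec_def sum_3)
    let ?a = "\<bar>\<nu> $ 1\<bar>" and ?b = "\<bar>\<nu> $ 2\<bar>" and ?c = "\<bar>\<nu> $ 3\<bar>"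
    consider "?c \<le> ?b" "?b \<le> ?a" | "?b \<le> ?c" "?c \<le> ?a" | "?c \<le> ?a" "?a \<le> ?b"
      | "?a \<le> ?c" "?c \<le> ?b" | "?b \<le> ?a" "?a \<le> ?c" | "?a \<le> ?b" "?b \<le> ?c" by linarith
    then show ?thesis
    proof cases
      case 1
      then have "max ?a ?b = ?a" "max ?a ?c = ?a" "max ?b ?c = ?b" by simp_all
      then have "vector [2 * g (\<nu> $ 1), g (\<nu> $ 2), 0] \<bullet> \<nu> = fcc_density \<nu> / 2"
        by (simp add: inner fcc_density_max mult.assoc g)
      then show ?thesis by (rule bexI) (rule mem, simp add: abs_mult g insert_commute)
    next
      case 2
      then have "max ?a ?b = ?a" "max ?a ?c = ?a" "max ?b ?c = ?c" by simp_all
      then have "vector [2 * g (\<nu> $ 1), 0, g (\<nu> $ 3)] \<bullet> \<nu> = fcc_density \<nu> / 2"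
        by (simp add: inner fcc_density_max mult.assoc g)
      then show ?thesis by (rule bexI) (rule mem, simp add: abs_mult g insert_commute)
    next
      case 3
      then have "max ?a ?b = ?b" "max ?a ?c = ?a" "max ?b ?c = ?b" by simp_all
      then have "vector [g (\<nu> $ 1), 2 * g (\<nu> $ 2), 0] \<bullet> \<nu> = fcc_density \<nu> / 2"
        by (simp add: inner fcc_density_max mult.assoc g)
      then show ?thesis by (rule bexI) (rule mem, simp add: abs_mult g insert_commute)
    next
      case 4
      then have "max ?a ?b = ?b" "max ?a ?c = ?c" "max ?b ?c = ?b" by simp_all
      then have "vector [0, 2 * g (\<nu> $ 2), g (\<nu> $ 3)] \<bullet> \<nu> = fcc_density \<nu> / 2"
        by (simp add: inner fcc_density_max mult.assoc g)
      then show ?thesis by (rule bexI) (rule mem, simp add: abs_mult g insert_commute)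
    next
      case 5
      then have "max ?a ?b = ?a" "max ?a ?c = ?c" "max ?b ?c = ?c" by simp_all
      then have "vector [g (\<nu> $ 1), 0, 2 * g (\<nu> $ 3)] \<bullet> \<nu> = fcc_density \<nu> / 2"
        by (simp add: inner fcc_density_max mult.assoc g)
      then show ?thesis by (rule bexI) (rule mem, simp add: abs_mult g insert_commute)
    next
      case 6
      then have "max ?a ?b = ?b" "max ?a ?c = ?c" "max ?b ?c = ?c" by simp_all
      then have "vector [0, g (\<nu> $ 2), 2 * g (\<nu> $ 3)] \<bullet> \<nu> = fcc_density \<nu> / 2"
        by (simp add: inner fcc_density_max mult.assoc g)
      then show ?thesis by (rule bexI) (rule mem, simp add: abs_mult g insert_commute)
    qed
  qed
  have "H \<subseteq> convex hull ?V"
  proof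
    fix x assume x: "x \<in> H"
    show "x \<in> convex hull ?V"
    proof (rule ccontr)
      assume "x \<notin> convex hull ?V"
      then obtain a b where ab: "a \<bullet> x < b" "\<And>v. v \<in> convex hull ?V \<Longrightarrow> b < a \<bullet> v"
        using separating_hyperplane_closed_point[OF convex_convex_hull closed] by blast
      obtain v where v: "v \<in> ?V" "v \<bullet> (- a) = fcc_density (- a) / 2" using vertex[of "- a"] by blast
      have "2 *\<^sub>R x \<in> fcc_wulff" using x by (simp add: H_def)
      then have "(- a) \<bullet> (2 *\<^sub>R x) \<le> 1 * fcc_density (- a)"
        by (intro inner_le_fcc_density) (simp_all add: fcc_wulff_def)
      then have "(- a) \<bullet> x \<le> v \<bullet> (- a)" using v(2) by simp
      moreover have "b < a \<bullet> v" using v(1) by (intro ab(2) hull_inc)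
      ultimately show False using ab(1) by (simp add: inner_commute)
    qed
  qed
  with sub have hull: "convex hull ?V = H" by blast
  show ?thesis
    unfolding hull
  proof (intro equalityI subsetI)
    fix x assume x: "x \<in> fcc_wulff"
    then have "(1 / 2) *\<^sub>R x \<in> H" by (simp add: H_def)
    then show "x \<in> (*\<^sub>R) 2 ` H" by (intro image_eqI[of _ _ "(1 / 2) *\<^sub>R x"]) auto
  qed (auto simp: H_def)
qed

text \<open>Point reflection in the centre of an octant \<open>\<plusminus>[0,4]\<^sup>3\<close> of the cube maps the part of the Wulff set in it
  onto the closure of the complement, so the Wulff set fills half of the cube.\<close>

lemma measure_fcc_wulff: "measure lebesgue fcc_wulff = 256"
proof -
  define I :: "(real \<times> real \<times> real) set" where "I = {1, -1} \<times> {1, -1} \<times> {1, -1}"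
  define Q where "Q s = (case s of (a, b, c) \<Rightarrow> {x :: real ^ 3. 0 \<le> a * x $ 1 \<and> a * x $ 1 \<le> 4 \<and>
    0 \<le> b * x $ 2 \<and> b * x $ 2 \<le> 4 \<and> 0 \<le> c * x $ 3 \<and> c * x $ 3 \<le> 4})" for s
  define L where "L s = (case s of (a, b, c) \<Rightarrow> Q s \<inter> {x :: real ^ 3. a * x $ 1 + b * x $ 2 + c * x $ 3 \<le> 6})" for s
  define U where "U s = (case s of (a, b, c) \<Rightarrow> Q s \<inter> {x :: real ^ 3. a * x $ 1 + b * x $ 2 + c * x $ 3 \<ge> 6})" for s
  have fin: "finite I" "card I = 8" by (simp_all add: I_def card_cartesian_product)
  have Q: "Q (a, b, c) = cbox (vector [min 0 (4 * a), min 0 (4 * b), min 0 (4 * c)])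
      (vector [max 0 (4 * a), max 0 (4 * b), max 0 (4 * c)])" if "(a, b, c) \<in> I" for a b c
    using that by (auto simp: I_def Q_def mem_box_cart forall_3)
  have Q_measure: "measure lebesgue (Q s) = 64" if "s \<in> I" for s
  proof -
    obtain a b c where s: "s = (a, b, c)" by (cases s)
    let ?l = "vector [min 0 (4 * a), min 0 (4 * b), min 0 (4 * c)] :: real ^ 3"
      and ?u = "vector [max 0 (4 * a), max 0 (4 * b), max 0 (4 * c)] :: real ^ 3"
    have "?l \<in> cbox ?l ?u"
      by (auto simp: mem_box_cart forall_3 intro: order_trans[OF min.cobounded1 max.cobounded1])
    then have "cbox ?l ?u \<noteq> {}" by blast
    then have "measure lebesgue (cbox ?l ?u) = (\<Prod>i\<in>UNIV. ?u $ i - ?l $ i)"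
      by (simp add: content_cbox_cart measure_completion)
    also have "\<dots> = 64" using that unfolding UNIV_3 s I_def by auto
    finally show ?thesis using Q that by (simp add: s)
  qed
  have L_closed: "closed (L s)" and U_closed: "closed (U s)" for s
    unfolding L_def U_def Q_def
    by (cases s; simp add: Collect_conj_eq; intro closed_Int closed_Collect_le continuous_intros)+
  have lm: "S \<in> lmeasurable" if "closed S" "S \<subseteq> Q s" "s \<in> I" for S s
  proof -
    have "bounded (Q s)" using Q that(3) by (cases s) auto
    then have "compact S" using that bounded_subset compact_eq_bounded_closed by blast
    then show ?thesis by (rule lmeasurable_compact)
  qed
  have L_sub: "L s \<subseteq> Q s" and U_sub: "U s \<subseteq> Q s" for s by (auto simp: L_def U_def split: prod.splits)
  note L_lm = lm[OF L_closed L_sub] and U_lm = lm[OF U_closed U_sub]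
  have L_measure: "measure lebesgue (L s) = 32" if sI: "s \<in> I" for s
  proof -
    obtain a b c where s: "s = (a, b, c)" by (cases s)
    have abc: "a * a = 1" "b * b = 1" "c * c = 1" "a \<noteq> 0" using sI by (auto simp: s I_def)
    \<comment> \<open>Twice the centre of the octant, so that \<open>?v - x\<close> is the point
      reflection of \<open>x\<close> in that centre.\<close>
    let ?v = "vector [4 * a, 4 * b, 4 * c] :: real ^ 3"
    have comp: "a * (4 * a - t) = 4 - a * t" "b * (4 * b - t) = 4 - b * t" "c * (4 * c - t) = 4 - c * t" for t
      using abc by (simp_all add: algebra_simps)
    have mem: "?v - x \<in> U s \<longleftrightarrow> x \<in> L s" for x
      by (auto simp: s L_def U_def Q_def comp)
    have img: "U s = (+) ?v ` (uminus ` L s)"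
    proof (intro equalityI subsetI)
      fix x assume "x \<in> U s"
      then have "?v - x \<in> L s" using mem[of "?v - x"] by simp
      then show "x \<in> (+) ?v ` (uminus ` L s)" by (intro image_eqI[of _ _ "- (?v - x)"] imageI) simp
    next
      fix x assume "x \<in> (+) ?v ` (uminus ` L s)"
      then obtain y where "x = ?v - y" "y \<in> L s" by auto
      then show "x \<in> U s" using mem by simp
    qed
    have "orthogonal_transformation (uminus :: real ^ 3 \<Rightarrow> real ^ 3)"
      by (simp add: orthogonal_transformation_def linear_iff)
    then have "measure lebesgue (U s) = measure lebesgue (L s)"
      unfolding img using L_lm[OF sI] by (simp add: measure_translation measure_orthogonal_image)
    moreover have "measure lebesgue (L s \<union> U s) = measure lebesgue (L s) + measure lebesgue (U s)"
    proof -
      have "L s \<inter> U s \<subseteq> {x. vector [a, b, c] \<bullet> x = 6}"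
        by (auto simp: s L_def U_def inner_vec_def sum_3)
      moreover have "negligible {x. vector [a, b, c] \<bullet> x = (6 :: real)}"
        by (rule negligible_hyperplane) simp
      ultimately have "measure lebesgue (L s \<inter> U s) = 0"
        using negligible_imp_measure0 negligible_subset by blast
      then show ?thesis using measure_Un3[OF L_lm[OF sI] U_lm[OF sI]] by simp
    qed
    moreover have "L s \<union> U s = Q s" by (auto simp: L_def U_def s)
    ultimately show ?thesis using Q_measure[OF sI] by simp
  qed
  have union: "fcc_wulff = (\<Union>s\<in>I. L s)"
  proof (intro equalityI subsetI)
    fix x assume x: "x \<in> fcc_wulff"
    define sg where "sg t = (if 0 \<le> t then 1 else - 1 :: real)" for t :: real
    have sg: "sg t * t = \<bar>t\<bar>" "sg t \<in> {1, -1}" for t by (auto simp: sg_def)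
    have "x \<in> L (sg (x $ 1), sg (x $ 2), sg (x $ 3))"
      using x by (simp add: L_def Q_def sg(1) fcc_wulff_def)
    moreover have "(sg (x $ 1), sg (x $ 2), sg (x $ 3)) \<in> I" unfolding I_def using sg(2) by blast
    ultimately show "x \<in> (\<Union>s\<in>I. L s)" by blast
  next
    fix x assume "x \<in> (\<Union>s\<in>I. L s)"
    then obtain a b c where s: "(a, b, c) \<in> I" "x \<in> L (a, b, c)" by auto
    have abs: "\<bar>t\<bar> = a * t" if "0 \<le> a * t" "a \<in> {1, -1}" for a t :: real using that by auto
    have "\<bar>x $ 1\<bar> = a * x $ 1" "\<bar>x $ 2\<bar> = b * x $ 2" "\<bar>x $ 3\<bar> = c * x $ 3"
      using s by (auto simp: L_def Q_def I_def intro!: abs)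
    then show "x \<in> fcc_wulff" using s(2) by (simp add: fcc_wulff_def L_def Q_def forall_3)
  qed
  have "measure lebesgue (\<Union>(L ` I)) = (\<Sum>s\<in>I. measure lebesgue (L s))"
  proof (rule measure_negligible_finite_Union_image[OF fin(1) L_lm])
    show "pairwise (\<lambda>s t. negligible (L s \<inter> L t)) I"
      unfolding pairwise_def
    proof (intro ballI impI)
      fix s t assume st: "s \<in> I" "t \<in> I" "s \<noteq> t"
      have "L s \<inter> L t \<subseteq> {x. axis 1 1 \<bullet> x = 0} \<union> {x. axis 2 1 \<bullet> x = 0} \<union> {x. axis 3 1 \<bullet> x = 0}"
        using st by (auto simp: I_def L_def Q_def inner_axis')
      moreover have "negligible {x :: real ^ 3. axis i 1 \<bullet> x = 0}" for i
        by (rule negligible_hyperplane) (simp add: axis_eq_0_iff)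
      then have "negligible ({x :: real ^ 3. axis 1 1 \<bullet> x = 0} \<union> {x. axis 2 1 \<bullet> x = 0} \<union> {x. axis 3 1 \<bullet> x = 0})"
        by (intro negligible_Un)
      ultimately show "negligible (L s \<inter> L t)" by (rule negligible_subset[rotated])
    qed
  qed
  also have "\<dots> = 256" using L_measure fin(2) by simp
  finally show ?thesis unfolding union .
qed

theorem proposition2p4:
  shows "(\<forall>\<nu> :: real ^ 3. phi_FCC \<nu> =
            \<bar>\<nu> $ 1 + \<nu> $ 2\<bar> + \<bar>\<nu> $ 1 + \<nu> $ 3\<bar> + \<bar>\<nu> $ 2 + \<nu> $ 3\<bar> +
            \<bar>\<nu> $ 1 - \<nu> $ 2\<bar> + \<bar>\<nu> $ 1 - \<nu> $ 3\<bar> + \<bar>\<nu> $ 2 - \<nu> $ 3\<bar>) \<and>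
         (\<forall>\<zeta> :: real ^ 3. polar_function phi_FCC \<zeta> =
            max (1 / 4 * infnorm \<zeta>) (1 / 6 * (\<Sum>i\<in>UNIV. \<bar>\<zeta> $ i\<bar>))) \<and>
         is_truncated_octahedron W_FCC \<and>
         measure lebesgue W_FCC powr (- (2 / 3)) * surface_energy phi_FCC W_FCC =
            3 * 2 ^ 2 * 2 powr (2 / 3)"
proof -
  have W: "W_FCC = fcc_wulff" by (simp add: W_FCC_def phi_FCC_eq wulff_set_fcc_density)
  have "is_truncated_octahedron W_FCC"
    unfolding is_truncated_octahedron_def W
  proof (intro exI conjI)
    show "(0 :: real) < 2" by simp
    show "orthogonal_transformation (id :: real ^ 3 \<Rightarrow> real ^ 3)" by (simp add: orthogonal_transformation_def linear_id)
    show "fcc_wulff = (\<lambda>x. 0 + 2 *\<^sub>R id x) ` (convex hull {v :: real ^ 3. range (\<lambda>i. \<bar>v $ i\<bar>) = {0, 1, 2}})"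
      using fcc_wulff_convex_hull by simp
  qed
  moreover have "measure lebesgue W_FCC powr (- (2 / 3)) * surface_energy phi_FCC W_FCC = 3 * 2 ^ 2 * 2 powr (2 / 3)"
  proof -
    have "surface_energy phi_FCC W_FCC = 3 * 256"
      using fcc.surface_energy_polytope[OF fcc_relfacet_nonempty refl] measure_fcc_wulff
      unfolding W phi_FCC_eq by (simp add: fcc_wulff_eq_normals[symmetric])
    \<comment> \<open>Here 768 is 3 times 2 to the power 2 times 2 to the power 6, and 6 - 16/3 =
      2/3.\<close>
    moreover have "(256 :: real) powr (- (2 / 3)) * (3 * 256) = 3 * 2 ^ 2 * 2 powr (2 / 3)"
    proof -
      have "(256 :: real) = 2 powr 8" by simp
      then have "(256 :: real) powr (- (2 / 3)) = 2 powr (- 16 / 3)" by (simp only: powr_powr) simp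
      moreover have "(2 :: real) powr (2 / 3) = 2 powr (- 16 / 3) * 2 powr 6" unfolding powr_add[symmetric] by simp
      ultimately show ?thesis by simp
    qed
    ultimately show ?thesis by (simp add: W measure_fcc_wulff)
  qed
  ultimately show ?thesis
    by (simp add: phi_FCC_eq fcc_density_def polar_function_fcc_density)
qed

end
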